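(* Let $(Y,\varrho)$ be a Polish space, $I=\{1,\dots,N\}$, $S=\{1,\dots,K\}$, $\lambda>0$. Let $\Pi_i:\mathbb{R}_+\times Y\to Y$ ($i\in I$) be continuous semidynamical systems, $q_s:Y\to Y$ ($s\in S$) continuous maps, $(\overline p_s)_{s\in S}$, $\overline p_s:Y\to[0,1]$, a probability vector and $[p_{ij}]_{i,j\in I}$, $p_{ij}:Y\to[0,1]$, a probability matrix. Let $(x_n,\xi_n)_{n\ge 0}$ be the associated Markov chain of post-jump locations on $Y\times I$ and $P^*$ its transition operator on measures (both described in the context). Assume: (1) there exists $x_*\in Y$ such that $\int_{\mathbb{R}_+}e^{-\lambda t}\varrho\big(q_s(\Pi_j(t,x_* )),q_s(x_* )\big)\,dt<\infty$ for all $j\in I$, $s\in S$ (fix such an $x_*$); (2) there are $L_p,L_{\overline p}>0$ such that $\sum_{j\in I}|p_{ij}(x)-p_{ij}(y)|\le L_p\varrho(x,y)$ and $\sum_{s\in S}|\overline p_s(x)-\overline p_s(y)|\le L_{\overline p}\varrho(x,y)$ for all $x,y\in Y$, $i\in I$; (3) there are constants $L\ge 1$, $\alpha\in\mathbb{R}$, $L_q>0$ such that $$\sum_{j\in I}p_{ij}(y)\varrho(\Pi_j(t,x),\Pi_j(t,y))\le Le^{\alpha t}\varrho(x,y)\quad\text{for } x,y\in Y,\ i\in I,\ t\ge 0,$$ $$\sum_{s\in S}\overline p_s(x)\varrho(q_s(x),q_s(y))\le L_q\varrho(x,y)\quad\text{for } x,y\in Y;$$ (4) with $I_\Pi(t,x,y)=\{j\in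 I:\varrho(\Pi_j(t,x),\Pi_j(t,y))\le Le^{\alpha t}\varrho(x,y)\}$ and $I_q(x,y)=\{s\in S:\varrho(q_s(x),q_s(y))\le L_q\varrho(x,y)\}$, there are $p_0>0$, $q_0>0$ such that for every $i_1,i_2\in I$, $x,y\in Y$ and $t\ge 0$ $$\sum_{j\in I_\Pi(t,x,y)}p_{i_1j}(x)p_{i_2j}(y)>p_0,\qquad \sum_{s\in I_q(x,y)}\overline p_s(x)\overline p_s(y)>q_0;$$ (5) $LL_q+\dfrac{\alpha}{\lambda}<1$. Then: (i) there exists a unique invariant measure $\mu_*\in\mathcal{M}_1^1(Y\times I)$ for the process $(x_n,\xi_n)_{n\ge 0}$, and it is attractive in $\mathcal{M}_1(Y\times I)$; (ii) there exist $q\in(0,1)$ and $C>0$ such that for all $\mu\in\mathcal{M}_1^1(Y\times I)$ and $n\in\mathbb{N}$ $$\|P^{*n}\mu-\mu_*\|_{FM}\le q^nC\Big(1+\int_{Y\times I}\varrho(x,x_* )\,\mu(dx,di)\Big);$$ (iii) the strong law of large numbers holds for the process $(x_n,\xi_n)_{n\ge 0}$ started from any point: for every bounded Lipschitz function $f:Y\times I\to\mathbb{R}$ and every $x_0\in Y$, $\xi_0\in I$, $$\lim_{n\to\infty}\frac1n\sum_{k=0}^{n-1}f(x_k,\xi_k)=\int_{Y\times I}f(x,\xi)\,\mu_*(dx,d\xi)$$ $\mathbb{P}_{x_0,\xi_0}$-almost surely.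
   Context: Polish space: complete separable metric space. $\mathbb{R}_+=[0,+\infty)$; $N,K$ are positive integers. A semidynamical system $\Pi_i$ satisfies $\Pi_i(0,x)=x$ and $\Pi_i(s+t,x)=\Pi_i(s,\Pi_i(t,x))$ for $s,t\ge 0$, $x\in Y$. Probability vector: $\sum_{s\in S}\overline p_s(x)=1$ for all $x\in Y$. Probability matrix: $\sum_{j\in I}p_{ij}(x)=1$ for all $x\in Y$, $i\in I$. The space $X=Y\times I$ carries the metric $d((x,i),(y,j))=\varrho(x,y)+\varrho_d(i,j)$, where $\varrho_d$ is the discrete metric on $I$. The Markov chain. Let $0=t_0<t_1<t_2<\dots$ be random times whose increments $\Delta t_n=t_n-t_{n-1}$ are independent with common density $\lambda e^{-\lambda t}$, $t\ge 0$. Given $(x_{n-1},\xi_{n-1})$, put $y_n=\Pi_{\xi_{n-1}}(\Delta t_n,x_{n-1})$, choose $\eta_n\in S$ with $\mathbb{P}(\eta_n=s\mid y_n=y)=\overline p_s(y)$, set $x_n=q_{\eta_n}(y_n)$, and choose $\xi_n\in I$ with $\mathbb{P}(\xi_n=k\mid x_n=x,\ \xi_{n-1}=i)=p_{ik}(x)$. The evolution of the chain $(x_n,\xi_n)_{n\ge 0}$ is given by the Markov operator on bounded Borel functions $$Uf(x,i)=\sum_{j\in I}\sum_{s\in S}\int_0^{+\infty}\lambda e^{-\lambda t}f\big(q_s(\Pi_j(t,x)),j\big)\,p_{ij}(x)\,\overline p_s(\Pi_j(t,x))\,dt,$$ and the corresponding operator on Borel measures, denoted $P^*$, is $$P^*\mu(A)=\sum_{j\in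 I}\sum_{s\in S}\int_{Y\times I}\int_0^{+\infty}\lambda e^{-\lambda t}1_A\big(q_s(\Pi_j(t,x)),j\big)\,p_{ij}(x)\,\overline p_s(\Pi_j(t,x))\,dt\,\mu(dx,di),$$ for Borel $A\subset Y\times I$. $\mathbb{P}_{x_0,\xi_0}$ denotes the law of the Markov chain with this transition operator started at $(x_0,\xi_0)$. Measures. $\mathcal{M}_1(X)$ is the set of Borel probability measures on $X$; $\mathcal{M}_1^1(X)=\{\mu\in\mathcal{M}_1(X):\int_X d(\bar x,x)\,\mu(dx)<\infty\}$ for a fixed (equivalently, any) $\bar x\in X$. The Fortet–Mourier metric is $\|\mu_1-\mu_2\|_{FM}=\sup\{|\int_X f\,d(\mu_1-\mu_2)|: f\in\mathcal{F}\}$, where $\mathcal{F}$ is the set of continuous bounded $f:X\to\mathbb{R}$ with $|f(x)-f(y)|\le d(x,y)$ and $|f(x)|\le 1$ for all $x,y\in X$. A measure $\mu_*\in\mathcal{M}_1(X)$ is invariant if $P^*\mu_*=\mu_*$. An invariant measure $\mu_*$ is attractive in $\mathcal{M}_1(X)$ if $\lim_{n\to\infty}\int_X U^nf\,d\mu=\int_X f\,d\mu_*$ for every bounded continuous $f:X\to\mathbb{R}$ and every $\mu\in\mathcal{M}_1(X)$. *)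

theory Defs
  imports "HOL-Probability.Probability"
begin

definition semidynamical_system :: "(real \<Rightarrow> 'y::topological_space \<Rightarrow> 'y) \<Rightarrow> bool" where
  "semidynamical_system \<phi> \<longleftrightarrow>
     continuous_on ({0..} \<times> UNIV) (\<lambda>(t, x). \<phi> t x) \<and>
     (\<forall>x. \<phi> 0 x = x) \<and>
     (\<forall>s\<ge>0. \<forall>t\<ge>0. \<forall>x. \<phi> (s + t) x = \<phi> s (\<phi> t x))"

definition probability_vector :: "nat \<Rightarrow> (nat \<Rightarrow> 'y \<Rightarrow> real) \<Rightarrow> bool" where
  "probability_vector K pb \<longleftrightarrow>
     (\<forall>s\<in>{1..K}. \<forall>x. pb s x \<in> {0..1}) \<and> (\<forall>x. (\<Sum>s\<in>{1..K}. pb s x) = 1)"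

definition probability_matrix :: "nat \<Rightarrow> (nat \<Rightarrow> nat \<Rightarrow> 'y \<Rightarrow> real) \<Rightarrow> bool" where
  "probability_matrix N p \<longleftrightarrow>
     (\<forall>i\<in>{1..N}. \<forall>j\<in>{1..N}. \<forall>x. p i j x \<in> {0..1}) \<and>
     (\<forall>i\<in>{1..N}. \<forall>x. (\<Sum>j\<in>{1..N}. p i j x) = 1)"

definition state_set :: "nat \<Rightarrow> ('y \<times> nat) set" where
  "state_set N = UNIV \<times> {1..N}"

text \<open>The library metric on a product of two metric types is the Euclidean one, and
  \<^typ>\<open>nat\<close> carries only a (discrete) topology, so the metric of the state space is
  defined separately. It induces the subspace topology of the product type (lemma \<open>mtopology_state_dist\<close> below), so that
  \<^const>\<open>continuous_on\<close> and \<^const>\<open>borel\<close> of the product type can be used.\<close>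

definition state_dist :: "'y::metric_space \<times> nat \<Rightarrow> 'y \<times> nat \<Rightarrow> real" where
  "state_dist z w = dist (fst z) (fst w) + (if snd z = snd w then 0 else 1)"

lemma Metric_space_state_dist: "Metric_space (state_set N) (state_dist :: 'y::metric_space \<times> nat \<Rightarrow> _)"
proof
  fix z w v :: "'y \<times> nat"
  show "0 \<le> state_dist z w" "state_dist z w = state_dist w z"
    by (auto simp: state_dist_def dist_commute)
  show "state_dist z w = 0 \<longleftrightarrow> z = w"
    by (auto simp: state_dist_def prod_eq_iff add_nonneg_eq_0_iff)
  show "state_dist z v \<le> state_dist z w + state_dist w v"
    using dist_triangle[of "fst z" "fst v" "fst w"] by (auto simp: state_dist_def)
qed

lemma mtopology_state_dist:
  "Metric_space.mtopology (state_set N) (state_dist :: 'y::metric_space \<times> nat \<Rightarrow> _)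
     = top_of_set (state_set N)"
proof -
  interpret S: Metric_space "state_set N" "state_dist :: 'y \<times> nat \<Rightarrow> _"
    by (rule Metric_space_state_dist)
  have snd_eq: "snd z = snd w" if "state_dist z w < 1" for z w :: "'y \<times> nat"
    using that zero_le_dist[of "fst z" "fst w"]
    by (auto simp: state_dist_def simp del: zero_le_dist split: if_splits)
  show ?thesis
  proof (rule topology_eq[THEN iffD2], intro allI iffI)
    fix U :: "('y \<times> nat) set"
    assume U: "openin S.mtopology U"
    then have sub: "U \<subseteq> state_set N" by (simp add: S.openin_mtopology)
    have "open U"
      unfolding open_prod_def
    proof
      fix z assume "z \<in> U"
      with U obtain r where r: "r > 0" "S.mball z r \<subseteq> U" unfolding S.openin_mtopology by blast
      have "ball (fst z) r \<times> {snd z} \<subseteq> S.mball z r"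
        using subsetD[OF sub \<open>z \<in> U\<close>] unfolding subset_iff S.in_mball
        by (cases z) (auto simp: state_dist_def state_set_def)
      then have "ball (fst z) r \<times> {snd z} \<subseteq> U" using r by blast
      moreover have "open {snd z}" by (rule Topological_Spaces.open_discrete)
      moreover have "z \<in> ball (fst z) r \<times> {snd z}" using r by (simp add: mem_Times_iff)
      ultimately show "\<exists>A B. open A \<and> open B \<and> z \<in> A \<times> B \<and> A \<times> B \<subseteq> U"
        by - (rule exI, rule exI, intro conjI, rule open_ball, assumption+)
    qed
    with sub show "openin (top_of_set (state_set N)) U"
      by (auto simp: openin_open)
  next
    fix U :: "('y \<times> nat) set"
    assume "openin (top_of_set (state_set N)) U"
    then obtain T where T: "open T" "U = state_set N \<inter> T" by (auto simp: openin_open)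
    show "openin S.mtopology U"
      unfolding S.openin_mtopology
    proof (intro conjI allI impI)
      fix z assume "z \<in> U"
      then have "z \<in> T" by (simp add: T(2))
      with T(1) obtain A B where AB: "open A" "z \<in> A \<times> B" "A \<times> B \<subseteq> T"
        by (rule open_prod_elim)
      then have "fst z \<in> A" by (simp add: mem_Times_iff)
      with AB(1) obtain e where e: "e > 0" "ball (fst z) e \<subseteq> A" by (rule openE)
      have "S.mball z (min e 1) \<subseteq> U"
      proof
        fix w assume w: "w \<in> S.mball z (min e 1)"
        then have "state_dist z w < 1" and "state_dist z w < e" and "w \<in> state_set N"
          unfolding S.in_mball by linarith+
        from \<open>state_dist z w < 1\<close> have "snd w = snd z" using snd_eq[of z w] by simp
        moreover have "fst w \<in> ball (fst z) e"
          using \<open>state_dist z w < e\<close> \<open>snd w = snd z\<close> by (simp add: state_dist_def)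
        ultimately have "fst w \<in> A" "snd w \<in> B"
          using subsetD[OF e(2)] AB(2) by (simp_all add: mem_Times_iff)
        then have "w \<in> T" using subsetD[OF AB(3)] by (simp add: mem_Times_iff)
        with \<open>w \<in> state_set N\<close> show "w \<in> U" by (simp add: T(2))
      qed
      moreover have "0 < min e 1" using e(1) by simp
      ultimately show "\<exists>r>0. S.mball z r \<subseteq> U" by (intro exI conjI)
    qed (simp add: T(2))
  qed
qed

definition state_space :: "nat \<Rightarrow> ('y::topological_space \<times> nat) measure" where
  "state_space N = restrict_space borel (state_set N)"

definition prob_measures :: "nat \<Rightarrow> ('y::topological_space \<times> nat) measure set" where
  "prob_measures N = {\<mu>. sets \<mu> = sets (state_space N) \<and> prob_space \<mu>}"

definition prob_measures1 :: "nat \<Rightarrow> ('y::metric_space \<times> nat) measure set" where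
  "prob_measures1 N = {\<mu> \<in> prob_measures N.
     \<exists>z\<in>state_set N. (\<integral>\<^sup>+ w. ennreal (state_dist z w) \<partial>\<mu>) < \<infinity>}"

definition FM_class :: "nat \<Rightarrow> ('y::metric_space \<times> nat \<Rightarrow> real) set" where
  "FM_class N = {f. continuous_on (state_set N) f \<and> bounded (f ` state_set N) \<and>
     (\<forall>z\<in>state_set N. \<forall>w\<in>state_set N. \<bar>f z - f w\<bar> \<le> state_dist z w) \<and>
     (\<forall>z\<in>state_set N. \<bar>f z\<bar> \<le> 1)}"

definition FM_dist :: "nat \<Rightarrow> ('y::metric_space \<times> nat) measure \<Rightarrow> ('y \<times> nat) measure \<Rightarrow> real" where
  "FM_dist N \<mu> \<nu> = (SUP f\<in>FM_class N. \<bar>(\<integral>z. f z \<partial>\<mu>) - (\<integral>z. f z \<partial>\<nu>)\<bar>)"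

definition U_op :: "nat \<Rightarrow> nat \<Rightarrow> real \<Rightarrow> (nat \<Rightarrow> real \<Rightarrow> 'y \<Rightarrow> 'y) \<Rightarrow> (nat \<Rightarrow> 'y \<Rightarrow> 'y) \<Rightarrow>
    (nat \<Rightarrow> 'y \<Rightarrow> real) \<Rightarrow> (nat \<Rightarrow> nat \<Rightarrow> 'y \<Rightarrow> real) \<Rightarrow> ('y \<times> nat \<Rightarrow> real) \<Rightarrow> 'y \<times> nat \<Rightarrow> real" where
  "U_op N K lam \<Phi> q pb p f = (\<lambda>(x, i). \<Sum>j\<in>{1..N}. \<Sum>s\<in>{1..K}.
     (LINT t:{0..}|lborel. lam * exp (- (lam * t)) * f (q s (\<Phi> j t x), j) * p i j x * pb s (\<Phi> j t x)))"

text \<open>One step from \<open>(x, i)\<close>: the index \<open>j\<close> is drawn from \<open>p i \<cdot> x\<close>, the flow \<open>\<Phi> j\<close> runs for an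
  exponential time, and then \<open>q s\<close> is applied with \<open>s\<close> drawn from \<open>pb\<close> at the end point of the
  flow; the new state carries the index \<open>j\<close>. Note that \<^const>\<open>measure_of\<close> returns the null measure when the
  set function is not countably additive; for continuous \<open>\<Phi> j\<close>, \<open>q s\<close> and measurable
  nonnegative \<open>pb s\<close>, \<open>p i j\<close> it is countably additive.\<close>

definition P_op :: "nat \<Rightarrow> nat \<Rightarrow> real \<Rightarrow> (nat \<Rightarrow> real \<Rightarrow> 'y \<Rightarrow> 'y) \<Rightarrow> (nat \<Rightarrow> 'y \<Rightarrow> 'y) \<Rightarrow>
    (nat \<Rightarrow> 'y \<Rightarrow> real) \<Rightarrow> (nat \<Rightarrow> nat \<Rightarrow> 'y \<Rightarrow> real) \<Rightarrow>
    ('y::topological_space \<times> nat) measure \<Rightarrow> ('y \<times> nat) measure" where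
  "P_op N K lam \<Phi> q pb p \<mu> = measure_of (state_set N) (sets (state_space N))
     (\<lambda>A. \<Sum>j\<in>{1..N}. \<Sum>s\<in>{1..K}. \<integral>\<^sup>+ (x, i). (\<integral>\<^sup>+ t\<in>{0..}.
        ennreal (lam * exp (- (lam * t)) * indicator A (q s (\<Phi> j t x), j) * p i j x * pb s (\<Phi> j t x))
        \<partial>lborel) \<partial>\<mu>)"

definition invariant_measure :: "nat \<Rightarrow> nat \<Rightarrow> real \<Rightarrow> (nat \<Rightarrow> real \<Rightarrow> 'y \<Rightarrow> 'y) \<Rightarrow> (nat \<Rightarrow> 'y \<Rightarrow> 'y) \<Rightarrow>
    (nat \<Rightarrow> 'y \<Rightarrow> real) \<Rightarrow> (nat \<Rightarrow> nat \<Rightarrow> 'y \<Rightarrow> real) \<Rightarrow>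
    ('y::topological_space \<times> nat) measure \<Rightarrow> bool" where
  "invariant_measure N K lam \<Phi> q pb p \<mu> \<longleftrightarrow>
     \<mu> \<in> prob_measures N \<and> P_op N K lam \<Phi> q pb p \<mu> = \<mu>"

definition attractive_measure :: "nat \<Rightarrow> nat \<Rightarrow> real \<Rightarrow> (nat \<Rightarrow> real \<Rightarrow> 'y \<Rightarrow> 'y) \<Rightarrow> (nat \<Rightarrow> 'y \<Rightarrow> 'y) \<Rightarrow>
    (nat \<Rightarrow> 'y \<Rightarrow> real) \<Rightarrow> (nat \<Rightarrow> nat \<Rightarrow> 'y \<Rightarrow> real) \<Rightarrow>
    ('y::topological_space \<times> nat) measure \<Rightarrow> bool" where
  "attractive_measure N K lam \<Phi> q pb p \<mu>\<^sub>0 \<longleftrightarrow>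
     (\<forall>f. continuous_on (state_set N) f \<and> bounded (f ` state_set N) \<longrightarrow>
        (\<forall>\<mu>\<in>prob_measures N.
           (\<lambda>n. \<integral>z. (U_op N K lam \<Phi> q pb p ^^ n) f z \<partial>\<mu>) \<longlonglongrightarrow> (\<integral>z. f z \<partial>\<mu>\<^sub>0)))"

text \<open>The law of the chain started at \<open>z\<^sub>0\<close>, on the space of trajectories: the Ionescu-Tulcea
  measure whose initial distribution is the point mass at \<open>z\<^sub>0\<close> and whose one-step transition
  probability from a state \<open>z\<close> is the image of the point mass at \<open>z\<close> under \<^const>\<open>P_op\<close>.\<close>

definition chain_step :: "nat \<Rightarrow> nat \<Rightarrow> real \<Rightarrow> (nat \<Rightarrow> real \<Rightarrow> 'y \<Rightarrow> 'y) \<Rightarrow> (nat \<Rightarrow> 'y \<Rightarrow> 'y) \<Rightarrow>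
    (nat \<Rightarrow> 'y \<Rightarrow> real) \<Rightarrow> (nat \<Rightarrow> nat \<Rightarrow> 'y \<Rightarrow> real) \<Rightarrow> 'y \<times> nat \<Rightarrow>
    nat \<Rightarrow> (nat \<Rightarrow> 'y::topological_space \<times> nat) \<Rightarrow> ('y \<times> nat) measure" where
  "chain_step N K lam \<Phi> q pb p z\<^sub>0 n \<omega> = (case n of
       0 \<Rightarrow> return (state_space N) z\<^sub>0
     | Suc m \<Rightarrow> P_op N K lam \<Phi> q pb p (return (state_space N) (\<omega> m)))"

definition chain_law :: "nat \<Rightarrow> nat \<Rightarrow> real \<Rightarrow> (nat \<Rightarrow> real \<Rightarrow> 'y \<Rightarrow> 'y) \<Rightarrow> (nat \<Rightarrow> 'y \<Rightarrow> 'y) \<Rightarrow>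
    (nat \<Rightarrow> 'y \<Rightarrow> real) \<Rightarrow> (nat \<Rightarrow> nat \<Rightarrow> 'y \<Rightarrow> real) \<Rightarrow> 'y::topological_space \<times> nat \<Rightarrow>
    (nat \<Rightarrow> 'y \<times> nat) measure" where
  "chain_law N K lam \<Phi> q pb p z\<^sub>0 =
     projective_family.lim UNIV
       (Ionescu_Tulcea.CI (chain_step N K lam \<Phi> q pb p z\<^sub>0) (\<lambda>_. state_space N))
       (\<lambda>_. state_space N)"

end

theory Submission
  imports Defs
begin

text \<open>The chain is realised by random maps: proposals (flow index, jump index, waiting time) are drawn
  until one is accepted with the probability weight it has at the current state. Run from two states
  on the same proposals, this map moves both by the same flow, jump and time with probability at least
  of the order of the overlap of their weights.

  Let \<open>V\<close> be the distance to \<open>x\<^sub>*\<close>. A bounded cost \<open>c\<^sub>0\<close> equal to \<open>1\<close> for different indices or large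
  distance, to \<open>\<sigma> D\<close> for small distance \<open>D\<close>, and slowly growing in between, is contracted in mean
  whenever \<open>D\<close> is below a threshold \<open>R\<close>, and beyond \<open>R\<close> the drift of \<open>V\<close> takes over. By Cauchy-Schwarz the
  cost \<open>sqrt (c\<^sub>0 (1 + \<beta> V + \<beta> V))\<close> is contracted by a constant factor in mean for every pair of states,
  as in the weak Harris theorem of Hairer, Mattingly and Scheutzow.

  Composing independent copies of the random map with the newest one innermost, the iterates then
  converge almost surely, to a limit that does not depend on the starting point; its law is the
  invariant measure. This avoids Prokhorov's theorem and gives attraction for all bounded continuous
  functions by dominated convergence. The strong law follows from exponentially decaying
  covariances by Chebyshev's inequality along the squares.\<close>

section \<open>Coupling by rejection sampling\<close>

text \<open>A coupling of two given states would not be enough: the almost sure limit needs one map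
  defined for all states at once, driven by noise that does not know the partner. Rejection gives
  such a map because the weights sum to 1 at every state and time, so the acceptance rate is the
  same everywhere. The price is a factor 2: given that one of two states accepts, the overlap is
  divided by a probability of up to twice the acceptance rate.

  Distances need not contract along the coupling. The averaged bounds weigh with one state only and
  control the common proposals; the others are controlled only for equal indices, where their mass
  is at most a constant times the distance. The slope \<open>\<sigma>\<close> of the cost is taken
  so large that this mass is absorbed. For different indices nothing is small and only the overlap
  helps, hence the constant cost 1 there.

  The square root joins the two regimes: in each of them one factor shrinks and the other grows by
  less, so the product of the two means contracts. As the cost tends to 0 at the diagonal, the
  contraction also yields the continuity of \<open>U f\<close> needed for invariance.\<close>

locale rejection_sampler = prob_space Q for Q :: "'w measure" +
  fixes S :: "'x measure" and T :: "'x \<Rightarrow> 'w \<Rightarrow> 'x" and acc :: "'x \<Rightarrow> 'w \<Rightarrow> bool" and \<theta> :: real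
  assumes measurable_T: "(\<lambda>(x, w). T x w) \<in> S \<Otimes>\<^sub>M Q \<rightarrow>\<^sub>M S"
    and pred_acc: "Measurable.pred (S \<Otimes>\<^sub>M Q) (\<lambda>(x, w). acc x w)"
    and \<theta>_pos: "\<theta> > 0"
    and emeasure_acc: "\<And>x. x \<in> space S \<Longrightarrow> emeasure Q {w\<in>space Q. acc x w} = ennreal \<theta>"
begin

text \<open>The proposals are the entries of a stream, and the first accepted one is used. Running all
  starting points on the same stream is what couples them.\<close>

definition sample :: "'x \<Rightarrow> 'w stream \<Rightarrow> 'x" where
  "sample x \<omega> = (if \<exists>n. acc x (\<omega> !! n) then T x (\<omega> !! (LEAST n. acc x (\<omega> !! n))) else x)"

text \<open>The recursion through the head of the stream is the source of every distributional fact
  about \<open>sample\<close>: a rejected head leaves an independent copy of the same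
  experiment.\<close>

lemma sample_Stream: "sample x (w ## \<omega>) = (if acc x w then T x w else sample x \<omega>)"
proof -
  have ex: "(\<exists>n. acc x ((w ## \<omega>) !! n)) \<longleftrightarrow> acc x w \<or> (\<exists>n. acc x (\<omega> !! n))"
    by (metis snth.simps(1) snth.simps(2) stream.sel(1) stream.sel(2) not0_implies_Suc)
  show ?thesis
  proof (cases "acc x w")
    case True
    then have "(LEAST n. acc x ((w ## \<omega>) !! n)) = 0" by (intro Least_equality) auto
    with True show ?thesis unfolding sample_def ex by simp
  next
    case False
    show ?thesis
    proof (cases "\<exists>n. acc x (\<omega> !! n)")
      case True
      then obtain n where n: "acc x (\<omega> !! n)" by auto
      have "(LEAST n. acc x ((w ## \<omega>) !! n)) = Suc (LEAST n. acc x ((w ## \<omega>) !! Suc n))"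
        by (rule Least_Suc[of _ "Suc n"]) (use n False in auto)
      with True False show ?thesis unfolding sample_def ex by simp
    next
      case F: False
      with False show ?thesis unfolding sample_def ex by simp
    qed
  qed
qed

lemma measurable_T'[measurable (raw)]:
  assumes "f \<in> M \<rightarrow>\<^sub>M S" "g \<in> M \<rightarrow>\<^sub>M Q" shows "(\<lambda>z. T (f z) (g z)) \<in> M \<rightarrow>\<^sub>M S"
  using measurable_compose[OF measurable_Pair[OF assms] measurable_T] by simp

lemma pred_acc'[measurable (raw)]:
  assumes "f \<in> M \<rightarrow>\<^sub>M S" "g \<in> M \<rightarrow>\<^sub>M Q" shows "Measurable.pred M (\<lambda>z. acc (f z) (g z))"
  using measurable_compose[OF measurable_Pair[OF assms] pred_acc] by simp

lemma measurable_sample[measurable]: "(\<lambda>(x, \<omega>). sample x \<omega>) \<in> S \<Otimes>\<^sub>M stream_space Q \<rightarrow>\<^sub>M S"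
proof -
  have [measurable]: "(\<lambda>z. T (fst z) (snd z !! (LEAST n. acc (fst z) (snd z !! n))))
      \<in> S \<Otimes>\<^sub>M stream_space Q \<rightarrow>\<^sub>M S"
    by (rule measurable_compose_countable[where f="\<lambda>n z. T (fst z) (snd z !! n)"]) measurable
  show ?thesis
    unfolding sample_def case_prod_beta by measurable
qed

lemma measurable_sample'[measurable (raw)]:
  assumes "f \<in> M \<rightarrow>\<^sub>M S" "g \<in> M \<rightarrow>\<^sub>M stream_space Q" shows "(\<lambda>z. sample (f z) (g z)) \<in> M \<rightarrow>\<^sub>M S"
  using measurable_compose[OF measurable_Pair[OF assms] measurable_sample] by simp

lemma emeasure_not_acc:
  assumes [measurable]: "x \<in> space S"
  shows "emeasure Q {w\<in>space Q. \<not> acc x w} = ennreal (1 - \<theta>)" "\<theta> \<le> 1"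
proof -
  have m: "measure Q {w\<in>space Q. acc x w} = \<theta>"
    using emeasure_acc[OF assms] \<theta>_pos by (simp add: emeasure_eq_measure)
  then show "\<theta> \<le> 1" by (metis prob_le_1)
  show "emeasure Q {w\<in>space Q. \<not> acc x w} = ennreal (1 - \<theta>)"
    using prob_neg[of "acc x"] m by (simp add: emeasure_eq_measure)
qed

text \<open>Conditioning on the first proposal turns the wanted probability \<open>I\<close> into a
  solution of \<open>I = J + I * (1 - \<theta>)\<close>. Since \<open>\<theta> > 0\<close> it is
  determined, and the default value of \<open>sample\<close> for a stream without acceptance
  contributes nothing. The product form avoids a quotient of extended reals.\<close>

lemma emeasure_sample:
  assumes x[measurable]: "x \<in> space S" and A[measurable]: "A \<in> sets S"
  shows "ennreal \<theta> * emeasure (stream_space Q) {\<omega>\<in>space (stream_space Q). sample x \<omega> \<in> A}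
    = emeasure Q {w\<in>space Q. acc x w \<and> T x w \<in> A}"
proof -
  interpret Om: prob_space "stream_space Q" by (rule prob_space_stream_space)
  let ?P = "\<lambda>\<omega>. sample x \<omega> \<in> A"
  define I where "I = Om.prob {\<omega>\<in>space (stream_space Q). ?P \<omega>}"
  have I: "emeasure (stream_space Q) {\<omega>\<in>space (stream_space Q). ?P \<omega>} = ennreal I"
    by (simp add: I_def Om.emeasure_eq_measure)
  define J where "J = prob {w\<in>space Q. acc x w \<and> T x w \<in> A}"
  have J: "emeasure Q {w\<in>space Q. acc x w \<and> T x w \<in> A} = ennreal J"
    by (simp add: J_def emeasure_eq_measure)
  have "ennreal I = (\<integral>\<^sup>+w. emeasure (stream_space Q) {\<omega>\<in>space (stream_space Q). ?P (w ## \<omega>)} \<partial>Q)"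
    by (subst I[symmetric], subst emeasure_stream_space)
      (auto simp: stream_space_Stream intro!: nn_integral_cong arg_cong[where f="emeasure _"])
  also have "\<dots> = (\<integral>\<^sup>+w. indicator {w\<in>space Q. acc x w \<and> T x w \<in> A} w
        + ennreal I * indicator {w\<in>space Q. \<not> acc x w} w \<partial>Q)"
    by (intro nn_integral_cong) (auto simp: sample_Stream I Om.emeasure_space_1 split: split_indicator)
  also have "\<dots> = ennreal J + ennreal I * ennreal (1 - \<theta>)"
    by (subst nn_integral_add) (auto simp: J nn_integral_cmult emeasure_not_acc(1)[OF x])
  also have "\<dots> = ennreal (J + I * (1 - \<theta>))"
    using emeasure_not_acc(2)[OF x] by (simp add: ennreal_plus ennreal_mult I_def J_def)
  finally have "I = J + I * (1 - \<theta>)"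
    using emeasure_not_acc(2)[OF x] by (subst (asm) ennreal_inj) (auto simp: I_def J_def)
  then have "\<theta> * I = J" by (simp add: algebra_simps)
  then show ?thesis using \<theta>_pos by (simp add: I J ennreal_mult[symmetric] I_def)
qed

lemma nn_integral_sample:
  assumes x[measurable]: "x \<in> space S" and h[measurable]: "h \<in> borel_measurable S"
  shows "ennreal \<theta> * (\<integral>\<^sup>+\<omega>. h (sample x \<omega>) \<partial>stream_space Q)
    = (\<integral>\<^sup>+w. (if acc x w then h (T x w) else 0) \<partial>Q)"
proof -
  let ?D = "density Q (\<lambda>w. if acc x w then 1 else 0)"
  \<comment> \<open>Equality of the two measures carries the formula from sets to all measurable
    \<open>h\<close>.\<close>
  have eq: "scale_measure (ennreal \<theta>) (distr (stream_space Q) S (sample x)) = distr ?D S (T x)"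
  proof (rule measure_eqI)
    fix A assume "A \<in> sets (scale_measure (ennreal \<theta>) (distr (stream_space Q) S (sample x)))"
    then have [measurable]: "A \<in> sets S" by simp
    have "emeasure (scale_measure (ennreal \<theta>) (distr (stream_space Q) S (sample x))) A
       = ennreal \<theta> * emeasure (stream_space Q) {\<omega>\<in>space (stream_space Q). sample x \<omega> \<in> A}"
      by (simp add: emeasure_distr vimage_def Int_def conj_commute)
    also have "\<dots> = (\<integral>\<^sup>+w. indicator {w\<in>space Q. acc x w \<and> T x w \<in> A} w \<partial>Q)"
      by (simp add: emeasure_sample[OF x])
    also have "\<dots> = emeasure (distr ?D S (T x)) A"
      by (subst emeasure_distr, simp, simp, subst emeasure_density, simp, simp)
        (intro nn_integral_cong, auto split: split_indicator)
    finally show "emeasure (scale_measure (ennreal \<theta>) (distr (stream_space Q) S (sample x))) A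
        = emeasure (distr ?D S (T x)) A" .
  qed simp
  have "ennreal \<theta> * (\<integral>\<^sup>+\<omega>. h (sample x \<omega>) \<partial>stream_space Q)
      = (\<integral>\<^sup>+y. h y \<partial>scale_measure (ennreal \<theta>) (distr (stream_space Q) S (sample x)))"
    by (simp add: nn_integral_scale_measure nn_integral_distr)
  also have "\<dots> = (\<integral>\<^sup>+w. (if acc x w then h (T x w) else 0) \<partial>Q)"
    unfolding eq by (auto simp: nn_integral_distr nn_integral_density intro!: nn_integral_cong)
  finally show ?thesis .
qed

text \<open>The first proposal accepted by at least one of the two states decides: if both accept
  it, they are moved by it together; if only one does, the cost is bounded by 1; if none does, the
  experiment restarts. Once the restart term is cancelled, \<open>?O\<close> remains as the
  normalising probability.\<close>

lemma nn_integral_sample_pair: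
  fixes c :: "'x \<times> 'x \<Rightarrow> ennreal"
  assumes x[measurable]: "x \<in> space S" and y[measurable]: "y \<in> space S"
    and c[measurable]: "c \<in> borel_measurable (S \<Otimes>\<^sub>M S)" and c_le: "\<And>p. c p \<le> 1"
  shows "(\<integral>\<^sup>+\<omega>. c (sample x \<omega>, sample y \<omega>) \<partial>stream_space Q)
      * emeasure Q {w\<in>space Q. acc x w \<or> acc y w}
    \<le> (\<integral>\<^sup>+w. (if acc x w \<and> acc y w then c (T x w, T y w) else 0) \<partial>Q)
      + emeasure Q {w\<in>space Q. acc x w \<noteq> acc y w}"
    (is "?I * ?O \<le> ?J + ?X")
proof -
  interpret Om: prob_space "stream_space Q" by (rule prob_space_stream_space)
  have le1: "(\<integral>\<^sup>+\<omega>. c (f \<omega>) \<partial>stream_space Q) \<le> 1" for f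
    using nn_integral_mono[of "stream_space Q" "\<lambda>\<omega>. c (f \<omega>)" "\<lambda>_. 1"] c_le
    by (simp add: Om.emeasure_space_1)
  have "?I = (\<integral>\<^sup>+w. (\<integral>\<^sup>+\<omega>. c (sample x (w ## \<omega>), sample y (w ## \<omega>)) \<partial>stream_space Q) \<partial>Q)"
    by (rule nn_integral_stream_space) measurable
  also have "\<dots> \<le> (\<integral>\<^sup>+w. (if acc x w \<and> acc y w then c (T x w, T y w) else 0)
      + indicator {w\<in>space Q. acc x w \<noteq> acc y w} w
      + ?I * indicator {w\<in>space Q. \<not> (acc x w \<or> acc y w)} w \<partial>Q)"
    using le1 by (intro nn_integral_mono) (auto simp: sample_Stream Om.emeasure_space_1 split: split_indicator)
  also have "\<dots> = ?J + ?X + ?I * emeasure Q {w\<in>space Q. \<not> (acc x w \<or> acc y w)}"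
    by (subst nn_integral_add, simp, simp, subst nn_integral_add) (auto simp: nn_integral_cmult)
  finally have le: "?I \<le> ?J + ?X + ?I * emeasure Q {w\<in>space Q. \<not> (acc x w \<or> acc y w)}" .
  have "?I * ?O + ?I * emeasure Q {w\<in>space Q. \<not> (acc x w \<or> acc y w)}
      = ?I * (?O + emeasure Q {w\<in>space Q. \<not> (acc x w \<or> acc y w)})"
    by (simp add: distrib_left)
  also have "?O + emeasure Q {w\<in>space Q. \<not> (acc x w \<or> acc y w)} = emeasure Q (space Q)"
    by (subst plus_emeasure) (auto intro!: arg_cong[where f="emeasure Q"])
  finally have "?I * ?O + ?I * emeasure Q {w\<in>space Q. \<not> (acc x w \<or> acc y w)} = ?I"
    by (simp add: emeasure_space_1)
  with le have "?I * ?O + ?I * emeasure Q {w\<in>space Q. \<not> (acc x w \<or> acc y w)}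
      \<le> ?J + ?X + ?I * emeasure Q {w\<in>space Q. \<not> (acc x w \<or> acc y w)}" by simp
  \<comment> \<open>Finiteness of the restart term, without which it could not be cancelled in the
    extended reals.\<close>
  moreover have "?I * emeasure Q {w\<in>space Q. \<not> (acc x w \<or> acc y w)} \<le> 1 * 1"
    by (intro mult_mono le1 emeasure_le_1) auto
  then have "?I * emeasure Q {w\<in>space Q. \<not> (acc x w \<or> acc y w)} < top"
    by (rule le_less_trans) simp
  ultimately show ?thesis
    by (subst (asm) (1 2) add.commute, subst (asm) ennreal_add_left_cancel_le) auto
qed

end

section \<open>State space\<close>

lemma space_state_space [simp]: "space (state_space N) = state_set N"
  by (simp add: state_space_def space_restrict_space)

lemma mem_state_set [simp]: "z \<in> state_set N \<longleftrightarrow> snd z \<in> {1..N}"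
  by (cases z) (simp add: state_set_def)

lemma measurable_fst_state [measurable]: "fst \<in> state_space N \<rightarrow>\<^sub>M borel"
  unfolding state_space_def
  by (intro measurable_restrict_space1 borel_measurable_continuous_onI continuous_intros)

lemma measurable_snd_state [measurable]: "snd \<in> state_space N \<rightarrow>\<^sub>M count_space UNIV"
  unfolding state_space_def measurable_cong_sets[OF refl sets_borel_eq_count_space[symmetric]]
  by (intro measurable_restrict_space1 borel_measurable_continuous_onI continuous_intros)

lemma measurable_fst_state':
  "f \<in> M \<rightarrow>\<^sub>M state_space N \<Longrightarrow> (\<lambda>x. fst (f x)) \<in> M \<rightarrow>\<^sub>M borel"
  by (rule measurable_compose[OF _ measurable_fst_state])

lemma measurable_snd_state':
  "f \<in> M \<rightarrow>\<^sub>M state_space N \<Longrightarrow> (\<lambda>x. snd (f x)) \<in> M \<rightarrow>\<^sub>M count_space UNIV"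
  by (rule measurable_compose[OF _ measurable_snd_state])

lemma measurable_Pair_state:
  fixes f :: "'a \<Rightarrow> 'y::second_countable_topology"
  assumes [measurable]: "f \<in> M \<rightarrow>\<^sub>M borel" "g \<in> M \<rightarrow>\<^sub>M count_space UNIV"
    and "\<And>x. x \<in> space M \<Longrightarrow> g x \<in> {1..N}"
  shows "(\<lambda>x. (f x, g x)) \<in> M \<rightarrow>\<^sub>M state_space N"
proof -
  have [measurable]: "g \<in> M \<rightarrow>\<^sub>M borel"
    using assms(2) by (simp add: measurable_cong_sets[OF refl sets_borel_eq_count_space])
  have "(\<lambda>x. (f x, g x)) \<in> M \<rightarrow>\<^sub>M borel" by measurable
  then show ?thesis
    unfolding state_space_def using assms(3) by (intro measurable_restrict_space2) auto
qed

lemma borel_measurable_continuous_on_state: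
  "continuous_on (state_set N) f \<Longrightarrow> f \<in> borel_measurable (state_space N)"
  unfolding state_space_def by (rule borel_measurable_continuous_on_restrict)

lemma measurable_state_dist [measurable]:
  "(\<lambda>(z, w). state_dist z w)
     \<in> borel_measurable (state_space N \<Otimes>\<^sub>M (state_space N :: ('y::{second_countable_topology, metric_space} \<times> nat) measure))"
proof -
  let ?S = "state_space N :: ('y \<times> nat) measure"
  have [measurable]: "(\<lambda>p. fst (fst p)) \<in> borel_measurable (?S \<Otimes>\<^sub>M ?S)"
      "(\<lambda>p. fst (snd p)) \<in> borel_measurable (?S \<Otimes>\<^sub>M ?S)"
      "(\<lambda>p. snd (fst p)) \<in> ?S \<Otimes>\<^sub>M ?S \<rightarrow>\<^sub>M count_space UNIV"
      "(\<lambda>p. snd (snd p)) \<in> ?S \<Otimes>\<^sub>M ?S \<rightarrow>\<^sub>M count_space UNIV"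
    by (rule measurable_compose[OF measurable_fst measurable_fst_state]
      measurable_compose[OF measurable_snd measurable_fst_state]
      measurable_compose[OF measurable_fst measurable_snd_state]
      measurable_compose[OF measurable_snd measurable_snd_state])+
  have "(\<lambda>p. dist (fst (fst p)) (fst (snd p))) \<in> borel_measurable (?S \<Otimes>\<^sub>M ?S)"
    by (rule borel_measurable_dist) fact+
  moreover have "Measurable.pred (?S \<Otimes>\<^sub>M ?S) (\<lambda>p. snd (fst p) = snd (snd p))"
    by (rule measurable_compose_countable[where f="\<lambda>i p. i = snd (snd p)" and g="\<lambda>p. snd (fst p)"]) measurable
  ultimately show ?thesis unfolding state_dist_def case_prod_beta by measurable
qed

lemma state_dist_nonneg: "0 \<le> state_dist z w"
  by (simp add: state_dist_def)

lemma Cauchy_of_summable_dist: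
  fixes x :: "nat \<Rightarrow> 'a::metric_space"
  assumes "summable (\<lambda>n. dist (x n) (x (Suc n)))"
  shows "Cauchy x"
proof (rule metric_CauchyI)
  fix e :: real assume "e > 0"
  then obtain M where M: "\<And>m n. m \<ge> M \<Longrightarrow> norm (\<Sum>i=m..<n. dist (x i) (x (Suc i))) < e"
    using assms unfolding summable_Cauchy by blast
  have le: "dist (x m) (x n) \<le> (\<Sum>i=m..<n. dist (x i) (x (Suc i)))" if "m \<le> n" for m n
    using that
  proof (induction n rule: dec_induct)
    case (step n)
    then show ?case using dist_triangle[of "x m" "x (Suc n)" "x n"] by simp
  qed simp
  have lt: "dist (x m) (x n) < e" if "m \<ge> M" "m \<le> n" for m n
    using le[OF that(2)] M[OF that(1), of n] by simp
  show "\<exists>M. \<forall>m\<ge>M. \<forall>n\<ge>M. dist (x m) (x n) < e"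
    using lt by (metis dist_commute nle_le)
qed

text \<open>Truncating the distance at 1 loses nothing in the limit: summable terms are eventually
  below 1, and states with different indices are at distance at least 1.\<close>

lemma convergent_of_summable_state_dist:
  fixes x :: "nat \<Rightarrow> 'y::complete_space \<times> nat"
  assumes s: "summable (\<lambda>n. min 1 (state_dist (x n) (x (Suc n))))"
  shows "Cauchy (\<lambda>n. fst (x n)) \<and> (\<exists>m. \<forall>n\<ge>m. snd (x n) = snd (x m))"
proof -
  have "(\<lambda>n. min 1 (state_dist (x n) (x (Suc n)))) \<longlonglongrightarrow> 0" using s by (rule summable_LIMSEQ_zero)
  then have "\<forall>\<^sub>F n in sequentially. min 1 (state_dist (x n) (x (Suc n))) < 1"
    by (rule order_tendstoD) simp
  then have "\<forall>\<^sub>F n in sequentially. state_dist (x n) (x (Suc n)) < 1"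
    by eventually_elim (simp add: min_less_iff_disj)
  then obtain m where m: "\<And>n. n \<ge> m \<Longrightarrow> state_dist (x n) (x (Suc n)) < 1"
    unfolding eventually_sequentially by blast
  have eq: "snd (x n) = snd (x (Suc n))" if "n \<ge> m" for n
    using m[OF that] unfolding state_dist_def by (smt (verit) zero_le_dist)
  have "snd (x n) = snd (x m)" if "n \<ge> m" for n
    using that by (induction n rule: dec_induct) (auto simp: eq[symmetric])
  moreover have "Cauchy (\<lambda>n. fst (x n))"
  proof (rule Cauchy_of_summable_dist)
    show "summable (\<lambda>n. dist (fst (x n)) (fst (x (Suc n))))"
    proof (rule summable_comparison_test_ev[OF _ s])
      show "\<forall>\<^sub>F n in sequentially. norm (dist (fst (x n)) (fst (x (Suc n)))) \<le> min 1 (state_dist (x n) (x (Suc n)))"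
        unfolding eventually_sequentially
      proof (intro exI[of _ m] allI impI)
        fix n assume "m \<le> n"
        then show "norm (dist (fst (x n)) (fst (x (Suc n)))) \<le> min 1 (state_dist (x n) (x (Suc n)))"
          using m[of n] by (auto simp: state_dist_def split: if_splits)
      qed
    qed
  qed
  ultimately show ?thesis by blast
qed

lemma tendsto_state:
  fixes x :: "nat \<Rightarrow> 'y::topological_space \<times> nat"
  assumes "(\<lambda>n. fst (x n)) \<longlonglongrightarrow> fst l" "\<And>n. n \<ge> m \<Longrightarrow> snd (x n) = snd l"
  shows "x \<longlonglongrightarrow> l"
proof -
  have "(\<lambda>n. snd (x n)) \<longlonglongrightarrow> snd l"
    by (rule tendsto_eventually) (use assms(2) in \<open>auto simp: eventually_sequentially\<close>)
  from tendsto_Pair[OF assms(1) this] show ?thesis by simp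
qed

text \<open>The pointwise limit exists only almost everywhere, so a total measurable version is
  assembled from the two components. Completeness turns the Cauchy sequence of positions into a
  convergent one.\<close>

lemma obtain_measurable_limit:
  fixes X :: "nat \<Rightarrow> 'w \<Rightarrow> 'y::polish_space \<times> nat"
  assumes X[measurable]: "\<And>n. X n \<in> M \<rightarrow>\<^sub>M state_space N"
    and "AE \<omega> in M. summable (\<lambda>n. min 1 (state_dist (X n \<omega>) (X (Suc n) \<omega>)))"
  obtains Z where "Z \<in> M \<rightarrow>\<^sub>M state_space N" "AE \<omega> in M. (\<lambda>n. X n \<omega>) \<longlonglongrightarrow> Z \<omega>"
proof -
  \<comment> \<open>The time from which the index is constant. Where there is none,
    \<open>LEAST\<close> still yields a measurable value, and every \<open>X n \<omega>\<close> has
    an admissible index.\<close>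
  define J where "J \<omega> = (LEAST m. \<forall>n\<ge>m. snd (X n \<omega>) = snd (X m \<omega>))" for \<omega>
  \<comment> \<open>A constant sequence off the Cauchy set, so that \<open>lim (G \<omega>)\<close>
    is a genuine limit for every \<open>\<omega>\<close> and hence measurable.\<close>
  define G where "G \<omega> n = (if Cauchy (\<lambda>n. fst (X n \<omega>)) then fst (X n \<omega>) else undefined)" for \<omega> n
  define Z where "Z \<omega> = (lim (G \<omega>), snd (X (J \<omega>) \<omega>))" for \<omega>
  have snd_X[measurable]: "(\<lambda>\<omega>. snd (X n \<omega>)) \<in> M \<rightarrow>\<^sub>M count_space UNIV" for n
    by (rule measurable_snd_state'[OF X])
  have fst_X[measurable]: "(\<lambda>\<omega>. fst (X n \<omega>)) \<in> M \<rightarrow>\<^sub>M borel" for n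
    by (rule measurable_fst_state'[OF X])
  have eq_meas: "Measurable.pred M (\<lambda>\<omega>. snd (X n \<omega>) = snd (X m \<omega>))" for n m
    by (rule measurable_compose_countable[OF _ snd_X, where f="\<lambda>i \<omega>. i = snd (X m \<omega>)"]) measurable
  have conv: "G \<omega> \<longlonglongrightarrow> lim (G \<omega>)" for \<omega>
    by (cases "Cauchy (\<lambda>n. fst (X n \<omega>))")
      (auto simp: G_def[abs_def] Cauchy_convergent_iff convergent_LIMSEQ_iff[symmetric] convergent_const)
  have [measurable]: "(\<lambda>\<omega>. G \<omega> n) \<in> borel_measurable M" for n
    unfolding G_def by measurable
  have [measurable]: "(\<lambda>\<omega>. lim (G \<omega>)) \<in> borel_measurable M"
    by (rule borel_measurable_LIMSEQ_metric[where f="\<lambda>n \<omega>. G \<omega> n"]) (use conv in auto)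
  have [measurable]: "J \<in> M \<rightarrow>\<^sub>M count_space UNIV"
    unfolding J_def
    by (intro measurable_Least pred_intros_countable pred_intros_logic eq_meas) (rule measurable_const, simp)
  have [measurable]: "(\<lambda>\<omega>. snd (X (J \<omega>) \<omega>)) \<in> M \<rightarrow>\<^sub>M count_space UNIV"
    by (rule measurable_compose_countable[where f="\<lambda>n \<omega>. snd (X n \<omega>)"]) measurable
  have "Z \<in> M \<rightarrow>\<^sub>M state_space N"
    unfolding Z_def
    by (rule measurable_Pair_state) (use measurable_space[OF X] in auto)
  moreover have "AE \<omega> in M. (\<lambda>n. X n \<omega>) \<longlonglongrightarrow> Z \<omega>"
    using assms(2)
  proof eventually_elim
    case (elim \<omega>)
    from convergent_of_summable_state_dist[OF this]
    have C: "Cauchy (\<lambda>n. fst (X n \<omega>))" and "\<exists>m. \<forall>n\<ge>m. snd (X n \<omega>) = snd (X m \<omega>)" by auto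
    from LeastI_ex[OF this(2)] have J: "\<And>n. n \<ge> J \<omega> \<Longrightarrow> snd (X n \<omega>) = snd (X (J \<omega>) \<omega>)"
      unfolding J_def by blast
    have G: "G \<omega> = (\<lambda>n. fst (X n \<omega>))" using C by (simp add: G_def fun_eq_iff)
    show ?case
    proof (rule tendsto_state)
      show "(\<lambda>n. fst (X n \<omega>)) \<longlonglongrightarrow> fst (Z \<omega>)" using conv[of \<omega>] by (simp add: Z_def G)
      show "snd (X n \<omega>) = snd (Z \<omega>)" if "J \<omega> \<le> n" for n
        using J[OF that] unfolding Z_def snd_conv .
    qed
  qed
  ultimately show ?thesis using that by blast
qed

section \<open>Head and tail of an i.i.d. stream\<close>

lemma (in prob_space) stream_space_eq_distr_pair:
  "stream_space M = distr (M \<Otimes>\<^sub>M stream_space M) (stream_space M) (\<lambda>(x, s). x ## s)"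
proof (rule measure_eqI)
  interpret S: prob_space "stream_space M" by (rule prob_space_stream_space)
  fix A assume "A \<in> sets (stream_space M)"
  then have [measurable]: "A \<in> sets (stream_space M)" .
  have "emeasure (stream_space M) A = (\<integral>\<^sup>+\<omega>. indicator A \<omega> \<partial>stream_space M)" by simp
  also have "\<dots> = (\<integral>\<^sup>+x. \<integral>\<^sup>+\<omega>. indicator A (x ## \<omega>) \<partial>stream_space M \<partial>M)"
    by (rule nn_integral_stream_space) simp
  also have "\<dots> = (\<integral>\<^sup>+p. indicator A (case p of (x, \<omega>) \<Rightarrow> x ## \<omega>) \<partial>(M \<Otimes>\<^sub>M stream_space M))"
    by (subst S.nn_integral_fst[symmetric]) auto
  also have "\<dots> = (\<integral>\<^sup>+\<omega>. indicator A \<omega> \<partial>distr (M \<Otimes>\<^sub>M stream_space M) (stream_space M) (\<lambda>(x, s). x ## s))"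
    by (subst nn_integral_distr) auto
  finally show "emeasure (stream_space M) A
      = emeasure (distr (M \<Otimes>\<^sub>M stream_space M) (stream_space M) (\<lambda>(x, s). x ## s)) A" by simp
qed simp

text \<open>The head will drive the outermost map of an iterate. Integrating it with the tail fixed
  means that one fresh map acts on a fixed state, where the one-step bounds apply.\<close>

lemma (in prob_space) nn_integral_stream_space_swap:
  assumes [measurable]: "f \<in> borel_measurable (stream_space M)"
  shows "(\<integral>\<^sup>+\<omega>. f \<omega> \<partial>stream_space M) = (\<integral>\<^sup>+\<omega>. \<integral>\<^sup>+x. f (x ## \<omega>) \<partial>M \<partial>stream_space M)"
proof -
  interpret S: prob_space "stream_space M" by (rule prob_space_stream_space)
  interpret P: pair_sigma_finite M "stream_space M" ..
  show ?thesis
    by (subst nn_integral_stream_space, simp, rule P.Fubini'[symmetric]) measurable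
qed

lemma (in prob_space) integral_stream_space_swap:
  fixes f :: "'a stream \<Rightarrow> real"
  assumes f: "integrable (stream_space M) f"
  shows "(\<integral>\<omega>. f \<omega> \<partial>stream_space M) = (\<integral>\<omega>. \<integral>x. f (x ## \<omega>) \<partial>M \<partial>stream_space M)"
proof -
  interpret S: prob_space "stream_space M" by (rule prob_space_stream_space)
  interpret P: pair_sigma_finite M "stream_space M" ..
  have [measurable]: "f \<in> borel_measurable (stream_space M)" using f by simp
  have i: "integrable (M \<Otimes>\<^sub>M stream_space M) (\<lambda>(x, \<omega>). f (x ## \<omega>))"
    using f by (subst (asm) stream_space_eq_distr_pair, subst (asm) integrable_distr_eq)
      (auto simp: case_prod_beta')
  have "(\<integral>\<omega>. f \<omega> \<partial>stream_space M) = (\<integral>p. f (case p of (x, \<omega>) \<Rightarrow> x ## \<omega>) \<partial>(M \<Otimes>\<^sub>M stream_space M))"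
    by (subst stream_space_eq_distr_pair, subst integral_distr) auto
  also have "\<dots> = (\<integral>\<omega>. \<integral>x. f (x ## \<omega>) \<partial>M \<partial>stream_space M)"
    using P.integral_snd[OF i] by (simp add: case_prod_beta')
  finally show ?thesis .
qed

section \<open>Contracting random maps\<close>

lemma (in prob_space) abs_integral_le:
  fixes f :: "'a \<Rightarrow> real"
  assumes [measurable]: "f \<in> borel_measurable M" and B: "\<And>x. x \<in> space M \<Longrightarrow> \<bar>f x\<bar> \<le> B"
  shows "integrable M f" "\<bar>\<integral>x. f x \<partial>M\<bar> \<le> B"
proof -
  show i: "integrable M f" by (rule integrable_const_bound[of _ B]) (use B in auto)
  have "\<bar>\<integral>x. f x \<partial>M\<bar> \<le> (\<integral>x. \<bar>f x\<bar> \<partial>M)" by (rule integral_abs_bound)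
  also have "\<dots> \<le> (\<integral>x. B \<partial>M)" using B i by (intro integral_mono) auto
  finally show "\<bar>\<integral>x. f x \<partial>M\<bar> \<le> B" by (simp add: prob_space)
qed

text \<open>Tonelli in place of Borel-Cantelli: a series with finite mean is finite almost
  everywhere.\<close>

lemma AE_summable_of_nn_integral:
  fixes Y :: "nat \<Rightarrow> 'w \<Rightarrow> real"
  assumes [measurable]: "\<And>n. Y n \<in> borel_measurable M"
    and nn: "\<And>n \<omega>. \<omega> \<in> space M \<Longrightarrow> 0 \<le> Y n \<omega>"
    and le: "\<And>n. (\<integral>\<^sup>+\<omega>. ennreal (Y n \<omega>) \<partial>M) \<le> ennreal (c n)"
    and c: "summable c" "\<And>n. 0 \<le> c n"
  shows "AE \<omega> in M. summable (\<lambda>n. Y n \<omega>)"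
proof -
  have "(\<integral>\<^sup>+\<omega>. (\<Sum>n. ennreal (Y n \<omega>)) \<partial>M) = (\<Sum>n. \<integral>\<^sup>+\<omega>. ennreal (Y n \<omega>) \<partial>M)"
    by (rule nn_integral_suminf) simp
  also have "\<dots> \<le> (\<Sum>n. ennreal (c n))" using le by (intro suminf_le) auto
  also have "\<dots> = ennreal (\<Sum>n. c n)" using c by (simp add: suminf_ennreal2)
  also have "\<dots> < \<infinity>" by simp
  finally have "AE \<omega> in M. (\<Sum>n. ennreal (Y n \<omega>)) \<noteq> \<infinity>"
    by (intro nn_integral_PInf_AE) auto
  then show ?thesis using AE_space
    by eventually_elim (auto intro!: summable_suminf_not_top nn)
qed

lemma tendsto_of_state_dist:
  fixes x y :: "nat \<Rightarrow> 'y::metric_space \<times> nat"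
  assumes x: "x \<longlonglongrightarrow> l" and d: "(\<lambda>n. min 1 (state_dist (x n) (y n))) \<longlonglongrightarrow> 0"
  shows "y \<longlonglongrightarrow> l"
proof -
  have "\<forall>\<^sub>F n in sequentially. min 1 (state_dist (x n) (y n)) < 1" using d by (rule order_tendstoD) simp
  then have ev: "\<forall>\<^sub>F n in sequentially. state_dist (x n) (y n) < 1"
    by eventually_elim (simp add: min_less_iff_disj)
  have "(\<lambda>n. snd (x n)) \<longlonglongrightarrow> snd l" using x by (rule tendsto_snd)
  then have "\<forall>\<^sub>F n in sequentially. snd (x n) = snd l" by (simp add: tendsto_discrete)
  with ev have "\<forall>\<^sub>F n in sequentially. snd (y n) = snd l"
    by eventually_elim (smt (verit) state_dist_def zero_le_dist)
  then have s: "(\<lambda>n. snd (y n)) \<longlonglongrightarrow> snd l" by (simp add: tendsto_discrete)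
  have "(\<lambda>n. dist (fst (x n)) (fst (y n))) \<longlonglongrightarrow> 0"
  proof (rule tendsto_sandwich[OF _ _ tendsto_const d])
    show "\<forall>\<^sub>F n in sequentially. dist (fst (x n)) (fst (y n)) \<le> min 1 (state_dist (x n) (y n))"
      using ev by eventually_elim (auto simp: state_dist_def split: if_splits)
  qed simp
  moreover have "(\<lambda>n. dist (fst (x n)) (fst l)) \<longlonglongrightarrow> 0"
    using tendsto_fst[OF x] by (rule tendsto_dist_iff[THEN iffD1])
  ultimately have "(\<lambda>n. dist (fst (x n)) (fst (y n)) + dist (fst (x n)) (fst l)) \<longlonglongrightarrow> 0"
    by (rule tendsto_add_zero)
  then have "(\<lambda>n. dist (fst (y n)) (fst l)) \<longlonglongrightarrow> 0"
    by (rule Lim_null_comparison[rotated]) (auto intro!: always_eventually dist_triangle3)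
  then have "(\<lambda>n. fst (y n)) \<longlonglongrightarrow> fst l" by (rule tendsto_dist_iff[THEN iffD2])
  from tendsto_Pair[OF this s] show ?thesis by simp
qed

text \<open>\<open>ct\<close> is a cost and not a metric. Its lower bound turns summable costs into
  convergence, its upper bound makes the initial cost integrable, and \<open>ct_tendsto\<close>
  makes the transition operator map suitable functions to continuous ones. The lower bound is
  truncated because the cost built later grows more slowly than the distance.\<close>

locale contractive_maps = prob_space Om for Om :: "'w measure" +
  fixes N :: nat and F :: "'y::polish_space \<times> nat \<Rightarrow> 'w \<Rightarrow> 'y \<times> nat" and xs :: 'y
    and ct :: "'y \<times> nat \<Rightarrow> 'y \<times> nat \<Rightarrow> real" and r a b \<eta> :: real
  assumes N: "N \<ge> 1"
    and measurable_F [measurable]: "(\<lambda>(z, w). F z w) \<in> state_space N \<Otimes>\<^sub>M Om \<rightarrow>\<^sub>M state_space N"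
    and measurable_ct [measurable]:
      "(\<lambda>(z, w). ct z w) \<in> borel_measurable (state_space N \<Otimes>\<^sub>M state_space N)"
    and ct_lower: "\<And>z w. z \<in> state_set N \<Longrightarrow> w \<in> state_set N \<Longrightarrow> \<eta> * min 1 (state_dist z w) \<le> ct z w"
    and ct_upper: "\<And>z w. z \<in> state_set N \<Longrightarrow> w \<in> state_set N \<Longrightarrow>
      ct z w \<le> 1 + dist (fst z) xs + dist (fst w) xs"
    and ct_tendsto: "\<And>z. z \<in> state_set N \<Longrightarrow> (ct z \<longlongrightarrow> 0) (at z within state_set N)"
    and \<eta>: "\<eta> > 0" and r: "0 < r" "r < 1" and a: "0 \<le> a" "a < 1" and b: "0 \<le> b"
    and contraction: "\<And>z w. z \<in> state_set N \<Longrightarrow> w \<in> state_set N \<Longrightarrow>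
      (\<integral>\<^sup>+\<omega>. ennreal (ct (F z \<omega>) (F w \<omega>)) \<partial>Om) \<le> ennreal (r * ct z w)"
    and drift: "\<And>z. z \<in> state_set N \<Longrightarrow>
      (\<integral>\<^sup>+\<omega>. ennreal (dist (fst (F z \<omega>)) xs) \<partial>Om) \<le> ennreal (a * dist (fst z) xs + b)"
begin

definition V :: "'y \<times> nat \<Rightarrow> real" where "V z = dist (fst z) xs"

lemma V_nonneg [simp]: "0 \<le> V z" by (simp add: V_def)

lemma measurable_V [measurable]: "V \<in> borel_measurable (state_space N)"
  unfolding V_def by measurable

lemma measurable_F' [measurable (raw)]:
  "f \<in> M \<rightarrow>\<^sub>M state_space N \<Longrightarrow> g \<in> M \<rightarrow>\<^sub>M Om \<Longrightarrow> (\<lambda>x. F (f x) (g x)) \<in> M \<rightarrow>\<^sub>M state_space N"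
  using measurable_compose[OF measurable_Pair measurable_F] by simp

lemma measurable_ct' [measurable (raw)]:
  "f \<in> M \<rightarrow>\<^sub>M state_space N \<Longrightarrow> g \<in> M \<rightarrow>\<^sub>M state_space N \<Longrightarrow> (\<lambda>x. ct (f x) (g x)) \<in> borel_measurable M"
  using measurable_compose[OF measurable_Pair measurable_ct] by simp

lemma ct_nonneg: "z \<in> state_set N \<Longrightarrow> w \<in> state_set N \<Longrightarrow> 0 \<le> ct z w"
  by (rule order_trans[OF _ ct_lower]) (use \<eta> state_dist_nonneg[of z w] in auto)

lemma F_in_state_set [simp]: "z \<in> state_set N \<Longrightarrow> \<omega> \<in> space Om \<Longrightarrow> F z \<omega> \<in> state_set N"
  using measurable_space[OF measurable_F, of "(z, \<omega>)"] by (simp add: space_pair_measure)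

lemma measurable_F1 [measurable]: "z \<in> state_set N \<Longrightarrow> F z \<in> Om \<rightarrow>\<^sub>M state_space N"
  by (rule measurable_F') auto

section \<open>Backward iterates and their almost sure limit\<close>

sublocale Str: prob_space "stream_space Om" by (rule prob_space_stream_space)

text \<open>The newest map is applied first, so that for a fixed stream the iterates converge.\<close>

primrec iter :: "nat \<Rightarrow> 'y \<times> nat \<Rightarrow> 'w stream \<Rightarrow> 'y \<times> nat" where
  "iter 0 z \<omega> = z"
| "iter (Suc n) z \<omega> = F (iter n z (stl \<omega>)) (shd \<omega>)"

lemma measurable_iter' [measurable (raw)]:
  "f \<in> M \<rightarrow>\<^sub>M state_space N \<Longrightarrow> g \<in> M \<rightarrow>\<^sub>M stream_space Om \<Longrightarrow> (\<lambda>x. iter n (f x) (g x)) \<in> M \<rightarrow>\<^sub>M state_space N"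
proof (induction n arbitrary: g)
  case (Suc n)
  have [measurable]: "(\<lambda>x. iter n (f x) (stl (g x))) \<in> M \<rightarrow>\<^sub>M state_space N"
    using Suc.prems by (intro Suc.IH) auto
  show ?case using Suc.prems by simp
qed simp

lemma measurable_iter1 [measurable]: "z \<in> state_set N \<Longrightarrow> iter n z \<in> stream_space Om \<rightarrow>\<^sub>M state_space N"
  by (rule measurable_iter') auto

lemma iter_in_state_set [simp]: "z \<in> state_set N \<Longrightarrow> \<omega> \<in> space (stream_space Om) \<Longrightarrow> iter n z \<omega> \<in> state_set N"
  using measurable_space[OF measurable_iter1, of z \<omega> n] by simp

text \<open>Stated for two arbitrary functions of the tail, so that the same step serves for two
  starting points at equal times and for one starting point at consecutive times.\<close>

lemma nn_integral_ct_step: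
  assumes [measurable]: "X \<in> stream_space Om \<rightarrow>\<^sub>M state_space N" "Y \<in> stream_space Om \<rightarrow>\<^sub>M state_space N"
  shows "(\<integral>\<^sup>+\<omega>. ennreal (ct (F (X (stl \<omega>)) (shd \<omega>)) (F (Y (stl \<omega>)) (shd \<omega>))) \<partial>stream_space Om)
    \<le> ennreal r * (\<integral>\<^sup>+\<omega>. ennreal (ct (X \<omega>) (Y \<omega>)) \<partial>stream_space Om)"
proof -
  have st: "X \<omega> \<in> state_set N" "Y \<omega> \<in> state_set N" if "\<omega> \<in> space (stream_space Om)" for \<omega>
    using assms[THEN measurable_space, OF that] by auto
  have "(\<integral>\<^sup>+\<omega>. ennreal (ct (F (X (stl \<omega>)) (shd \<omega>)) (F (Y (stl \<omega>)) (shd \<omega>))) \<partial>stream_space Om)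
      = (\<integral>\<^sup>+\<omega>. \<integral>\<^sup>+x. ennreal (ct (F (X \<omega>) x) (F (Y \<omega>) x)) \<partial>Om \<partial>stream_space Om)"
    by (subst nn_integral_stream_space_swap) auto
  also have "\<dots> \<le> (\<integral>\<^sup>+\<omega>. ennreal r * ennreal (ct (X \<omega>) (Y \<omega>)) \<partial>stream_space Om)"
    using contraction[OF st] r
    by (intro nn_integral_mono) (simp add: ennreal_mult[symmetric] ct_nonneg[OF st] del: mem_state_set)
  finally show ?thesis by (simp add: nn_integral_cmult)
qed

lemma nn_integral_ct_iter:
  assumes "z \<in> state_set N" "w \<in> state_set N"
  shows "(\<integral>\<^sup>+\<omega>. ennreal (ct (iter n z \<omega>) (iter n w \<omega>)) \<partial>stream_space Om) \<le> ennreal (ct z w * r ^ n)"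
proof (induction n)
  case 0
  then show ?case by (simp add: Str.emeasure_space_1)
next
  case (Suc n)
  have "(\<integral>\<^sup>+\<omega>. ennreal (ct (iter (Suc n) z \<omega>) (iter (Suc n) w \<omega>)) \<partial>stream_space Om)
      \<le> ennreal r * (\<integral>\<^sup>+\<omega>. ennreal (ct (iter n z \<omega>) (iter n w \<omega>)) \<partial>stream_space Om)"
    using assms by (simp del: mem_state_set add: nn_integral_ct_step)
  also have "\<dots> \<le> ennreal r * ennreal (ct z w * r ^ n)" by (intro mult_left_mono Suc.IH) auto
  also have "\<dots> = ennreal (ct z w * r ^ Suc n)"
    using r assms by (simp add: ennreal_mult[symmetric] ct_nonneg algebra_simps)
  finally show ?case .
qed

text \<open>Increasing the time inserts a map innermost, so consecutive iterates are images of
  \<open>z\<close> and of a random image of \<open>z\<close> under the same \<open>n\<close> outer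
  maps. The mean cost of that initial displacement comes from the upper bound for \<open>ct\<close>
  and the drift.\<close>

lemma nn_integral_ct_iter_Suc:
  assumes z: "z \<in> state_set N"
  shows "(\<integral>\<^sup>+\<omega>. ennreal (ct (iter n z \<omega>) (iter (Suc n) z \<omega>)) \<partial>stream_space Om)
    \<le> ennreal ((1 + V z + (a * V z + b)) * r ^ n)"
proof (induction n)
  case 0
  have [measurable]: "z \<in> space (state_space N)" using z by simp
  have "(\<integral>\<^sup>+\<omega>. ennreal (ct z (F z (shd \<omega>))) \<partial>stream_space Om) = (\<integral>\<^sup>+\<omega>. ennreal (ct z (F z \<omega>)) \<partial>Om)"
    by (subst nn_integral_stream_space) (auto simp: Str.emeasure_space_1)
  also have "\<dots> \<le> (\<integral>\<^sup>+\<omega>. ennreal (1 + V z) + ennreal (V (F z \<omega>)) \<partial>Om)"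
    using ct_upper z by (intro nn_integral_mono) (auto simp: ennreal_plus[symmetric] V_def simp del: mem_state_set ennreal_plus)
  also have "\<dots> = ennreal (1 + V z) + (\<integral>\<^sup>+\<omega>. ennreal (V (F z \<omega>)) \<partial>Om)"
    by (subst nn_integral_add) (auto simp: emeasure_space_1)
  also have "\<dots> \<le> ennreal (1 + V z) + ennreal (a * V z + b)"
    using drift[OF z] by (intro add_left_mono) (simp add: V_def)
  finally show ?case using a b by (simp add: ennreal_plus[symmetric] del: ennreal_plus)
next
  case (Suc n)
  have "(\<integral>\<^sup>+\<omega>. ennreal (ct (iter (Suc n) z \<omega>) (iter (Suc (Suc n)) z \<omega>)) \<partial>stream_space Om)
      \<le> ennreal r * (\<integral>\<^sup>+\<omega>. ennreal (ct (iter n z \<omega>) (iter (Suc n) z \<omega>)) \<partial>stream_space Om)"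
    using nn_integral_ct_step[of "iter n z" "iter (Suc n) z"] z by simp
  also have "\<dots> \<le> ennreal r * ennreal ((1 + V z + (a * V z + b)) * r ^ n)" by (intro mult_left_mono Suc.IH) auto
  also have "\<dots> = ennreal ((1 + V z + (a * V z + b)) * r ^ Suc n)"
    using r a b by (simp add: ennreal_mult[symmetric] algebra_simps)
  finally show ?case .
qed

text \<open>\<open>b / (1 - a)\<close> is the fixed point of the map taking \<open>x\<close> to
  \<open>a * x + b\<close>, so the bound reproduces itself.\<close>

lemma drift_step:
  assumes X: "X \<le> ennreal (v + b / (1 - a))" and v: "0 \<le> v"
  shows "ennreal a * X + ennreal b \<le> ennreal (v + b / (1 - a))"
proof -
  have "ennreal a * X + ennreal b \<le> ennreal a * ennreal (v + b / (1 - a)) + ennreal b"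
    by (intro add_right_mono mult_left_mono X) auto
  also have "\<dots> = ennreal (a * v + (a * (b / (1 - a)) + b))"
    using a b v by (simp add: ennreal_mult[symmetric] ennreal_plus[symmetric] algebra_simps del: ennreal_plus)
  also have "a * (b / (1 - a)) + b = b / (1 - a)" using a by (simp add: field_simps)
  also have "ennreal (a * v + b / (1 - a)) \<le> ennreal (v + b / (1 - a))"
    using a mult_right_mono[of a 1 v] v by (intro ennreal_leI) simp
  finally show ?thesis .
qed

lemma nn_integral_V_iter:
  assumes z: "z \<in> state_set N"
  shows "(\<integral>\<^sup>+\<omega>. ennreal (V (iter n z \<omega>)) \<partial>stream_space Om) \<le> ennreal (V z + b / (1 - a))"
proof (induction n)
  case 0
  then show ?case using a b by (simp add: Str.emeasure_space_1)
next
  case (Suc n)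
  have "(\<integral>\<^sup>+\<omega>. ennreal (V (iter (Suc n) z \<omega>)) \<partial>stream_space Om)
     = (\<integral>\<^sup>+\<omega>. \<integral>\<^sup>+x. ennreal (V (F (iter n z \<omega>) x)) \<partial>Om \<partial>stream_space Om)"
    using z by (subst nn_integral_stream_space_swap) auto
  also have "\<dots> \<le> (\<integral>\<^sup>+\<omega>. ennreal a * ennreal (V (iter n z \<omega>)) + ennreal b \<partial>stream_space Om)"
    using drift[OF iter_in_state_set[OF z]] a b
    by (intro nn_integral_mono) (simp add: V_def ennreal_mult[symmetric] ennreal_plus[symmetric] del: ennreal_plus)
  also have "\<dots> = ennreal a * (\<integral>\<^sup>+\<omega>. ennreal (V (iter n z \<omega>)) \<partial>stream_space Om) + ennreal b"
    using z by (subst nn_integral_add) (auto simp: nn_integral_cmult Str.emeasure_space_1)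
  also have "\<dots> \<le> ennreal (V z + b / (1 - a))" by (rule drift_step[OF Suc.IH]) simp
  finally show ?case .
qed

lemma summable_state_dist_of_ct:
  assumes "\<And>n. x n \<in> state_set N" "\<And>n. y n \<in> state_set N" "summable (\<lambda>n. ct (x n) (y n))"
  shows "summable (\<lambda>n. min 1 (state_dist (x n) (y n)))"
proof (rule summable_comparison_test[OF _ summable_mult[OF assms(3), of "1 / \<eta>"]], intro exI allI impI)
  fix n
  show "norm (min 1 (state_dist (x n) (y n))) \<le> 1 / \<eta> * ct (x n) (y n)"
    using ct_lower[OF assms(1,2), of n n] \<eta> state_dist_nonneg[of "x n" "y n"] by (simp add: field_simps)
qed

text \<open>Only the orbit of \<open>(xs, 1)\<close> is shown to converge by itself; every other
  orbit is attached to it by the contraction between two starting points, which forces the common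
  limit. The exceptional null set may depend on \<open>z\<close>.\<close>

lemma ex_limit:
  "\<exists>Z. Z \<in> stream_space Om \<rightarrow>\<^sub>M state_space N \<and>
     (\<forall>z\<in>state_set N. AE \<omega> in stream_space Om. (\<lambda>n. iter n z \<omega>) \<longlonglongrightarrow> Z \<omega>)"
proof -
  have z0: "(xs, 1) \<in> state_set N" using N by simp
  have sr: "summable (\<lambda>n. c * r ^ n)" for c using r by (intro summable_mult summable_geometric) simp
  have "AE \<omega> in stream_space Om. summable (\<lambda>n. ct (iter n (xs, 1) \<omega>) (iter (Suc n) (xs, 1) \<omega>))"
    by (rule AE_summable_of_nn_integral[OF _ _ nn_integral_ct_iter_Suc[OF z0] sr])
      (use z0 r a b in \<open>auto intro!: ct_nonneg simp del: mem_state_set iter.simps\<close>)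
  then have "AE \<omega> in stream_space Om.
      summable (\<lambda>n. min 1 (state_dist (iter n (xs, 1) \<omega>) (iter (Suc n) (xs, 1) \<omega>)))"
    using AE_space
    by eventually_elim (rule summable_state_dist_of_ct, use z0 in \<open>auto simp del: mem_state_set iter.simps\<close>)
  then obtain Z where Z: "Z \<in> stream_space Om \<rightarrow>\<^sub>M state_space N"
    "AE \<omega> in stream_space Om. (\<lambda>n. iter n (xs, 1) \<omega>) \<longlonglongrightarrow> Z \<omega>"
    by (rule obtain_measurable_limit[rotated]) (use z0 in \<open>auto simp del: mem_state_set\<close>)
  have "AE \<omega> in stream_space Om. (\<lambda>n. iter n z \<omega>) \<longlonglongrightarrow> Z \<omega>" if z: "z \<in> state_set N" for z
  proof -
    have "AE \<omega> in stream_space Om. summable (\<lambda>n. ct (iter n (xs, 1) \<omega>) (iter n z \<omega>))"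
      by (rule AE_summable_of_nn_integral[OF _ _ nn_integral_ct_iter[OF z0 z] sr])
        (use z z0 r in \<open>auto intro!: ct_nonneg mult_nonneg_nonneg simp del: mem_state_set\<close>)
    then show ?thesis using Z(2) AE_space
    proof eventually_elim
      case (elim \<omega>)
      have "summable (\<lambda>n. min 1 (state_dist (iter n (xs, 1) \<omega>) (iter n z \<omega>)))"
        by (rule summable_state_dist_of_ct[OF _ _ elim(1)])
          (use z z0 elim(3) in \<open>auto simp del: mem_state_set\<close>)
      then show ?case by (rule tendsto_of_state_dist[OF elim(2) summable_LIMSEQ_zero])
    qed
  qed
  with Z show ?thesis by blast
qed

definition Z :: "'w stream \<Rightarrow> 'y \<times> nat" where
  "Z = (SOME Z. Z \<in> stream_space Om \<rightarrow>\<^sub>M state_space N \<and>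
     (\<forall>z\<in>state_set N. AE \<omega> in stream_space Om. (\<lambda>n. iter n z \<omega>) \<longlonglongrightarrow> Z \<omega>))"

lemma measurable_Z [measurable]: "Z \<in> stream_space Om \<rightarrow>\<^sub>M state_space N"
  and AE_tendsto_Z: "z \<in> state_set N \<Longrightarrow> AE \<omega> in stream_space Om. (\<lambda>n. iter n z \<omega>) \<longlonglongrightarrow> Z \<omega>"
  using someI_ex[OF ex_limit] unfolding Z_def by blast+

end

section \<open>Measures determined by the Fortet-Mourier class\<close>

lemma prob_measuresD:
  assumes "\<mu> \<in> prob_measures N"
  shows "prob_space \<mu>" "sets \<mu> = sets (state_space N)" "space \<mu> = state_set N"
  using assms sets_eq_imp_space_eq[of \<mu> "state_space N"] by (auto simp: prob_measures_def)

lemma FM_classD: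
  assumes "f \<in> FM_class N"
  shows "continuous_on (state_set N) f" "bounded (f ` state_set N)"
    "\<And>z w. z \<in> state_set N \<Longrightarrow> w \<in> state_set N \<Longrightarrow> \<bar>f z - f w\<bar> \<le> state_dist z w"
    "\<And>z. z \<in> state_set N \<Longrightarrow> \<bar>f z\<bar> \<le> 1"
  using assms by (auto simp: FM_class_def simp del: mem_state_set)

text \<open>Continuity in \<open>FM_class\<close> refers to the product topology, the Lipschitz
  bound to \<open>state_dist\<close>. Near a point the index is constant and
  \<open>state_dist\<close> reduces to the distance of positions, so the bound implies
  continuity.\<close>

lemma FM_class_I:
  assumes lip: "\<And>z w. z \<in> state_set N \<Longrightarrow> w \<in> state_set N \<Longrightarrow> \<bar>f z - f w\<bar> \<le> state_dist z w"
    and le: "\<And>z. z \<in> state_set N \<Longrightarrow> \<bar>f z\<bar> \<le> 1"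
  shows "f \<in> FM_class N"
proof -
  have "continuous_on (state_set N) f"
    unfolding continuous_on_def
  proof
    fix z :: "'a \<times> nat" assume z: "z \<in> state_set N"
    have "((\<lambda>w. dist (fst w) (fst z)) \<longlongrightarrow> 0) (at z within state_set N)"
      by (rule tendsto_dist_iff[THEN iffD1]) (intro tendsto_intros)
    moreover have "\<forall>\<^sub>F w in at z within state_set N. norm (f w - f z) \<le> dist (fst w) (fst z)"
    proof -
      have "\<forall>\<^sub>F w in at z within state_set N. snd w = snd z"
        unfolding tendsto_discrete[symmetric] by (intro tendsto_intros)
      moreover have "\<forall>\<^sub>F w in at z within state_set N. w \<in> state_set N"
        by (simp add: eventually_at_filter)
      ultimately show ?thesis
      proof eventually_elim
        case (elim w)
        have "state_dist w z = dist (fst w) (fst z)" using elim(1) by (simp add: state_dist_def)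
        then show ?case using lip[OF elim(2) z] by (metis real_norm_def)
      qed
    qed
    ultimately have "((\<lambda>w. f w - f z) \<longlongrightarrow> 0) (at z within state_set N)"
      by (rule Lim_null_comparison[rotated])
    then show "(f \<longlongrightarrow> f z) (at z within state_set N)" by (rule Lim_null[THEN iffD2])
  qed
  moreover have "bounded (f ` state_set N)"
    unfolding bounded_iff using le by (intro exI[of _ 1]) (auto simp del: mem_state_set)
  ultimately show ?thesis using assms unfolding FM_class_def by blast
qed

text \<open>\<open>C\<close> is nonempty because \<open>infdist\<close> to the empty set is 0 by
  convention, and the limit would be 1.\<close>

lemma tendsto_closed_indicator:
  fixes x :: "'a::metric_space"
  assumes "closed C" "C \<noteq> {}"
  shows "(\<lambda>n. max 0 (1 - real n * infdist x C)) \<longlonglongrightarrow> indicator C x"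
proof (cases "x \<in> C")
  case True
  then show ?thesis by simp
next
  case False
  then have pos: "infdist x C > 0" using assms in_closed_iff_infdist_zero infdist_nonneg
    by (metis less_eq_real_def)
  obtain n0 :: nat where n0: "1 / infdist x C < real n0" using reals_Archimedean2 by blast
  have "max 0 (1 - real n * infdist x C) = 0" if "n \<ge> n0" for n
  proof -
    have "1 / infdist x C < real n" using n0 that by linarith
    then show ?thesis using pos by (simp add: field_simps max_def)
  qed
  then have "\<forall>\<^sub>F n in sequentially. max 0 (1 - real n * infdist x C) = 0"
    unfolding eventually_sequentially by blast
  then show ?thesis using False by (simp add: tendsto_eventually)
qed

text \<open>Lipschitz functions approximate the indicators of closed sets inside one slice of
  constant index; closed sets are an intersection-stable generator, and a state measure is the sum
  of its \<open>N\<close> slices.\<close>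

lemma prob_measures_eqI:
  fixes \<mu> \<nu> :: "('y::polish_space \<times> nat) measure"
  assumes \<mu>: "\<mu> \<in> prob_measures N" and \<nu>: "\<nu> \<in> prob_measures N"
    and eq: "\<And>f. f \<in> FM_class N \<Longrightarrow> (\<integral>z. f z \<partial>\<mu>) = (\<integral>z. f z \<partial>\<nu>)"
  shows "\<mu> = \<nu>"
proof (rule measure_eqI)
  show "sets \<mu> = sets \<nu>" using prob_measuresD(2)[OF \<mu>] prob_measuresD(2)[OF \<nu>] by simp
  fix A assume "A \<in> sets \<mu>"
  then have A: "A \<in> sets (state_space N)" using prob_measuresD(2)[OF \<mu>] by simp
  have meas_C: "{z\<in>state_set N. snd z = j \<and> fst z \<in> B} \<in> sets (state_space N)"
    if "B \<in> sets borel" for j and B :: "'y set"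
  proof -
    have "(fst -` B \<inter> space (state_space N)) \<inter> (snd -` {j} \<inter> space (state_space N))
        \<in> sets (state_space N :: ('y \<times> nat) measure)"
      using that by (intro sets.Int measurable_sets[OF measurable_fst_state] measurable_sets[OF measurable_snd_state]) auto
    also have "(fst -` B \<inter> space (state_space N)) \<inter> (snd -` {j} \<inter> space (state_space N))
        = {z\<in>state_set N. snd z = j \<and> fst z \<in> B}" by auto
    finally show ?thesis .
  qed
  have closed_eq: "emeasure \<mu> {z\<in>state_set N. snd z = j \<and> fst z \<in> C} = emeasure \<nu> {z\<in>state_set N. snd z = j \<and> fst z \<in> C}"
    if C: "closed C" "C \<noteq> {}" for j and C :: "'y set"
  proof -
    define f where "f n z = (if snd z = j then max 0 (1 - real n * infdist (fst z) C) else 0)" for n and z :: "'y \<times> nat"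
    have f01: "0 \<le> f n z" "f n z \<le> 1" for n z by (auto simp: f_def infdist_nonneg)
    \<comment> \<open>\<open>f n\<close> has slope at most \<open>n\<close> within a slice and jumps
      by at most 1 between slices. Dividing by \<open>Suc n\<close>, which is positive also for
      \<open>n = 0\<close>, brings both under \<open>state_dist\<close>.\<close>
    have FM: "(\<lambda>z. f n z / Suc n) \<in> FM_class N" for n
    proof (rule FM_class_I)
      fix z w :: "'y \<times> nat" assume "z \<in> state_set N" "w \<in> state_set N"
      show "\<bar>f n z / Suc n - f n w / Suc n\<bar> \<le> state_dist z w"
      proof (cases "snd z = snd w")
        case True
        have "\<bar>max 0 u - max 0 v\<bar> \<le> \<bar>u - v\<bar>" for u v :: real by auto
        from this[of "1 - real n * infdist (fst z) C" "1 - real n * infdist (fst w) C"]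
        have "\<bar>f n z - f n w\<bar> \<le> \<bar>real n * (infdist (fst w) C - infdist (fst z) C)\<bar>"
          using True by (simp add: f_def right_diff_distrib)
        also have "\<dots> = real n * \<bar>infdist (fst z) C - infdist (fst w) C\<bar>"
          by (simp add: abs_mult abs_minus_commute)
        also have "\<dots> \<le> real (Suc n) * dist (fst z) (fst w)"
          using infdist_triangle_abs[of "fst z" C "fst w"] by (intro mult_mono) auto
        finally have "\<bar>f n z - f n w\<bar> / Suc n \<le> dist (fst z) (fst w)" by (simp add: field_simps)
        then show ?thesis using True by (simp add: state_dist_def diff_divide_distrib[symmetric])
      next
        case False
        have "\<bar>f n z - f n w\<bar> \<le> 1" using f01[of n z] f01[of n w] by (simp add: abs_if)
        then have "\<bar>f n z - f n w\<bar> / Suc n \<le> 1" by (simp add: field_simps)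
        moreover have "1 \<le> state_dist z w" using False by (simp add: state_dist_def)
        ultimately show ?thesis
          unfolding diff_divide_distrib[symmetric] abs_divide abs_of_nat by linarith
      qed
    next
      fix z :: "'y \<times> nat"
      show "\<bar>f n z / Suc n\<bar> \<le> 1" using f01[of n z] by (simp add: field_simps)
    qed
    have lim: "(\<lambda>n. \<integral>z. f n z \<partial>\<rho>) \<longlonglongrightarrow> measure \<rho> {z\<in>state_set N. snd z = j \<and> fst z \<in> C}"
      if \<rho>: "\<rho> \<in> prob_measures N" for \<rho> :: "('y \<times> nat) measure"
    proof -
      interpret prob_space \<rho> using \<rho> by (rule prob_measuresD)
      have [measurable]: "(\<lambda>z. f n z / Suc n) \<in> borel_measurable \<rho>" for n
        using borel_measurable_continuous_on_state[OF FM_classD(1)[OF FM]]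
        by (simp add: measurable_cong_sets[OF prob_measuresD(2)[OF \<rho>] refl])
      have [measurable]: "f n \<in> borel_measurable \<rho>" for n
      proof -
        have "(\<lambda>z. (f n z / Suc n) * Suc n) \<in> borel_measurable \<rho>" by measurable
        then show ?thesis by (simp del: of_nat_Suc)
      qed
      have Cs: "{z\<in>state_set N. snd z = j \<and> fst z \<in> C} \<in> sets \<rho>"
        using meas_C[of C j] C by (simp add: prob_measuresD[OF \<rho>] del: mem_state_set)
      have "(\<lambda>n. \<integral>z. f n z \<partial>\<rho>) \<longlonglongrightarrow> (\<integral>z. indicator {z\<in>state_set N. snd z = j \<and> fst z \<in> C} z \<partial>\<rho>)"
      proof (rule integral_dominated_convergence[where w="\<lambda>_. 1"])
        show "AE z in \<rho>. (\<lambda>n. f n z) \<longlonglongrightarrow> indicator {z\<in>state_set N. snd z = j \<and> fst z \<in> C} z"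
        proof (rule AE_I2)
          fix z assume "z \<in> space \<rho>"
          then have "z \<in> state_set N" by (simp add: prob_measuresD[OF \<rho>])
          then show "(\<lambda>n. f n z) \<longlonglongrightarrow> indicator {z\<in>state_set N. snd z = j \<and> fst z \<in> C} z"
            using tendsto_closed_indicator[OF C, of "fst z"]
            by (cases "snd z = j") (auto simp: f_def indicator_def)
        qed
      qed (use f01 Cs in auto)
      then show ?thesis using Cs by simp
    qed
    have "(\<integral>z. f n z \<partial>\<mu>) = (\<integral>z. f n z \<partial>\<nu>)" for n
      using eq[OF FM, of n] by (simp del: of_nat_Suc)
    then have "measure \<mu> {z\<in>state_set N. snd z = j \<and> fst z \<in> C} = measure \<nu> {z\<in>state_set N. snd z = j \<and> fst z \<in> C}"
      using LIMSEQ_unique[OF lim[OF \<mu>]] lim[OF \<nu>] by simp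
    then show ?thesis
      using finite_measure.emeasure_eq_measure[OF prob_space.finite_measure[OF prob_measuresD(1)[OF \<mu>]]]
        finite_measure.emeasure_eq_measure[OF prob_space.finite_measure[OF prob_measuresD(1)[OF \<nu>]]]
      by simp
  qed
  \<comment> \<open>Slice \<open>j\<close> is transported to the space of positions, where the
    closed sets generate the Borel sets.\<close>
  define sl where "sl \<rho> j = distr (restrict_space \<rho> {z\<in>state_set N. snd z = j}) (borel :: 'y measure) fst"
    for \<rho> :: "('y \<times> nat) measure" and j
  have em_sl: "emeasure (sl \<rho> j) B = emeasure \<rho> {z\<in>state_set N. snd z = j \<and> fst z \<in> B}"
    if \<rho>: "\<rho> \<in> prob_measures N" and B: "B \<in> sets borel" for \<rho> j B
  proof -
    have s: "{z\<in>state_set N. snd z = j} \<in> sets \<rho>" using meas_C[of UNIV j] by (simp add: prob_measuresD[OF \<rho>])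
    have "fst \<in> borel_measurable \<rho>"
      using measurable_fst_state by (simp add: measurable_cong_sets[OF prob_measuresD(2)[OF \<rho>] refl])
    then have "fst \<in> borel_measurable (restrict_space \<rho> {z\<in>state_set N. snd z = j})"
      by (rule measurable_restrict_space1)
    then have "emeasure (sl \<rho> j) B = emeasure \<rho> (fst -` B \<inter> space (restrict_space \<rho> {z\<in>state_set N. snd z = j}))"
      unfolding sl_def using B s
      by (subst emeasure_distr) (auto simp: emeasure_restrict_space space_restrict_space)
    also have "fst -` B \<inter> space (restrict_space \<rho> {z\<in>state_set N. snd z = j}) = {z\<in>state_set N. snd z = j \<and> fst z \<in> B}"
      by (auto simp: space_restrict_space prob_measuresD[OF \<rho>])
    finally show ?thesis .
  qed
  have sl_eq: "sl \<mu> j = sl \<nu> j" for j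
  proof (rule measure_eqI_generator_eq[where E="Collect closed" and A="\<lambda>_::nat. UNIV"])
    show "Int_stable (Collect closed :: 'y set set)" by (auto simp: Int_stable_def)
    show "emeasure (sl \<mu> j) X = emeasure (sl \<nu> j) X" if "X \<in> Collect closed" for X
      using that closed_eq[of X j] by (cases "X = {}") (auto simp: em_sl[OF \<mu>] em_sl[OF \<nu>])
    show "sets (sl \<mu> j) = sigma_sets UNIV (Collect closed)" "sets (sl \<nu> j) = sigma_sets UNIV (Collect closed)"
      by (simp_all add: sl_def borel_eq_closed)
    show "emeasure (sl \<mu> j) UNIV \<noteq> \<infinity>"
      using finite_measure.emeasure_finite[OF prob_space.finite_measure[OF prob_measuresD(1)[OF \<mu>]]]
      by (simp add: em_sl[OF \<mu>])
  qed auto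
  have decomp: "emeasure \<rho> A = (\<Sum>j\<in>{1..N}. emeasure (sl \<rho> j) {x. (x, j) \<in> A})"
    if \<rho>: "\<rho> \<in> prob_measures N" for \<rho>
  proof -
    have Aj: "{x. (x, j) \<in> A} \<in> sets borel" if "j \<in> {1..N}" for j
    proof -
      have "(\<lambda>x :: 'y. (x, j)) \<in> borel \<rightarrow>\<^sub>M state_space N"
        by (rule measurable_Pair_state) (use that in auto)
      from measurable_sets[OF this A] show ?thesis by (simp add: vimage_def)
    qed
    have sub: "A \<subseteq> state_set N" using sets.sets_into_space[OF A] by simp
    have s: "{z\<in>state_set N. snd z = j \<and> fst z \<in> {x. (x, j) \<in> A}} = A \<inter> {z. snd z = j}" if "j \<in> {1..N}" for j
      using sub that by (auto simp: prod_eq_iff)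
    have "A = (\<Union>j\<in>{1..N}. A \<inter> {z. snd z = j})" using sub by auto
    then have "emeasure \<rho> A = emeasure \<rho> (\<Union>j\<in>{1..N}. A \<inter> {z. snd z = j})" by simp
    also have "\<dots> = (\<Sum>j\<in>{1..N}. emeasure \<rho> (A \<inter> {z. snd z = j}))"
    proof (rule sum_emeasure[symmetric])
      show "(\<lambda>j. A \<inter> {z. snd z = j}) ` {1..N} \<subseteq> sets \<rho>"
      proof (rule image_subsetI)
        fix j assume j: "j \<in> {1..N}"
        show "A \<inter> {z. snd z = j} \<in> sets \<rho>"
          using meas_C[OF Aj[OF j], of j] unfolding s[OF j] prob_measuresD(2)[OF \<rho>] .
      qed
    qed (auto simp: disjoint_family_on_def)
    also have "\<dots> = (\<Sum>j\<in>{1..N}. emeasure (sl \<rho> j) {x. (x, j) \<in> A})"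
      by (intro sum.cong refl) (simp only: em_sl[OF \<rho> Aj] s)
    finally show ?thesis .
  qed
  show "emeasure \<mu> A = emeasure \<nu> A" unfolding decomp[OF \<mu>] decomp[OF \<nu>] sl_eq ..
qed

section \<open>Invariant measure and rate of convergence\<close>

text \<open>\<open>state_dist\<close> exceeds the distance of positions by at most 1, which a
  probability measure integrates; \<open>N \<ge> 1\<close> provides the reference state
  \<open>(x, 1)\<close>.\<close>

lemma prob_measures1_iff:
  fixes \<mu> :: "('y::polish_space \<times> nat) measure"
  assumes N: "N \<ge> 1" and \<mu>: "\<mu> \<in> prob_measures N"
  shows "\<mu> \<in> prob_measures1 N \<longleftrightarrow> (\<integral>\<^sup>+z. ennreal (dist (fst z) x) \<partial>\<mu>) < \<infinity>"
proof -
  interpret prob_space \<mu> using \<mu> by (rule prob_measuresD)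
  have m[measurable]: "(\<lambda>z. state_dist w z) \<in> borel_measurable \<mu>" "(\<lambda>z. dist (fst z) y) \<in> borel_measurable \<mu>"
    if "w \<in> state_set N" for w y
  proof -
    show "(\<lambda>z. state_dist w z) \<in> borel_measurable \<mu>"
      using measurable_compose_Pair1[OF _ measurable_state_dist, of w N] that
      by (simp add: measurable_cong_sets[OF prob_measuresD(2)[OF \<mu>] refl])
    have "(\<lambda>z. dist (fst z) y) \<in> borel_measurable (state_space N)" by measurable
    then show "(\<lambda>z. dist (fst z) y) \<in> borel_measurable \<mu>"
      by (simp add: measurable_cong_sets[OF prob_measuresD(2)[OF \<mu>] refl])
  qed
  show ?thesis
  proof
    assume "\<mu> \<in> prob_measures1 N"
    then obtain w where w: "w \<in> state_set N" "(\<integral>\<^sup>+z. ennreal (state_dist w z) \<partial>\<mu>) < \<infinity>"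
      by (auto simp: prob_measures1_def simp del: mem_state_set)
    have "(\<integral>\<^sup>+z. ennreal (dist (fst z) x) \<partial>\<mu>)
        \<le> (\<integral>\<^sup>+z. ennreal (state_dist w z) + ennreal (dist (fst w) x) \<partial>\<mu>)"
    proof (rule nn_integral_mono)
      fix z :: "'y \<times> nat"
      have "dist (fst z) x \<le> state_dist w z + dist (fst w) x"
        using dist_triangle[of "fst z" x "fst w"] by (simp add: state_dist_def dist_commute)
      then show "ennreal (dist (fst z) x) \<le> ennreal (state_dist w z) + ennreal (dist (fst w) x)"
        by (simp add: ennreal_plus[symmetric] state_dist_nonneg ennreal_leI del: ennreal_plus)
    qed
    also have "\<dots> = (\<integral>\<^sup>+z. ennreal (state_dist w z) \<partial>\<mu>) + ennreal (dist (fst w) x)"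
      using m(1)[OF w(1)] by (subst nn_integral_add) (auto simp: emeasure_space_1)
    also have "\<dots> < \<infinity>" using w(2) by (simp add: ennreal_add_eq_top less_top[symmetric])
    finally show "(\<integral>\<^sup>+z. ennreal (dist (fst z) x) \<partial>\<mu>) < \<infinity>" .
  next
    assume fin: "(\<integral>\<^sup>+z. ennreal (dist (fst z) x) \<partial>\<mu>) < \<infinity>"
    have w: "(x, 1) \<in> state_set N" using N by simp
    have "(\<integral>\<^sup>+z. ennreal (state_dist (x, 1) z) \<partial>\<mu>) \<le> (\<integral>\<^sup>+z. ennreal (dist (fst z) x) + 1 \<partial>\<mu>)"
    proof (rule nn_integral_mono)
      fix z :: "'y \<times> nat"
      have "state_dist (x, 1) z \<le> dist (fst z) x + 1" by (simp add: state_dist_def dist_commute)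
      then show "ennreal (state_dist (x, 1) z) \<le> ennreal (dist (fst z) x) + 1"
        by (simp add: ennreal_plus[symmetric] ennreal_1[symmetric] ennreal_leI del: ennreal_plus ennreal_1)
    qed
    also have "\<dots> = (\<integral>\<^sup>+z. ennreal (dist (fst z) x) \<partial>\<mu>) + 1"
      using m(2)[OF w] by (subst nn_integral_add) (auto simp: emeasure_space_1)
    also have "\<dots> < \<infinity>" using fin by (simp add: ennreal_add_eq_top less_top[symmetric])
    finally show "\<mu> \<in> prob_measures1 N" using \<mu> w unfolding prob_measures1_def by blast
  qed
qed

context contractive_maps
begin

definition bdd_meas :: "('y \<times> nat \<Rightarrow> real) \<Rightarrow> bool" where
  "bdd_meas f \<longleftrightarrow> f \<in> borel_measurable (state_space N) \<and> (\<exists>B. \<forall>z\<in>state_set N. \<bar>f z\<bar> \<le> B)"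

text \<open>\<open>Ufun\<close> and \<open>Pmap\<close> are the transition operators of the abstract
  random map, on functions and on measures. They are identified with \<open>U_op\<close> and
  \<open>P_op\<close> once the map is the sampler of the jump process.\<close>

definition Ufun :: "('y \<times> nat \<Rightarrow> real) \<Rightarrow> 'y \<times> nat \<Rightarrow> real" where
  "Ufun f z = (\<integral>\<omega>. f (F z \<omega>) \<partial>Om)"

definition Pmap :: "('y \<times> nat) measure \<Rightarrow> ('y \<times> nat) measure" where
  "Pmap \<mu> = distr (\<mu> \<Otimes>\<^sub>M Om) (state_space N) (\<lambda>(z, \<omega>). F z \<omega>)"

definition \<mu>0 :: "('y \<times> nat) measure" where
  "\<mu>0 = distr (stream_space Om) (state_space N) Z"

lemma bdd_measD [dest]: "bdd_meas f \<Longrightarrow> f \<in> borel_measurable (state_space N)"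
  by (simp add: bdd_meas_def)

lemma bdd_meas_continuous:
  assumes "continuous_on (state_set N) f" "bounded (f ` state_set N)"
  shows "bdd_meas f"
  using assms borel_measurable_continuous_on_state unfolding bdd_meas_def bounded_iff
  by (auto simp del: mem_state_set)

lemma integrable_bdd_meas:
  assumes f: "bdd_meas f" and X: "X \<in> M \<rightarrow>\<^sub>M state_space N" and M: "prob_space M"
  shows "integrable M (\<lambda>x. f (X x))"
proof -
  interpret M: prob_space M by fact
  obtain B where B: "\<And>z. z \<in> state_set N \<Longrightarrow> \<bar>f z\<bar> \<le> B" using f by (auto simp: bdd_meas_def simp del: mem_state_set)
  show ?thesis
    using f measurable_space[OF X]
    by (intro M.abs_integral_le(1)[of _ B] measurable_compose[OF X] B) (auto simp: bdd_meas_def)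
qed

lemma bdd_meas_Ufun: assumes f: "bdd_meas f" shows "bdd_meas (Ufun f)"
proof -
  obtain B where B: "\<And>z. z \<in> state_set N \<Longrightarrow> \<bar>f z\<bar> \<le> B" using f by (auto simp: bdd_meas_def simp del: mem_state_set)
  have [measurable]: "f \<in> borel_measurable (state_space N)" using f ..
  have "\<bar>Ufun f z\<bar> \<le> B" if "z \<in> state_set N" for z
    unfolding Ufun_def using that by (intro abs_integral_le(2) B F_in_state_set) auto
  moreover have "Ufun f \<in> borel_measurable (state_space N)"
    unfolding Ufun_def by measurable
  ultimately show ?thesis unfolding bdd_meas_def by blast
qed

lemma bdd_meas_Ufun_pow: "bdd_meas f \<Longrightarrow> bdd_meas ((Ufun ^^ n) f)"
  by (induction n) (auto intro: bdd_meas_Ufun)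

text \<open>At each fixed time the backward iterate has the law of the chain. In the induction
  \<open>Ufun\<close> is peeled off next to \<open>f\<close>, because the head of the stream acts
  last.\<close>

lemma Ufun_pow_eq:
  assumes "bdd_meas f" and z: "z \<in> state_set N"
  shows "(Ufun ^^ n) f z = (\<integral>\<omega>. f (iter n z \<omega>) \<partial>stream_space Om)"
  using assms(1)
proof (induction n arbitrary: f)
  case 0
  then show ?case by (simp add: Str.prob_space)
next
  case (Suc n)
  have "(Ufun ^^ Suc n) f z = (\<integral>\<omega>. Ufun f (iter n z \<omega>) \<partial>stream_space Om)"
    using Suc.IH[OF bdd_meas_Ufun[OF Suc.prems]] by (simp add: funpow_swap1)
  also have "\<dots> = (\<integral>\<omega>. f (iter (Suc n) z \<omega>) \<partial>stream_space Om)"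
    using integral_stream_space_swap[OF integrable_bdd_meas[OF Suc.prems measurable_iter1[OF z] Str.prob_space_axioms], of "Suc n"]
    by (simp add: Ufun_def)
  finally show ?case .
qed

lemma integral_mu0: "bdd_meas f \<Longrightarrow> (\<integral>z. f z \<partial>\<mu>0) = (\<integral>\<omega>. f (Z \<omega>) \<partial>stream_space Om)"
  unfolding \<mu>0_def by (rule integral_distr) auto

lemma mu0_in: "\<mu>0 \<in> prob_measures N"
  unfolding prob_measures_def \<mu>0_def by (auto intro: Str.prob_space_distr)

lemma Ufun_pow_tendsto:
  assumes f: "continuous_on (state_set N) f" "bounded (f ` state_set N)" and z: "z \<in> state_set N"
  shows "(\<lambda>n. (Ufun ^^ n) f z) \<longlonglongrightarrow> (\<integral>z. f z \<partial>\<mu>0)"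
proof -
  note bm = bdd_meas_continuous[OF f]
  obtain B where B: "\<And>z. z \<in> state_set N \<Longrightarrow> \<bar>f z\<bar> \<le> B" using bm by (auto simp: bdd_meas_def simp del: mem_state_set)
  have [measurable]: "f \<in> borel_measurable (state_space N)" using bm ..
  have Zin: "Z \<omega> \<in> state_set N" if "\<omega> \<in> space (stream_space Om)" for \<omega>
    using measurable_space[OF measurable_Z that] by simp
  have "(\<lambda>n. \<integral>\<omega>. f (iter n z \<omega>) \<partial>stream_space Om) \<longlonglongrightarrow> (\<integral>\<omega>. f (Z \<omega>) \<partial>stream_space Om)"
  proof (rule integral_dominated_convergence[where w="\<lambda>_. B"])
    show "AE \<omega> in stream_space Om. (\<lambda>n. f (iter n z \<omega>)) \<longlonglongrightarrow> f (Z \<omega>)"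
      using AE_tendsto_Z[OF z] AE_space
    proof eventually_elim
      case (elim \<omega>)
      show ?case
        by (rule continuous_on_tendsto_compose[OF f(1) elim(1) Zin[OF elim(2)]])
          (use elim(2) z in \<open>auto simp del: mem_state_set\<close>)
    qed
    show "AE \<omega> in stream_space Om. norm (f (iter n z \<omega>)) \<le> B" for n
      using AE_space by eventually_elim (use B z in \<open>auto simp del: mem_state_set\<close>)
  qed (use z in auto)
  then show ?thesis by (simp add: Ufun_pow_eq[OF bm z] integral_mu0[OF bm])
qed

lemma integral_Ufun_pow_tendsto:
  assumes f: "continuous_on (state_set N) f" "bounded (f ` state_set N)" and \<mu>: "\<mu> \<in> prob_measures N"
  shows "(\<lambda>n. \<integral>z. (Ufun ^^ n) f z \<partial>\<mu>) \<longlonglongrightarrow> (\<integral>z. f z \<partial>\<mu>0)"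
proof -
  interpret \<mu>: prob_space \<mu> using \<mu> by (rule prob_measuresD)
  note bm = bdd_meas_continuous[OF f]
  obtain B where B: "\<And>z. z \<in> state_set N \<Longrightarrow> \<bar>f z\<bar> \<le> B" using bm by (auto simp: bdd_meas_def simp del: mem_state_set)
  have [measurable]: "f \<in> borel_measurable (state_space N)" using bm ..
  have m: "(Ufun ^^ n) f \<in> borel_measurable \<mu>" for n
    using bdd_meas_Ufun_pow[OF bm, of n] by (auto simp: measurable_cong_sets[OF prob_measuresD(2)[OF \<mu>] refl])
  have "(\<lambda>n. \<integral>z. (Ufun ^^ n) f z \<partial>\<mu>) \<longlonglongrightarrow> (\<integral>z. (\<integral>z. f z \<partial>\<mu>0) \<partial>\<mu>)"
  proof (rule integral_dominated_convergence[where w="\<lambda>_. B"])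
    show "AE z in \<mu>. (\<lambda>n. (Ufun ^^ n) f z) \<longlonglongrightarrow> (\<integral>z. f z \<partial>\<mu>0)"
      using Ufun_pow_tendsto[OF f] by (intro AE_I2) (auto simp: prob_measuresD[OF \<mu>] simp del: mem_state_set)
    have "\<bar>(Ufun ^^ n) f z\<bar> \<le> B" if "z \<in> state_set N" for n z
      unfolding Ufun_pow_eq[OF bm that]
      using that by (intro Str.abs_integral_le(2)) (auto intro!: B simp del: mem_state_set)
    then show "AE z in \<mu>. norm ((Ufun ^^ n) f z) \<le> B" for n
      by (intro AE_I2) (auto simp: prob_measuresD[OF \<mu>] simp del: mem_state_set)
  qed (use m in auto)
  then show ?thesis by (simp add: \<mu>.prob_space)
qed

lemma Pmap_in:
  assumes \<mu>: "\<mu> \<in> prob_measures N" shows "Pmap \<mu> \<in> prob_measures N"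
proof -
  interpret \<mu>: prob_space \<mu> using \<mu> by (rule prob_measuresD)
  interpret pair_prob_space \<mu> Om ..
  have [measurable_cong]: "sets \<mu> = sets (state_space N)" using \<mu> by (rule prob_measuresD)
  show ?thesis unfolding prob_measures_def Pmap_def by (auto intro!: P.prob_space_distr)
qed

lemma Pmap_pow_in: "\<mu> \<in> prob_measures N \<Longrightarrow> (Pmap ^^ n) \<mu> \<in> prob_measures N"
  by (induction n) (auto intro: Pmap_in)

lemma integral_Pmap:
  assumes \<mu>: "\<mu> \<in> prob_measures N" and f: "bdd_meas f"
  shows "(\<integral>z. f z \<partial>Pmap \<mu>) = (\<integral>z. Ufun f z \<partial>\<mu>)"
proof -
  interpret \<mu>: prob_space \<mu> using \<mu> by (rule prob_measuresD)
  interpret pair_prob_space \<mu> Om ..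
  have [measurable_cong]: "sets \<mu> = sets (state_space N)" using \<mu> by (rule prob_measuresD)
  have [measurable]: "f \<in> borel_measurable (state_space N)" using f ..
  have m: "(\<lambda>(z, \<omega>). F z \<omega>) \<in> \<mu> \<Otimes>\<^sub>M Om \<rightarrow>\<^sub>M state_space N" by measurable
  have i: "integrable (\<mu> \<Otimes>\<^sub>M Om) (\<lambda>(z, \<omega>). f (F z \<omega>))"
    using integrable_bdd_meas[OF f m P.prob_space_axioms] by (simp add: case_prod_beta')
  have "(\<integral>z. f z \<partial>Pmap \<mu>) = (\<integral>p. f (case p of (z, \<omega>) \<Rightarrow> F z \<omega>) \<partial>(\<mu> \<Otimes>\<^sub>M Om))"
    unfolding Pmap_def by (rule integral_distr[OF m]) measurable
  also have "\<dots> = (\<integral>z. \<integral>\<omega>. f (F z \<omega>) \<partial>Om \<partial>\<mu>)"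
    using integral_fst[OF i] by (simp add: case_prod_beta')
  finally show ?thesis by (simp add: Ufun_def)
qed

lemma integral_Pmap_pow:
  assumes \<mu>: "\<mu> \<in> prob_measures N" and "bdd_meas f"
  shows "(\<integral>z. f z \<partial>(Pmap ^^ n) \<mu>) = (\<integral>z. (Ufun ^^ n) f z \<partial>\<mu>)"
  using assms(2)
proof (induction n arbitrary: f)
  case (Suc n)
  have "(\<integral>z. f z \<partial>(Pmap ^^ Suc n) \<mu>) = (\<integral>z. Ufun f z \<partial>(Pmap ^^ n) \<mu>)"
    using integral_Pmap[OF Pmap_pow_in[OF \<mu>] Suc.prems] by simp
  then show ?case using Suc.IH[OF bdd_meas_Ufun[OF Suc.prems]] by (simp add: funpow_swap1)
qed simp

text \<open>For functions that are Lipschitz with respect to the cost, the mean contraction of the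
  cost becomes geometric decay of the differences of the iterates.\<close>

lemma Ufun_pow_contraction:
  assumes f: "bdd_meas f" and Lf: "0 \<le> Lf"
    and lip: "\<And>z w. z \<in> state_set N \<Longrightarrow> w \<in> state_set N \<Longrightarrow> \<bar>f z - f w\<bar> \<le> Lf * ct z w"
    and z: "z \<in> state_set N" and w: "w \<in> state_set N"
  shows "\<bar>(Ufun ^^ n) f z - (Ufun ^^ n) f w\<bar> \<le> Lf * (ct z w * r ^ n)"
proof -
  have i: "integrable (stream_space Om) (\<lambda>\<omega>. f (iter n z \<omega>))" "integrable (stream_space Om) (\<lambda>\<omega>. f (iter n w \<omega>))"
    by (intro integrable_bdd_meas[OF f] measurable_iter1 z w Str.prob_space_axioms)+
  have "ennreal \<bar>\<integral>\<omega>. f (iter n z \<omega>) - f (iter n w \<omega>) \<partial>stream_space Om\<bar>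
      \<le> (\<integral>\<^sup>+\<omega>. ennreal \<bar>f (iter n z \<omega>) - f (iter n w \<omega>)\<bar> \<partial>stream_space Om)"
    using integral_norm_bound_ennreal[of "stream_space Om" "\<lambda>\<omega>. f (iter n z \<omega>) - f (iter n w \<omega>)"] i by simp
  also have "\<dots> \<le> (\<integral>\<^sup>+\<omega>. ennreal Lf * ennreal (ct (iter n z \<omega>) (iter n w \<omega>)) \<partial>stream_space Om)"
  proof (rule nn_integral_mono)
    fix \<omega> assume "\<omega> \<in> space (stream_space Om)"
    then have "iter n z \<omega> \<in> state_set N" "iter n w \<omega> \<in> state_set N"
      using z w by (simp_all del: mem_state_set)
    from lip[OF this] ct_nonneg[OF this] Lf
    show "ennreal \<bar>f (iter n z \<omega>) - f (iter n w \<omega>)\<bar> \<le> ennreal Lf * ennreal (ct (iter n z \<omega>) (iter n w \<omega>))"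
      by (simp add: ennreal_mult[symmetric] ennreal_leI)
  qed
  also have "\<dots> = ennreal Lf * (\<integral>\<^sup>+\<omega>. ennreal (ct (iter n z \<omega>) (iter n w \<omega>)) \<partial>stream_space Om)"
    using z w by (intro nn_integral_cmult) auto
  also have "\<dots> \<le> ennreal Lf * ennreal (ct z w * r ^ n)"
    by (intro mult_left_mono nn_integral_ct_iter z w) simp
  also have "\<dots> = ennreal (Lf * (ct z w * r ^ n))"
    using Lf r ct_nonneg[OF z w] by (simp add: ennreal_mult[symmetric])
  finally show ?thesis
    using Lf r ct_nonneg[OF z w] i
    by (subst (asm) ennreal_le_iff) (auto simp: Ufun_pow_eq[OF f z] Ufun_pow_eq[OF f w])
qed

text \<open>A Feller property for cost-Lipschitz functions: one step of contraction bounds the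
  increment of \<open>Ufun f\<close> by a multiple of \<open>ct\<close>, which tends to 0 at the
  diagonal. It admits \<open>Ufun f\<close> as a test function in the proof of invariance.\<close>

lemma continuous_on_Ufun:
  assumes f: "bdd_meas f" and Lf: "0 \<le> Lf"
    and lip: "\<And>z w. z \<in> state_set N \<Longrightarrow> w \<in> state_set N \<Longrightarrow> \<bar>f z - f w\<bar> \<le> Lf * ct z w"
  shows "continuous_on (state_set N) (Ufun f)"
  unfolding continuous_on_def
proof
  fix z :: "'y \<times> nat" assume z: "z \<in> state_set N"
  have "((\<lambda>w. Lf * (ct z w * r)) \<longlongrightarrow> Lf * (0 * r)) (at z within state_set N)"
    by (intro tendsto_intros ct_tendsto z)
  then have lim: "((\<lambda>w. Lf * (ct z w * r)) \<longlongrightarrow> 0) (at z within state_set N)" by simp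
  have "\<forall>\<^sub>F w in at z within state_set N. w \<in> state_set N" by (simp add: eventually_at_filter)
  then have "\<forall>\<^sub>F w in at z within state_set N. norm (Ufun f w - Ufun f z) \<le> Lf * (ct z w * r)"
  proof eventually_elim
    case (elim w)
    show ?case
      using Ufun_pow_contraction[OF f Lf lip z elim, of 1] by (simp add: abs_minus_commute)
  qed
  from Lim_null_comparison[OF this lim]
  show "(Ufun f \<longlongrightarrow> Ufun f z) (at z within state_set N)" by (rule Lim_null[THEN iffD2])
qed

text \<open>The factor 2 is the oscillation of a function bounded by 1, and \<open>\<eta>\<close>
  comes from the lower bound for the cost.\<close>

lemma FM_class_lip_ct:
  assumes f: "f \<in> FM_class N" and z: "z \<in> state_set N" and w: "w \<in> state_set N"
  shows "\<bar>f z - f w\<bar> \<le> 2 / \<eta> * ct z w"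
proof -
  have "\<bar>f z - f w\<bar> \<le> 2 * min 1 (state_dist z w)"
    using FM_classD(3)[OF f z w] FM_classD(4)[OF f z] FM_classD(4)[OF f w] state_dist_nonneg[of z w]
    by (auto simp: min_def)
  also have "\<dots> = 2 / \<eta> * (\<eta> * min 1 (state_dist z w))" using \<eta> by simp
  also have "\<dots> \<le> 2 / \<eta> * ct z w" using \<eta> by (intro mult_left_mono ct_lower z w) simp
  finally show ?thesis .
qed

lemma bdd_meas_FM: "f \<in> FM_class N \<Longrightarrow> bdd_meas f"
  using FM_classD by (intro bdd_meas_continuous)

text \<open>The iterates of \<open>Ufun\<close> at \<open>Ufun f\<close> are the shifted iterates at
  \<open>f\<close>; one way of taking the limit gives the integral of \<open>Ufun f\<close>, the
  other that of \<open>f\<close>. The Fortet-Mourier class suffices, as it determines the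
  measure.\<close>

lemma Pmap_mu0: "Pmap \<mu>0 = \<mu>0"
proof (rule prob_measures_eqI[OF Pmap_in[OF mu0_in] mu0_in])
  fix f :: "'y \<times> nat \<Rightarrow> real" assume f: "f \<in> FM_class N"
  have z: "(xs, 1) \<in> state_set N" using N by simp
  have c: "continuous_on (state_set N) (Ufun f)"
    using \<eta> by (intro continuous_on_Ufun[OF bdd_meas_FM[OF f] _ FM_class_lip_ct[OF f]]) simp
  have "bounded (Ufun f ` state_set N)"
    using bdd_meas_Ufun[OF bdd_meas_FM[OF f]] unfolding bdd_meas_def bounded_iff by (auto simp del: mem_state_set)
  from Ufun_pow_tendsto[OF c this z]
  have "(\<lambda>n. (Ufun ^^ Suc n) f (xs, 1)) \<longlonglongrightarrow> (\<integral>z. Ufun f z \<partial>\<mu>0)" by (simp add: funpow_swap1)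
  moreover have "(\<lambda>n. (Ufun ^^ Suc n) f (xs, 1)) \<longlonglongrightarrow> (\<integral>z. f z \<partial>\<mu>0)"
    using Ufun_pow_tendsto[OF FM_classD(1,2)[OF f] z] by (rule LIMSEQ_Suc)
  ultimately show "(\<integral>z. f z \<partial>Pmap \<mu>0) = (\<integral>z. f z \<partial>\<mu>0)"
    using integral_Pmap[OF mu0_in bdd_meas_FM[OF f]] LIMSEQ_unique by metis
qed

text \<open>For an invariant measure the integrals of the iterates are constant, and they converge
  to the integral against \<open>\<mu>0\<close>. Uniqueness thus holds among all probability
  measures.\<close>

lemma Pmap_invariant_unique:
  assumes \<nu>: "\<nu> \<in> prob_measures N" and "Pmap \<nu> = \<nu>"
  shows "\<nu> = \<mu>0"
proof (rule prob_measures_eqI[OF \<nu> mu0_in])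
  fix f :: "'y \<times> nat \<Rightarrow> real" assume f: "f \<in> FM_class N"
  have "(Pmap ^^ n) \<nu> = \<nu>" for n by (induction n) (auto simp: assms(2))
  then have "(\<integral>z. (Ufun ^^ n) f z \<partial>\<nu>) = (\<integral>z. f z \<partial>\<nu>)" for n
    using integral_Pmap_pow[OF \<nu> bdd_meas_FM[OF f], of n] by simp
  with integral_Ufun_pow_tendsto[OF FM_classD(1,2)[OF f] \<nu>] show "(\<integral>z. f z \<partial>\<nu>) = (\<integral>z. f z \<partial>\<mu>0)"
    by (simp add: LIMSEQ_const_iff)
qed

text \<open>Fatou along the orbit of \<open>(xs, 1)\<close>, where \<open>V\<close> starts at
  0.\<close>

lemma nn_integral_V_mu0: "(\<integral>\<^sup>+z. ennreal (V z) \<partial>\<mu>0) \<le> ennreal (b / (1 - a))"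
proof -
  have z: "(xs, 1) \<in> state_set N" using N by simp
  have "(\<integral>\<^sup>+z. ennreal (V z) \<partial>\<mu>0) = (\<integral>\<^sup>+\<omega>. ennreal (V (Z \<omega>)) \<partial>stream_space Om)"
    unfolding \<mu>0_def by (rule nn_integral_distr) auto
  also have "\<dots> \<le> (\<integral>\<^sup>+\<omega>. liminf (\<lambda>n. ennreal (V (iter n (xs, 1) \<omega>))) \<partial>stream_space Om)"
  proof (rule nn_integral_mono_AE)
    show "AE \<omega> in stream_space Om. ennreal (V (Z \<omega>)) \<le> liminf (\<lambda>n. ennreal (V (iter n (xs, 1) \<omega>)))"
      using AE_tendsto_Z[OF z]
    proof eventually_elim
      case (elim \<omega>)
      have "(\<lambda>n. ennreal (V (iter n (xs, 1) \<omega>))) \<longlonglongrightarrow> ennreal (V (Z \<omega>))"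
        unfolding V_def by (intro tendsto_intros elim)
      from lim_imp_Liminf[OF sequentially_bot this] show ?case by simp
    qed
  qed
  also have "\<dots> \<le> liminf (\<lambda>n. \<integral>\<^sup>+\<omega>. ennreal (V (iter n (xs, 1) \<omega>)) \<partial>stream_space Om)"
    using z by (intro nn_integral_liminf) auto
  also have "\<dots> \<le> liminf (\<lambda>n. ennreal (b / (1 - a)))"
    using nn_integral_V_iter[OF z] by (intro Liminf_mono always_eventually allI) (simp add: V_def)
  finally show ?thesis by (simp add: Liminf_const)
qed

lemma integrable_V:
  assumes \<mu>: "\<mu> \<in> prob_measures N" and "(\<integral>\<^sup>+z. ennreal (V z) \<partial>\<mu>) < \<infinity>"
  shows "integrable \<mu> V"
proof (rule integrableI_bounded)
  show "V \<in> borel_measurable \<mu>"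
    using measurable_V by (simp add: measurable_cong_sets[OF prob_measuresD(2)[OF \<mu>] refl])
qed (use assms(2) in simp)

lemma mu0_V: "integrable \<mu>0 V" "(\<integral>z. V z \<partial>\<mu>0) \<le> b / (1 - a)"
proof -
  show i: "integrable \<mu>0 V"
    by (rule integrable_V[OF mu0_in le_less_trans[OF nn_integral_V_mu0]]) simp
  show "(\<integral>z. V z \<partial>\<mu>0) \<le> b / (1 - a)"
    using nn_integral_V_mu0 a b by (subst (asm) nn_integral_eq_integral[OF i]) auto
qed

lemma mu0_in1: "\<mu>0 \<in> prob_measures1 N"
proof -
  have "(\<integral>\<^sup>+z. ennreal (dist (fst z) xs) \<partial>\<mu>0) < \<infinity>"
    using nn_integral_V_mu0 unfolding V_def by (rule le_less_trans) simp
  then show ?thesis using prob_measures1_iff[OF N mu0_in] by blast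
qed

text \<open>The two-point bound is averaged over a second state distributed according to
  \<open>\<mu>0\<close>; invariance allows the integral of \<open>f\<close> to be written as that of
  its \<open>n\<close>-th iterate.\<close>

lemma Ufun_pow_rate:
  assumes f: "bdd_meas f" and Lf: "0 \<le> Lf"
    and lip: "\<And>z w. z \<in> state_set N \<Longrightarrow> w \<in> state_set N \<Longrightarrow> \<bar>f z - f w\<bar> \<le> Lf * ct z w"
    and z: "z \<in> state_set N"
  shows "\<bar>(Ufun ^^ n) f z - (\<integral>w. f w \<partial>\<mu>0)\<bar> \<le> Lf * (1 + b / (1 - a) + V z) * r ^ n"
proof -
  interpret \<mu>0: prob_space \<mu>0 using mu0_in by (rule prob_measuresD)
  have "(Pmap ^^ n) \<mu>0 = \<mu>0" by (induction n) (auto simp: Pmap_mu0)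
  then have inv: "(\<integral>w. f w \<partial>\<mu>0) = (\<integral>w. (Ufun ^^ n) f w \<partial>\<mu>0)"
    using integral_Pmap_pow[OF mu0_in f, of n] by simp
  have id: "(\<lambda>w. w) \<in> \<mu>0 \<rightarrow>\<^sub>M state_space N" by (simp add: \<mu>0_def)
  have iU: "integrable \<mu>0 ((Ufun ^^ n) f)"
    using integrable_bdd_meas[OF bdd_meas_Ufun_pow[OF f] id \<mu>0.prob_space_axioms] .
  have "\<bar>(Ufun ^^ n) f z - (\<integral>w. f w \<partial>\<mu>0)\<bar> = \<bar>\<integral>w. (Ufun ^^ n) f z - (Ufun ^^ n) f w \<partial>\<mu>0\<bar>"
    unfolding inv using iU by (simp add: \<mu>0.prob_space)
  also have "\<dots> \<le> (\<integral>w. \<bar>(Ufun ^^ n) f z - (Ufun ^^ n) f w\<bar> \<partial>\<mu>0)" by (rule integral_abs_bound)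
  also have "\<dots> \<le> (\<integral>w. Lf * r ^ n * (1 + V z + V w) \<partial>\<mu>0)"
  proof (rule integral_mono)
    fix w assume "w \<in> space \<mu>0"
    then have w: "w \<in> state_set N" by (simp add: prob_measuresD[OF mu0_in])
    have "Lf * (ct z w * r ^ n) \<le> Lf * ((1 + V z + V w) * r ^ n)"
      using Lf r ct_upper[OF z w] unfolding V_def by (intro mult_left_mono mult_right_mono) auto
    with Ufun_pow_contraction[OF f Lf lip z w, of n]
    show "\<bar>(Ufun ^^ n) f z - (Ufun ^^ n) f w\<bar> \<le> Lf * r ^ n * (1 + V z + V w)" by (simp add: algebra_simps)
  qed (use iU mu0_V(1) in auto)
  also have "\<dots> = Lf * r ^ n * (1 + V z + (\<integral>w. V w \<partial>\<mu>0))"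
    using mu0_V(1) by (simp add: \<mu>0.prob_space)
  also have "\<dots> \<le> Lf * r ^ n * (1 + V z + b / (1 - a))"
    using Lf r mu0_V(2) by (intro mult_left_mono) auto
  finally show ?thesis by (simp add: algebra_simps)
qed

lemma FM_dist_Pmap_pow:
  assumes \<mu>: "\<mu> \<in> prob_measures1 N"
  shows "FM_dist N ((Pmap ^^ n) \<mu>) \<mu>0
    \<le> r ^ n * (2 / \<eta> * (1 + b / (1 - a))) * (1 + (\<integral>z. dist (fst z) xs \<partial>\<mu>))"
  unfolding FM_dist_def
proof (rule cSUP_least)
  show "FM_class N \<noteq> ({} :: ('y \<times> nat \<Rightarrow> real) set)"
    using FM_class_I[of N "\<lambda>_. 0"] state_dist_nonneg by force
  have \<mu>': "\<mu> \<in> prob_measures N" using \<mu> by (simp add: prob_measures1_def)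
  interpret \<mu>: prob_space \<mu> using \<mu>' by (rule prob_measuresD)
  have iV: "integrable \<mu> V"
    using prob_measures1_iff[OF N \<mu>', of xs] \<mu> by (intro integrable_V[OF \<mu>']) (simp add: V_def)
  fix f :: "'y \<times> nat \<Rightarrow> real" assume f: "f \<in> FM_class N"
  note bm = bdd_meas_FM[OF f]
  have iU: "integrable \<mu> ((Ufun ^^ n) f)"
    using integrable_bdd_meas[OF bdd_meas_Ufun_pow[OF bm], of "\<lambda>z. z" \<mu> n] \<mu>.prob_space_axioms
    by (simp add: measurable_ident_sets prob_measuresD[OF \<mu>'])
  have b': "0 \<le> b / (1 - a)" using a b by simp
  have "\<bar>(\<integral>z. f z \<partial>(Pmap ^^ n) \<mu>) - (\<integral>z. f z \<partial>\<mu>0)\<bar> = \<bar>\<integral>z. (Ufun ^^ n) f z - (\<integral>z. f z \<partial>\<mu>0) \<partial>\<mu>\<bar>"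
    using iU by (simp add: integral_Pmap_pow[OF \<mu>' bm] \<mu>.prob_space)
  also have "\<dots> \<le> (\<integral>z. \<bar>(Ufun ^^ n) f z - (\<integral>z. f z \<partial>\<mu>0)\<bar> \<partial>\<mu>)" by (rule integral_abs_bound)
  also have "\<dots> \<le> (\<integral>z. 2 / \<eta> * (1 + b / (1 - a) + V z) * r ^ n \<partial>\<mu>)"
    using Ufun_pow_rate[OF bm _ FM_class_lip_ct[OF f]] \<eta> iU iV
    by (intro integral_mono) (auto simp: prob_measuresD[OF \<mu>'] simp del: mem_state_set)
  also have "\<dots> = 2 / \<eta> * (1 + b / (1 - a) + (\<integral>z. V z \<partial>\<mu>)) * r ^ n"
    using iV by (simp add: \<mu>.prob_space)
  \<comment> \<open>With \<open>B = b / (1 - a)\<close> and \<open>v\<close> the mean of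
    \<open>V\<close>, the inequality \<open>1 + B + v \<le> (1 + B) * (1 + v)\<close> separates a
    constant from the moment of \<open>\<mu>\<close>.\<close>
  also have "\<dots> \<le> 2 / \<eta> * ((1 + b / (1 - a)) * (1 + (\<integral>z. V z \<partial>\<mu>))) * r ^ n"
  proof (intro mult_right_mono mult_left_mono)
    have "0 \<le> (\<integral>z. V z \<partial>\<mu>)" by (rule Bochner_Integration.integral_nonneg) simp
    then have "0 \<le> b / (1 - a) * (\<integral>z. V z \<partial>\<mu>)" using b' by (rule mult_nonneg_nonneg[rotated])
    then show "1 + b / (1 - a) + (\<integral>z. V z \<partial>\<mu>) \<le> (1 + b / (1 - a)) * (1 + (\<integral>z. V z \<partial>\<mu>))"
      unfolding distrib_left distrib_right by linarith
  qed (use \<eta> r in auto)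
  finally show "\<bar>(\<integral>z. f z \<partial>(Pmap ^^ n) \<mu>) - (\<integral>z. f z \<partial>\<mu>0)\<bar>
      \<le> r ^ n * (2 / \<eta> * (1 + b / (1 - a))) * (1 + (\<integral>z. dist (fst z) xs \<partial>\<mu>))"
    by (simp only: V_def mult_ac)
qed

end

section \<open>Strong law under decay of covariances\<close>

text \<open>With \<open>m\<close> the integer root of \<open>n\<close>, at most \<open>2 * m\<close>
  terms lie between \<open>m^2\<close> and \<open>n\<close>, each of size at most \<open>B\<close>;
  divided by \<open>n \<ge> m^2\<close> they contribute at most \<open>2 * B / m\<close>.\<close>

lemma average_tendsto_0_of_squares:
  fixes x :: "nat \<Rightarrow> real"
  assumes B: "\<And>k. \<bar>x k\<bar> \<le> B"
    and sq: "(\<lambda>m. (\<Sum>k<m\<^sup>2. x k) / (real m)\<^sup>2) \<longlonglongrightarrow> 0"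
  shows "(\<lambda>n. (\<Sum>k<n. x k) / real n) \<longlonglongrightarrow> 0"
proof -
  define m where "m n = nat \<lfloor>sqrt (real n)\<rfloor>" for n
  have B0: "0 \<le> B" using B[of 0] by linarith
  have m_lim: "filterlim m at_top sequentially"
    unfolding filterlim_at_top
  proof
    fix c :: nat
    show "\<forall>\<^sub>F n in sequentially. c \<le> m n"
      unfolding eventually_sequentially
    proof (intro exI allI impI)
      fix n assume "c\<^sup>2 \<le> n"
      then have "real c \<le> sqrt (real n)"
        by (metis of_nat_le_iff of_nat_power real_le_rsqrt)
      then show "c \<le> m n" unfolding m_def by (simp add: le_nat_floor)
    qed
  qed
  have bound: "\<bar>(\<Sum>k<n. x k) / real n\<bar> \<le> \<bar>(\<Sum>k<(m n)\<^sup>2. x k) / (real (m n))\<^sup>2\<bar> + 2 * B / real (m n)"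
    if n: "n \<ge> 1" for n
  proof -
    have s1: "1 \<le> sqrt (real n)" using n by simp
    have mle: "real (m n) \<le> sqrt (real n)" and mgt: "sqrt (real n) < real (m n) + 1"
      using s1 unfolding m_def by linarith+
    have m1: "m n \<ge> 1" using s1 unfolding m_def by linarith
    have sq_le: "(real (m n))\<^sup>2 \<le> real n"
      using power_mono[OF mle, of 2] by simp
    have lt: "real n < (real (m n) + 1)\<^sup>2"
      using power_strict_mono[OF mgt, of 2] by simp
    have le_nat: "(m n)\<^sup>2 \<le> n" using sq_le by (metis of_nat_le_iff of_nat_power)
    have "(\<Sum>k<n. x k) = (\<Sum>k<(m n)\<^sup>2. x k) + (\<Sum>k\<in>{(m n)\<^sup>2..<n}. x k)"
      using le_nat by (metis atLeast0LessThan sum.atLeastLessThan_concat zero_le)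
    moreover have "\<bar>\<Sum>k\<in>{(m n)\<^sup>2..<n}. x k\<bar> \<le> (\<Sum>k\<in>{(m n)\<^sup>2..<n}. B)"
      using B by (intro order_trans[OF sum_abs] sum_mono)
    moreover have "(\<Sum>k\<in>{(m n)\<^sup>2..<n}. B) = (real n - (real (m n))\<^sup>2) * B"
      using le_nat by (simp add: of_nat_diff)
    moreover have "(real n - (real (m n))\<^sup>2) * B \<le> (2 * real (m n)) * B"
    proof (rule mult_right_mono[OF _ B0])
      have "n < (m n + 1)\<^sup>2" using lt by (metis of_nat_1 of_nat_add of_nat_less_iff of_nat_power)
      then have "n \<le> (m n)\<^sup>2 + 2 * m n" by (simp add: power2_eq_square)
      then have "real n \<le> real ((m n)\<^sup>2 + 2 * m n)" by (simp only: of_nat_le_iff)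
      then show "real n - (real (m n))\<^sup>2 \<le> 2 * real (m n)" by simp
    qed
    ultimately have "\<bar>\<Sum>k<n. x k\<bar> \<le> \<bar>\<Sum>k<(m n)\<^sup>2. x k\<bar> + 2 * real (m n) * B" by linarith
    then have "\<bar>\<Sum>k<n. x k\<bar> / real n \<le> (\<bar>\<Sum>k<(m n)\<^sup>2. x k\<bar> + 2 * real (m n) * B) / real n"
      by (intro divide_right_mono) auto
    also have "\<dots> \<le> (\<bar>\<Sum>k<(m n)\<^sup>2. x k\<bar> + 2 * real (m n) * B) / (real (m n))\<^sup>2"
      using sq_le m1 B0 n by (intro divide_left_mono) auto
    also have "\<dots> = \<bar>\<Sum>k<(m n)\<^sup>2. x k\<bar> / (real (m n))\<^sup>2 + 2 * B / real (m n)"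
      using m1 by (simp add: field_simps power2_eq_square)
    finally show ?thesis by (simp add: abs_divide)
  qed
  have l1: "(\<lambda>n. \<bar>(\<Sum>k<(m n)\<^sup>2. x k) / (real (m n))\<^sup>2\<bar>) \<longlonglongrightarrow> 0"
    using filterlim_compose[OF tendsto_rabs_zero[OF sq] m_lim] .
  have l2: "(\<lambda>n. 2 * B / real (m n)) \<longlonglongrightarrow> 0"
    using filterlim_compose[OF lim_const_over_n[of "2 * B"] m_lim] .
  show ?thesis
  proof (rule Lim_null_comparison)
    show "\<forall>\<^sub>F n in sequentially. norm ((\<Sum>k<n. x k) / real n)
        \<le> \<bar>(\<Sum>k<(m n)\<^sup>2. x k) / (real (m n))\<^sup>2\<bar> + 2 * B / real (m n)"
      unfolding eventually_sequentially real_norm_def using bound by blast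
    show "(\<lambda>n. \<bar>(\<Sum>k<(m n)\<^sup>2. x k) / (real (m n))\<^sup>2\<bar> + 2 * B / real (m n)) \<longlonglongrightarrow> 0"
      using tendsto_add[OF l1 l2] by simp
  qed
qed

text \<open>The exponent is the distance of \<open>k\<close> and \<open>l\<close>, written by cases
  because natural subtraction truncates. Each side of \<open>k\<close> contributes a geometric
  series.\<close>

lemma sum_geometric_dist_le:
  fixes r :: real
  assumes r: "0 < r" "r < 1"
  shows "(\<Sum>l<n. r ^ (if k \<le> l then l - k else k - l)) \<le> 2 / (1 - r)"
proof -
  have geo: "(\<Sum>i<m. r ^ i) \<le> 1 / (1 - r)" for m
    using sum_le_suminf[of "\<lambda>i. r ^ i" "{..<m}"] r by (simp add: suminf_geometric summable_geometric)
  have "(\<Sum>l<n. r ^ (if k \<le> l then l - k else k - l))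
      \<le> (\<Sum>l\<in>{k..<k + n}. r ^ (l - k)) + (\<Sum>l\<in>{..<k}. r ^ (k - l))"
  proof -
    have "(\<Sum>l<n. r ^ (if k \<le> l then l - k else k - l))
        \<le> (\<Sum>l\<in>{k..<k + n} \<union> {..<k}. r ^ (if k \<le> l then l - k else k - l))"
      using r by (intro sum_mono2) auto
    also have "\<dots> = (\<Sum>l\<in>{k..<k + n}. r ^ (if k \<le> l then l - k else k - l))
        + (\<Sum>l\<in>{..<k}. r ^ (if k \<le> l then l - k else k - l))"
      by (rule sum.union_disjoint) auto
    also have "\<dots> = (\<Sum>l\<in>{k..<k + n}. r ^ (l - k)) + (\<Sum>l\<in>{..<k}. r ^ (k - l))"
      by (intro arg_cong2[where f="(+)"] sum.cong) auto
    finally show ?thesis .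
  qed
  also have "(\<Sum>l\<in>{k..<k + n}. r ^ (l - k)) = (\<Sum>i<n. r ^ i)"
    by (rule sum.reindex_bij_witness[of _ "\<lambda>i. i + k" "\<lambda>l. l - k"]) auto
  \<comment> \<open>These exponents run from 1 to \<open>k\<close>; lowering each by one only
    enlarges the terms and gives a geometric sum starting at exponent 0.\<close>
  also have "(\<Sum>l\<in>{..<k}. r ^ (k - l)) \<le> (\<Sum>l\<in>{..<k}. r ^ (k - 1 - l))"
    using r by (intro sum_mono power_decreasing) auto
  also have "(\<Sum>l\<in>{..<k}. r ^ (k - 1 - l)) = (\<Sum>i<k. r ^ i)"
    by (rule sum.reindex_bij_witness[of _ "\<lambda>i. k - 1 - i" "\<lambda>l. k - 1 - l"]) auto
  finally show ?thesis using geo[of n] geo[of k] by simp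
qed

text \<open>The second moment of the sum of \<open>n\<close> terms is of order \<open>n\<close>, so
  the squared averages at times \<open>m^2\<close> have means of order \<open>1 / m^2\<close> and
  are summable almost surely. Boundedness fills the gaps between squares.\<close>

lemma (in prob_space) strong_law_of_covariance_decay:
  fixes X :: "nat \<Rightarrow> 'a \<Rightarrow> real"
  assumes X[measurable]: "\<And>n. X n \<in> borel_measurable M"
    and B: "\<And>n \<omega>. \<omega> \<in> space M \<Longrightarrow> \<bar>X n \<omega>\<bar> \<le> B"
    and r: "0 < r" "r < 1" and D: "0 \<le> D"
    and cov: "\<And>k l. k \<le> l \<Longrightarrow> \<bar>\<integral>\<omega>. X k \<omega> * X l \<omega> \<partial>M\<bar> \<le> D * r ^ (l - k)"
  shows "AE \<omega> in M. (\<lambda>n. (\<Sum>k<n. X k \<omega>) / real n) \<longlonglongrightarrow> 0"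
proof -
  have B0: "0 \<le> B" using B not_empty by fastforce
  have XX: "integrable M (\<lambda>\<omega>. X k \<omega> * X l \<omega>)" for k l
  proof (rule abs_integral_le(1)[of _ "B * B"])
    show "\<bar>X k \<omega> * X l \<omega>\<bar> \<le> B * B" if "\<omega> \<in> space M" for \<omega>
      unfolding abs_mult using B[OF that] B0 by (intro mult_mono) auto
  qed simp
  have sq_eq: "(\<Sum>k<n. X k \<omega>)\<^sup>2 = (\<Sum>k<n. \<Sum>l<n. X k \<omega> * X l \<omega>)" for n \<omega>
    by (simp add: power2_eq_square sum_product)
  have i: "integrable M (\<lambda>\<omega>. (\<Sum>k<n. X k \<omega>)\<^sup>2)" for n
    unfolding sq_eq using XX by (intro Bochner_Integration.integrable_sum) auto
  have var: "(\<integral>\<omega>. (\<Sum>k<n. X k \<omega>)\<^sup>2 \<partial>M) \<le> real n * (2 * D / (1 - r))" for n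
  proof -
    have "(\<integral>\<omega>. (\<Sum>k<n. X k \<omega>)\<^sup>2 \<partial>M) = (\<Sum>k<n. \<Sum>l<n. \<integral>\<omega>. X k \<omega> * X l \<omega> \<partial>M)"
      unfolding sq_eq using XX by (subst Bochner_Integration.integral_sum) (auto intro!: sum.cong)
    also have "\<dots> \<le> (\<Sum>k<n. \<Sum>l<n. D * r ^ (if k \<le> l then l - k else k - l))"
    proof (intro sum_mono)
      fix k l
      show "(\<integral>\<omega>. X k \<omega> * X l \<omega> \<partial>M) \<le> D * r ^ (if k \<le> l then l - k else k - l)"
        using cov[of k l] cov[of l k] by (cases "k \<le> l") (auto simp: mult.commute)
    qed
    also have "\<dots> \<le> (\<Sum>k<n. D * (2 / (1 - r)))"
      unfolding sum_distrib_left[symmetric]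
      using D r by (intro sum_mono mult_left_mono sum_geometric_dist_le)
    finally show ?thesis by (simp add: mult_ac)
  qed
  \<comment> \<open>Shifted to \<open>Suc m\<close>, which keeps the denominator positive;
    \<open>LIMSEQ_imp_Suc\<close> undoes the shift.\<close>
  define Y where "Y m \<omega> = ((\<Sum>k<(Suc m)\<^sup>2. X k \<omega>) / (real (Suc m))\<^sup>2)\<^sup>2" for m \<omega>
  have "AE \<omega> in M. summable (\<lambda>m. Y m \<omega>)"
  proof (rule AE_summable_of_nn_integral)
    fix m
    show "Y m \<in> borel_measurable M" unfolding Y_def by measurable
    have "(\<integral>\<^sup>+\<omega>. ennreal (Y m \<omega>) \<partial>M) = ennreal (\<integral>\<omega>. Y m \<omega> \<partial>M)"
      unfolding Y_def power_divide using i[of "(Suc m)\<^sup>2"] by (intro nn_integral_eq_integral) auto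
    also have "(\<integral>\<omega>. Y m \<omega> \<partial>M) = (\<integral>\<omega>. (\<Sum>k<(Suc m)\<^sup>2. X k \<omega>)\<^sup>2 \<partial>M) / ((real (Suc m))\<^sup>2)\<^sup>2"
      unfolding Y_def power_divide by simp
    also have "\<dots> \<le> real ((Suc m)\<^sup>2) * (2 * D / (1 - r)) / ((real (Suc m))\<^sup>2)\<^sup>2"
      by (intro divide_right_mono var) simp
    also have "\<dots> = 2 * D / (1 - r) * (1 / (real (Suc m))\<^sup>2)"
      unfolding of_nat_power by (simp add: power2_eq_square del: of_nat_Suc)
    finally show "(\<integral>\<^sup>+\<omega>. ennreal (Y m \<omega>) \<partial>M) \<le> ennreal (2 * D / (1 - r) * (1 / (real (Suc m))\<^sup>2))"
      by (simp add: ennreal_leI)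
    show "0 \<le> 2 * D / (1 - r) * (1 / (real (Suc m))\<^sup>2)" using D r by simp
  next
    have "summable (\<lambda>m. 1 / (real m)\<^sup>2)"
      using inverse_power_summable[of 2, where ?'a=real] by (simp add: divide_inverse)
    then show "summable (\<lambda>m. 2 * D / (1 - r) * (1 / (real (Suc m))\<^sup>2))"
      by (intro summable_mult) (subst summable_Suc_iff)
  qed (simp add: Y_def)
  then show ?thesis using AE_space
  proof eventually_elim
    case (elim \<omega>)
    from summable_LIMSEQ_zero[OF elim(1)] have "(\<lambda>m. sqrt (Y m \<omega>)) \<longlonglongrightarrow> sqrt 0" by (rule tendsto_real_sqrt)
    then have "(\<lambda>m. \<bar>(\<Sum>k<(Suc m)\<^sup>2. X k \<omega>) / (real (Suc m))\<^sup>2\<bar>) \<longlonglongrightarrow> 0"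
      by (simp add: Y_def del: of_nat_Suc)
    then have "(\<lambda>m. (\<Sum>k<(Suc m)\<^sup>2. X k \<omega>) / (real (Suc m))\<^sup>2) \<longlonglongrightarrow> 0"
      by (rule tendsto_rabs_zero_cancel)
    then have "(\<lambda>m. (\<Sum>k<m\<^sup>2. X k \<omega>) / (real m)\<^sup>2) \<longlonglongrightarrow> 0"
      by (rule LIMSEQ_imp_Suc)
    then show ?case by (rule average_tendsto_0_of_squares[rotated]) (use B elim(2) in auto)
  qed
qed

section \<open>The path law of the chain\<close>

text \<open>The kernel is prescribed only at histories whose last entry is an admissible state,
  since \<open>P_op\<close> of a point mass is identified with a law of the random map only
  there.\<close>

locale contractive_chain = contractive_maps Om N F xs ct r a b \<eta>
  for Om :: "'w measure" and N and F :: "'y::polish_space \<times> nat \<Rightarrow> 'w \<Rightarrow> 'y \<times> nat" and xs ct r a b \<eta> +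
  fixes P :: "nat \<Rightarrow> (nat \<Rightarrow> 'y \<times> nat) \<Rightarrow> ('y \<times> nat) measure" and z0 :: "'y \<times> nat"
  assumes z0: "z0 \<in> state_set N"
    and P_0: "\<And>\<omega>. P 0 \<omega> = return (state_space N) z0"
    and P_Suc: "\<And>m \<omega>. \<omega> m \<in> state_set N \<Longrightarrow> P (Suc m) \<omega> = distr Om (state_space N) (F (\<omega> m))"
begin

lemma prefix_in_state_set: "\<omega> \<in> space (PiM {0..<Suc m} (\<lambda>_. state_space N)) \<Longrightarrow> \<omega> m \<in> state_set N"
  by (simp add: space_PiM PiE_iff del: mem_state_set)

lemma Ionescu_Tulcea_chain: "Ionescu_Tulcea P (\<lambda>_. state_space N)"
proof (rule Ionescu_Tulcea.intro)
  fix i :: nat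
  show "P i \<in> PiM {0..<i} (\<lambda>_. state_space N) \<rightarrow>\<^sub>M subprob_algebra (state_space N)"
  proof (cases i)
    case 0
    have "return (state_space N) z0 \<in> space (subprob_algebra (state_space N))"
      using z0 by (intro measurable_space[OF return_measurable]) simp
    then show ?thesis unfolding 0 P_0[abs_def] by (rule measurable_const)
  next
    case (Suc m)
    have "(\<lambda>\<omega>. distr Om (state_space N) (F (\<omega> m))) \<in> PiM {0..<Suc m} (\<lambda>_. state_space N) \<rightarrow>\<^sub>M subprob_algebra (state_space N)"
    proof (rule measurable_distr2)
      show "case_prod (\<lambda>\<omega>. F (\<omega> m)) \<in> PiM {0..<Suc m} (\<lambda>_. state_space N) \<Otimes>\<^sub>M Om \<rightarrow>\<^sub>M state_space N"
        unfolding case_prod_beta' by measurable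
      show "(\<lambda>_. Om) \<in> PiM {0..<Suc m} (\<lambda>_. state_space N) \<rightarrow>\<^sub>M subprob_algebra Om"
        by (rule measurable_const) (auto simp: space_subprob_algebra prob_space_imp_subprob_space prob_space_axioms)
    qed
    then show ?thesis
      unfolding Suc by (rule measurable_cong[THEN iffD1, rotated]) (simp add: P_Suc[OF prefix_in_state_set])
  qed
next
  fix i and \<omega> :: "nat \<Rightarrow> 'y \<times> nat" assume \<omega>: "\<omega> \<in> space (PiM {0..<i} (\<lambda>_. state_space N))"
  show "prob_space (P i \<omega>)"
  proof (cases i)
    case 0
    then show ?thesis using z0 by (auto simp: P_0 intro!: prob_space_return simp del: mem_state_set)
  next
    case (Suc m)
    have "\<omega> m \<in> state_set N" using \<omega> unfolding Suc by (rule prefix_in_state_set)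
    then show ?thesis unfolding Suc by (subst P_Suc) (auto intro!: prob_space_distr)
  qed
qed

section \<open>Path measure and its finite-dimensional marginals\<close>

sublocale IT: Ionescu_Tulcea P "\<lambda>_. state_space N"
  by (rule Ionescu_Tulcea_chain)

abbreviation law :: "(nat \<Rightarrow> 'y \<times> nat) measure" where "law \<equiv> IT.PF.lim"

lemma sets_law [measurable_cong]: "sets law = sets (PiM UNIV (\<lambda>_. state_space N))"
  by (rule IT.PF.sets_lim)

lemma measurable_coord [measurable]: "(\<lambda>\<omega>. \<omega> n) \<in> law \<rightarrow>\<^sub>M state_space N"
  by measurable

lemma coord_in_state_set: "\<omega> \<in> space law \<Longrightarrow> \<omega> n \<in> state_set N"
  using measurable_space[OF measurable_coord] by simp

lemma measurable_restrict_law [measurable]: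
  "(\<lambda>\<omega>. restrict \<omega> {0..<m}) \<in> law \<rightarrow>\<^sub>M PiM {0..<m} (\<lambda>_. state_space N)"
  by (rule measurable_restrict) measurable

text \<open>The total mass is visible on the marginal over the empty set of coordinates, which is a
  probability measure by construction.\<close>

lemma prob_space_law: "prob_space law"
proof (rule prob_space_distrD)
  show "(\<lambda>\<omega>. restrict \<omega> {}) \<in> law \<rightarrow>\<^sub>M PiM {} (\<lambda>_. state_space N)" by (rule measurable_restrict) simp
  show "prob_space (distr law (PiM {} (\<lambda>_. state_space N)) (\<lambda>\<omega>. restrict \<omega> {}))"
    by (subst IT.distr_lim) (auto intro!: IT.PF.prob_space_P)
qed

sublocale law: prob_space law by (rule prob_space_law)

text \<open>The marginal on a prefix is the \<open>m\<close>-fold composition of kernels from the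
  empty history; \<open>\<lambda>_. undefined\<close> is the only point of the product over no
  coordinates.\<close>

lemma CI_prefix: "IT.CI {0..<m} = IT.C 0 m (\<lambda>_. undefined)"
proof -
  have u: "IT.up_to {0..<m} = m"
    unfolding IT.up_to_def by (rule Least_equality) (auto simp: not_less_eq_eq[symmetric] dest: spec[of _ "m - 1"])
  have sp: "(\<lambda>_. undefined) \<in> space (PiM {0..<0::nat} (\<lambda>_. state_space N))" by (simp add: space_PiM)
  have "IT.CI {0..<m} = distr (IT.C 0 m (\<lambda>_. undefined)) (PiM {0..<m} (\<lambda>_. state_space N)) (\<lambda>f. restrict f {0..<m})"
    unfolding IT.CI_def u ..
  also have "\<dots> = distr (IT.C 0 m (\<lambda>_. undefined)) (PiM {0..<m} (\<lambda>_. state_space N)) (\<lambda>f. f)"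
    using IT.space_C[OF sp, of m] by (intro distr_cong) (auto simp: space_PiM extensional_restrict PiE_def)
  also have "\<dots> = IT.C 0 m (\<lambda>_. undefined)"
    using IT.sets_C[OF sp, of m] by (intro distr_id2) simp
  finally show ?thesis .
qed

lemma nn_integral_prefix:
  assumes [measurable]: "H \<in> borel_measurable (PiM {0..<m} (\<lambda>_. state_space N))"
  shows "(\<integral>\<^sup>+\<omega>. H (restrict \<omega> {0..<m}) \<partial>law) = (\<integral>\<^sup>+x. H x \<partial>IT.C 0 m (\<lambda>_. undefined))"
proof -
  have "(\<integral>\<^sup>+x. H x \<partial>IT.C 0 m (\<lambda>_. undefined))
      = (\<integral>\<^sup>+x. H x \<partial>distr law (PiM {0..<m} (\<lambda>_. state_space N)) (\<lambda>\<omega>. restrict \<omega> {0..<m}))"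
    by (subst IT.distr_lim) (auto simp: CI_prefix)
  also have "\<dots> = (\<integral>\<^sup>+\<omega>. H (restrict \<omega> {0..<m}) \<partial>law)"
    by (rule nn_integral_distr) measurable
  finally show ?thesis ..
qed

text \<open>\<open>P m\<close> is the conditional law of coordinate \<open>m\<close> given the
  earlier ones; for \<open>m = 0\<close> the history is empty and \<open>P 0\<close> is the initial
  law.\<close>

lemma nn_integral_prefix_Suc:
  assumes H[measurable]: "H \<in> borel_measurable (PiM {0..<Suc m} (\<lambda>_. state_space N))"
  shows "(\<integral>\<^sup>+\<omega>. H (restrict \<omega> {0..<Suc m}) \<partial>law)
    = (\<integral>\<^sup>+\<omega>. \<integral>\<^sup>+y. H ((restrict \<omega> {0..<m})(m := y)) \<partial>P m (restrict \<omega> {0..<m}) \<partial>law)"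
proof -
  have sp: "(\<lambda>_. undefined) \<in> space (PiM {0..<0::nat} (\<lambda>_. state_space N))" by (simp add: space_PiM)
  have upd: "(\<lambda>(x, y). x(m := y)) \<in> PiM {0..<m} (\<lambda>_. state_space N) \<Otimes>\<^sub>M state_space N \<rightarrow>\<^sub>M PiM {0..<Suc m} (\<lambda>_. state_space N)"
    unfolding case_prod_beta' by (rule measurable_fun_upd[where J="{0..<m}"]) auto
  have m: "(\<lambda>x. \<integral>\<^sup>+y. H (x(m := y)) \<partial>P m x) \<in> borel_measurable (PiM {0..<m} (\<lambda>_. state_space N))"
    using measurable_compose[OF upd H]
    by (intro nn_integral_measurable_subprob_algebra2[OF _ IT.P]) (simp add: case_prod_beta')
  have "(\<integral>\<^sup>+\<omega>. H (restrict \<omega> {0..<Suc m}) \<partial>law) = (\<integral>\<^sup>+x. H x \<partial>IT.C 0 (Suc m) (\<lambda>_. undefined))"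
    by (rule nn_integral_prefix[OF H])
  also have "\<dots> = (\<integral>\<^sup>+x. \<integral>\<^sup>+y. H y \<partial>IT.eP m x \<partial>IT.C 0 m (\<lambda>_. undefined))"
    unfolding IT.C.simps add_0
    by (rule nn_integral_bind[OF H]) (use IT.measurable_eP[of m] in \<open>simp add: measurable_cong_sets[OF IT.sets_C[OF sp] refl]\<close>)
  also have "\<dots> = (\<integral>\<^sup>+x. \<integral>\<^sup>+y. H (x(m := y)) \<partial>P m x \<partial>IT.C 0 m (\<lambda>_. undefined))"
    by (intro nn_integral_cong IT.nn_integral_eP H) (simp add: IT.space_C[OF sp])
  also have "\<dots> = (\<integral>\<^sup>+\<omega>. \<integral>\<^sup>+y. H ((restrict \<omega> {0..<m})(m := y)) \<partial>P m (restrict \<omega> {0..<m}) \<partial>law)"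
    by (rule nn_integral_prefix[OF m, symmetric])
  finally show ?thesis .
qed

lemma nn_integral_coord_0:
  assumes [measurable]: "h \<in> borel_measurable (state_space N)"
  shows "(\<integral>\<^sup>+\<omega>. h (\<omega> 0) \<partial>law) = h z0"
proof -
  have "(\<integral>\<^sup>+\<omega>. h (\<omega> 0) \<partial>law) = (\<integral>\<^sup>+\<omega>. \<integral>\<^sup>+y. h y \<partial>return (state_space N) z0 \<partial>law)"
    using nn_integral_prefix_Suc[of "\<lambda>x. h (x 0)" 0] by (simp add: P_0)
  also have "\<dots> = h z0" using z0 law.emeasure_space_1 by (simp add: nn_integral_return)
  finally show ?thesis .
qed

lemma nn_integral_transition:
  assumes H[measurable]: "H \<in> borel_measurable (PiM {0..<Suc (Suc m)} (\<lambda>_. state_space N))"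
  shows "(\<integral>\<^sup>+\<omega>. H (restrict \<omega> {0..<Suc (Suc m)}) \<partial>law)
    = (\<integral>\<^sup>+\<omega>. \<integral>\<^sup>+w. H ((restrict \<omega> {0..<Suc m})(Suc m := F (\<omega> m) w)) \<partial>Om \<partial>law)"
  unfolding nn_integral_prefix_Suc[OF H]
proof (rule nn_integral_cong)
  fix \<omega> assume \<omega>: "\<omega> \<in> space law"
  let ?x = "restrict \<omega> {0..<Suc m}"
  have x: "?x \<in> space (PiM {0..<Suc m} (\<lambda>_. state_space N))"
    using measurable_space[OF measurable_restrict_law \<omega>] .
  have Hm: "(\<lambda>y. H (?x(Suc m := y))) \<in> borel_measurable (state_space N)"
    using measurable_fun_upd[of "{0..<Suc (Suc m)}" "{0..<Suc m}" "Suc m" "\<lambda>_. ?x" "state_space N" "\<lambda>_. state_space N" "\<lambda>y. y"] x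
    by (intro measurable_compose[OF _ H]) (auto simp: atLeast0_lessThan_Suc[of "Suc m"])
  have Fm: "F (\<omega> m) \<in> Om \<rightarrow>\<^sub>M state_space N"
    by (rule measurable_F1) (rule coord_in_state_set[OF \<omega>])
  have "P (Suc m) ?x = distr Om (state_space N) (F (\<omega> m))"
    using P_Suc[of ?x m] coord_in_state_set[OF \<omega>, of m] by simp
  then show "(\<integral>\<^sup>+y. H (?x(Suc m := y)) \<partial>P (Suc m) ?x) = (\<integral>\<^sup>+w. H (?x(Suc m := F (\<omega> m) w)) \<partial>Om)"
    by (simp only:) (rule nn_integral_distr[OF Fm], simp only: measurable_distr_eq1, rule Hm)
qed

text \<open>As an equality of measures, the transition formula also covers signed integrands, which
  the covariances require.\<close>

lemma distr_transition:
  "distr law (PiM {0..<Suc (Suc m)} (\<lambda>_. state_space N)) (\<lambda>\<omega>. restrict \<omega> {0..<Suc (Suc m)})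
   = distr (law \<Otimes>\<^sub>M Om) (PiM {0..<Suc (Suc m)} (\<lambda>_. state_space N))
       (\<lambda>(\<omega>, w). (restrict \<omega> {0..<Suc m})(Suc m := F (\<omega> m) w))"
  (is "?L = distr _ ?M ?g")
proof (rule measure_eqI)
  have g: "?g \<in> law \<Otimes>\<^sub>M Om \<rightarrow>\<^sub>M ?M"
    unfolding case_prod_beta'
  proof (rule measurable_fun_upd[where J="{0..<Suc m}"])
    show "(\<lambda>p. restrict (fst p) {0..<Suc m}) \<in> law \<Otimes>\<^sub>M Om \<rightarrow>\<^sub>M PiM {0..<Suc m} (\<lambda>_. state_space N)"
      by (rule measurable_compose[OF measurable_fst measurable_restrict_law])
    show "(\<lambda>p. F (fst p m) (snd p)) \<in> law \<Otimes>\<^sub>M Om \<rightarrow>\<^sub>M state_space N"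
      by (rule measurable_F'[OF measurable_compose[OF measurable_fst measurable_coord] measurable_snd])
  qed auto
  fix A assume "A \<in> sets ?L"
  then have [measurable]: "A \<in> sets ?M" by simp
  have "emeasure ?L A = (\<integral>\<^sup>+x. indicator A x \<partial>?L)" by simp
  also have "\<dots> = (\<integral>\<^sup>+\<omega>. indicator A (restrict \<omega> {0..<Suc (Suc m)}) \<partial>law)"
    by (rule nn_integral_distr) measurable
  also have "\<dots> = (\<integral>\<^sup>+\<omega>. \<integral>\<^sup>+w. indicator A (?g (\<omega>, w)) \<partial>Om \<partial>law)"
    by (subst nn_integral_transition) auto
  also have "\<dots> = (\<integral>\<^sup>+p. indicator A (?g p) \<partial>(law \<Otimes>\<^sub>M Om))"
    by (rule nn_integral_fst) (intro measurable_compose[OF g] borel_measurable_indicator, simp)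
  also have "\<dots> = emeasure (distr (law \<Otimes>\<^sub>M Om) ?M ?g) A"
    by (subst nn_integral_distr[OF g, symmetric]) auto
  finally show "emeasure ?L A = emeasure (distr (law \<Otimes>\<^sub>M Om) ?M ?g) A" .
qed simp

text \<open>The Markov property tested against one past coordinate: since \<open>j \<le> m\<close>,
  replacing coordinate \<open>Suc m\<close> by a fresh image of \<open>\<omega> m\<close> leaves
  coordinate \<open>j\<close> untouched.\<close>

lemma integral_transition:
  assumes f: "bdd_meas f" and g: "bdd_meas g" and "j \<le> m"
  shows "(\<integral>\<omega>. f (\<omega> j) * g (\<omega> (Suc m)) \<partial>law) = (\<integral>\<omega>. f (\<omega> j) * Ufun g (\<omega> m) \<partial>law)"
proof -
  interpret LP: pair_prob_space law Om ..
  have [measurable]: "f \<in> borel_measurable (state_space N)" "g \<in> borel_measurable (state_space N)"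
    using f g by auto
  let ?M = "PiM {0..<Suc (Suc m)} (\<lambda>_. state_space N)"
  have fst_m: "(\<lambda>p. fst p k) \<in> law \<Otimes>\<^sub>M Om \<rightarrow>\<^sub>M state_space N" for k
    by (rule measurable_compose[OF measurable_fst measurable_coord])
  have G: "(\<lambda>p. (restrict (fst p) {0..<Suc m})(Suc m := F (fst p m) (snd p))) \<in> law \<Otimes>\<^sub>M Om \<rightarrow>\<^sub>M ?M"
  proof (rule measurable_fun_upd[where J="{0..<Suc m}"])
    show "(\<lambda>p. restrict (fst p) {0..<Suc m}) \<in> law \<Otimes>\<^sub>M Om \<rightarrow>\<^sub>M PiM {0..<Suc m} (\<lambda>_. state_space N)"
      by (rule measurable_compose[OF measurable_fst measurable_restrict_law])
    show "(\<lambda>p. F (fst p m) (snd p)) \<in> law \<Otimes>\<^sub>M Om \<rightarrow>\<^sub>M state_space N"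
      by (rule measurable_F'[OF fst_m measurable_snd])
  qed auto
  have H: "(\<lambda>x. f (x j) * g (x (Suc m))) \<in> borel_measurable ?M"
  proof (rule borel_measurable_times)
    show "(\<lambda>x. f (x j)) \<in> borel_measurable ?M" "(\<lambda>x. g (x (Suc m))) \<in> borel_measurable ?M"
      using \<open>j \<le> m\<close> by (auto intro!: measurable_compose[OF measurable_component_singleton])
  qed
  obtain Bf where Bf: "\<And>z. z \<in> state_set N \<Longrightarrow> \<bar>f z\<bar> \<le> Bf" using f by (auto simp: bdd_meas_def simp del: mem_state_set)
  obtain Bg where Bg: "\<And>z. z \<in> state_set N \<Longrightarrow> \<bar>g z\<bar> \<le> Bg" using g by (auto simp: bdd_meas_def simp del: mem_state_set)
  have i: "integrable (law \<Otimes>\<^sub>M Om) (\<lambda>(\<omega>, w). f (\<omega> j) * g (F (\<omega> m) w))"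
  proof (rule LP.P.abs_integral_le(1)[of _ "Bf * Bg"])
    show "(\<lambda>(\<omega>, w). f (\<omega> j) * g (F (\<omega> m) w)) \<in> borel_measurable (law \<Otimes>\<^sub>M Om)"
      unfolding case_prod_beta'
      by (intro borel_measurable_times measurable_compose[OF fst_m, of f] measurable_compose[OF measurable_F'[OF fst_m measurable_snd], of g]) auto
    fix p assume "p \<in> space (law \<Otimes>\<^sub>M Om)"
    then have p: "fst p \<in> space law" "snd p \<in> space Om" by (auto simp: space_pair_measure)
    have st: "fst p j \<in> state_set N" "F (fst p m) (snd p) \<in> state_set N"
      using coord_in_state_set[OF p(1)] p(2) by (auto simp del: mem_state_set)
    show "\<bar>case p of (\<omega>, w) \<Rightarrow> f (\<omega> j) * g (F (\<omega> m) w)\<bar> \<le> Bf * Bg"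
      unfolding case_prod_beta abs_mult
      using Bf[OF st(1)] Bg[OF st(2)] by (intro mult_mono) auto
  qed
  have "(\<integral>\<omega>. f (\<omega> j) * g (\<omega> (Suc m)) \<partial>law)
      = (\<integral>x. f (x j) * g (x (Suc m)) \<partial>distr law ?M (\<lambda>\<omega>. restrict \<omega> {0..<Suc (Suc m)}))"
    using \<open>j \<le> m\<close> by (subst integral_distr[OF measurable_restrict_law H]) simp
  also have "\<dots> = (\<integral>p. f (fst p j) * g (F (fst p m) (snd p)) \<partial>(law \<Otimes>\<^sub>M Om))"
    unfolding distr_transition case_prod_beta' using \<open>j \<le> m\<close>
    by (subst integral_distr[OF G H]) simp
  also have "\<dots> = (\<integral>\<omega>. \<integral>w. f (\<omega> j) * g (F (\<omega> m) w) \<partial>Om \<partial>law)"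
    using LP.integral_fst[OF i] by (simp add: case_prod_beta')
  finally show ?thesis by (simp add: Ufun_def)
qed

section \<open>Covariances and moments along a path\<close>

lemma integral_transition_pow:
  assumes f: "bdd_meas f" and g: "bdd_meas g"
  shows "(\<integral>\<omega>. f (\<omega> k) * g (\<omega> (k + n)) \<partial>law) = (\<integral>\<omega>. f (\<omega> k) * (Ufun ^^ n) g (\<omega> k) \<partial>law)"
  using g
proof (induction n arbitrary: g)
  case (Suc n)
  have "(\<integral>\<omega>. f (\<omega> k) * g (\<omega> (k + Suc n)) \<partial>law) = (\<integral>\<omega>. f (\<omega> k) * Ufun g (\<omega> (k + n)) \<partial>law)"
    using integral_transition[OF f Suc.prems, of k "k + n"] by simp
  then show ?case using Suc.IH[OF bdd_meas_Ufun[OF Suc.prems]] by (simp add: funpow_swap1)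
qed simp

lemma nn_integral_V_coord: "(\<integral>\<^sup>+\<omega>. ennreal (V (\<omega> n)) \<partial>law) \<le> ennreal (V z0 + b / (1 - a))"
proof (induction n)
  case 0
  have "(\<integral>\<^sup>+\<omega>. ennreal (V (\<omega> 0)) \<partial>law) = ennreal (V z0)" by (rule nn_integral_coord_0) measurable
  then show ?case using a b by (simp add: ennreal_leI)
next
  case (Suc n)
  have "(\<integral>\<^sup>+\<omega>. ennreal (V (\<omega> (Suc n))) \<partial>law) = (\<integral>\<^sup>+\<omega>. \<integral>\<^sup>+w. ennreal (V (F (\<omega> n) w)) \<partial>Om \<partial>law)"
    using nn_integral_transition[of "\<lambda>x. ennreal (V (x (Suc n)))" n] by simp
  also have "\<dots> \<le> (\<integral>\<^sup>+\<omega>. ennreal a * ennreal (V (\<omega> n)) + ennreal b \<partial>law)"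
    using drift[OF coord_in_state_set] a b
    by (intro nn_integral_mono) (simp add: V_def ennreal_mult[symmetric] ennreal_plus[symmetric] del: ennreal_plus)
  also have "\<dots> = ennreal a * (\<integral>\<^sup>+\<omega>. ennreal (V (\<omega> n)) \<partial>law) + ennreal b"
    using law.emeasure_space_1 by (subst nn_integral_add) (auto simp: nn_integral_cmult)
  also have "\<dots> \<le> ennreal (V z0 + b / (1 - a))" by (rule drift_step[OF Suc.IH]) simp
  finally show ?case .
qed

lemma V_coord: "integrable law (\<lambda>\<omega>. V (\<omega> n))" "(\<integral>\<omega>. V (\<omega> n) \<partial>law) \<le> V z0 + b / (1 - a)"
proof -
  show i: "integrable law (\<lambda>\<omega>. V (\<omega> n))"
  proof (rule integrableI_bounded)
    show "(\<integral>\<^sup>+\<omega>. ennreal (norm (V (\<omega> n))) \<partial>law) < \<infinity>"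
      using le_less_trans[OF nn_integral_V_coord[of n]] by simp
  qed measurable
  show "(\<integral>\<omega>. V (\<omega> n) \<partial>law) \<le> V z0 + b / (1 - a)"
    using nn_integral_V_coord[of n] a b
    by (subst (asm) nn_integral_eq_integral[OF i]) (auto simp del: ennreal_plus)
qed

theorem strong_law:
  assumes bdd: "bounded (f ` state_set N)"
    and lip: "\<And>z w. z \<in> state_set N \<Longrightarrow> w \<in> state_set N \<Longrightarrow> \<bar>f z - f w\<bar> \<le> c * state_dist z w"
  shows "AE \<omega> in law. (\<lambda>n. 1 / real n * (\<Sum>k<n. f (\<omega> k))) \<longlonglongrightarrow> (\<integral>z. f z \<partial>\<mu>0)"
proof -
  interpret \<mu>0: prob_space \<mu>0 using mu0_in by (rule prob_measuresD)
  obtain B where B: "B > 0" "\<And>z. z \<in> state_set N \<Longrightarrow> \<bar>f z\<bar> \<le> B"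
    using bdd unfolding bounded_pos by (auto simp del: mem_state_set)
  \<comment> \<open>Dividing by a common bound for size and slope places \<open>f\<close> in the
    Fortet-Mourier class.\<close>
  define D where "D = max B \<bar>c\<bar>"
  have D: "D > 0" "B \<le> D" "c \<le> D" using B(1) by (auto simp: D_def)
  have "(\<lambda>z. f z / D) \<in> FM_class N"
  proof (rule FM_class_I)
    fix z w :: "'y \<times> nat" assume zw: "z \<in> state_set N" "w \<in> state_set N"
    have "\<bar>f z - f w\<bar> \<le> D * state_dist z w"
      using lip[OF zw] mult_right_mono[OF D(3) state_dist_nonneg[of z w]] by linarith
    then show "\<bar>f z / D - f w / D\<bar> \<le> state_dist z w"
      using D(1) by (simp add: diff_divide_distrib[symmetric] field_simps)
  next
    fix z :: "'y \<times> nat" assume z: "z \<in> state_set N"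
    show "\<bar>f z / D\<bar> \<le> 1" using B(2)[OF z] D by (simp add: field_simps)
  qed
  note FM = this
  have f_eq: "f = (\<lambda>z. D * (f z / D))" using D(1) by auto
  have "continuous_on (state_set N) f"
    by (subst f_eq) (intro continuous_on_mult_left FM_classD(1)[OF FM])
  then have bmf: "bdd_meas f" using bdd by (rule bdd_meas_continuous)
  define m where "m = (\<integral>z. f z \<partial>\<mu>0)"
  \<comment> \<open>Centring at the stationary mean makes the iterates of \<open>Ufun\<close> at
    \<open>g\<close> decay to 0, so the product moments of \<open>g\<close> decay although the chain
    does not start in equilibrium.\<close>
  define g where "g z = f z - m" for z
  have if0: "integrable \<mu>0 f"
    using integrable_bdd_meas[OF bmf, of "\<lambda>z. z" \<mu>0] \<mu>0.prob_space_axioms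
    by (simp add: \<mu>0_def measurable_ident_sets)
  have g0: "(\<integral>z. g z \<partial>\<mu>0) = 0" using if0 by (simp add: g_def m_def \<mu>0.prob_space)
  have m_le: "\<bar>m\<bar> \<le> B"
    unfolding m_def using B(2) if0
    by (intro \<mu>0.abs_integral_le(2)) (auto simp: prob_measuresD[OF mu0_in] simp del: mem_state_set)
  have gB: "\<bar>g z\<bar> \<le> 2 * B" if "z \<in> state_set N" for z
    using B(2)[OF that] m_le unfolding g_def by linarith
  have bmg: "bdd_meas g"
  proof -
    have "g \<in> borel_measurable (state_space N)"
      unfolding g_def[abs_def] using bmf by (intro borel_measurable_diff) auto
    with gB show ?thesis unfolding bdd_meas_def by blast
  qed
  have [measurable]: "g \<in> borel_measurable (state_space N)" using bmg ..
  define Lg where "Lg = D * (2 / \<eta>)"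
  have Lg: "0 \<le> Lg" using D(1) \<eta> by (simp add: Lg_def)
  have lip_g: "\<bar>g z - g w\<bar> \<le> Lg * ct z w" if "z \<in> state_set N" "w \<in> state_set N" for z w
  proof -
    have "\<bar>g z - g w\<bar> = D * \<bar>f z / D - f w / D\<bar>"
      using D(1) by (simp add: g_def diff_divide_distrib[symmetric])
    also have "\<dots> \<le> D * (2 / \<eta> * ct z w)"
      using FM_class_lip_ct[OF FM that] D(1) by (intro mult_left_mono) auto
    finally show ?thesis by (simp add: Lg_def)
  qed
  \<comment> \<open>The factor \<open>2 * B\<close> bounds \<open>g\<close> at the earlier time; the
    rest is the constant of \<open>Ufun_pow_rate\<close> with the mean of \<open>V\<close> bounded
    uniformly in time.\<close>
  define E where "E = 2 * B * (Lg * (1 + b / (1 - a) + (V z0 + b / (1 - a))))"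
  have "AE \<omega> in law. (\<lambda>n. (\<Sum>k<n. g (\<omega> k)) / real n) \<longlonglongrightarrow> 0"
  proof (rule law.strong_law_of_covariance_decay[where B="2 * B" and D=E and r=r])
    show "(\<lambda>\<omega>. g (\<omega> n)) \<in> borel_measurable law" for n by measurable
    show "\<bar>g (\<omega> n)\<bar> \<le> 2 * B" if "\<omega> \<in> space law" for n \<omega>
      by (rule gB) (rule coord_in_state_set[OF that])
    show "0 < r" "r < 1" by (rule r)+
    show "0 \<le> E" unfolding E_def using B(1) Lg a b by (intro mult_nonneg_nonneg add_nonneg_nonneg) auto
    fix k l :: nat assume "k \<le> l"
    define n where "n = l - k"
    have l: "l = k + n" using \<open>k \<le> l\<close> by (simp add: n_def)
    have U_meas[measurable]: "(Ufun ^^ n) g \<in> borel_measurable (state_space N)"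
      using bdd_meas_Ufun_pow[OF bmg] by auto
    have bound: "\<bar>g z * (Ufun ^^ n) g z\<bar> \<le> 2 * B * (Lg * (1 + b / (1 - a) + V z) * r ^ n)"
      if z: "z \<in> state_set N" for z
      unfolding abs_mult
      using gB[OF z] Ufun_pow_rate[OF bmg Lg lip_g z, of n] B(1) by (intro mult_mono) (auto simp: g0)
    have iV: "integrable law (\<lambda>\<omega>. 2 * B * (Lg * (1 + b / (1 - a) + V (\<omega> k)) * r ^ n))"
      using V_coord(1) by simp
    have ig: "integrable law (\<lambda>\<omega>. g (\<omega> k) * (Ufun ^^ n) g (\<omega> k))"
    proof (rule Bochner_Integration.integrable_bound[OF iV])
      show "AE \<omega> in law. norm (g (\<omega> k) * (Ufun ^^ n) g (\<omega> k)) \<le> norm (2 * B * (Lg * (1 + b / (1 - a) + V (\<omega> k)) * r ^ n))"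
        using bound[OF coord_in_state_set, of _ k] by (intro AE_I2) (auto intro: order_trans[OF _ abs_ge_self])
    qed measurable
    have "\<bar>\<integral>\<omega>. g (\<omega> k) * g (\<omega> l) \<partial>law\<bar> = \<bar>\<integral>\<omega>. g (\<omega> k) * (Ufun ^^ n) g (\<omega> k) \<partial>law\<bar>"
      unfolding l integral_transition_pow[OF bmg bmg] ..
    also have "\<dots> \<le> (\<integral>\<omega>. \<bar>g (\<omega> k) * (Ufun ^^ n) g (\<omega> k)\<bar> \<partial>law)" by (rule integral_abs_bound)
    also have "\<dots> \<le> (\<integral>\<omega>. 2 * B * (Lg * (1 + b / (1 - a) + V (\<omega> k)) * r ^ n) \<partial>law)"
      using ig iV bound[OF coord_in_state_set, of _ k] by (intro integral_mono) auto
    also have "\<dots> = 2 * B * (Lg * (1 + b / (1 - a) + (\<integral>\<omega>. V (\<omega> k) \<partial>law)) * r ^ n)"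
      using V_coord(1)[of k] law.prob_space by simp
    also have "\<dots> \<le> 2 * B * (Lg * (1 + b / (1 - a) + (V z0 + b / (1 - a))) * r ^ n)"
      using V_coord(2)[of k] B(1) Lg r by (intro mult_left_mono mult_right_mono) auto
    also have "\<dots> = E * r ^ (l - k)" by (simp add: E_def n_def)
    finally show "\<bar>\<integral>\<omega>. g (\<omega> k) * g (\<omega> l) \<partial>law\<bar> \<le> E * r ^ (l - k)" .
  qed
  then show ?thesis
  proof eventually_elim
    case (elim \<omega>)
    have "(\<lambda>n. (\<Sum>k<n. g (\<omega> k)) / real n + m) \<longlonglongrightarrow> 0 + m" by (intro tendsto_intros elim)
    moreover have "\<forall>\<^sub>F n in sequentially. (\<Sum>k<n. g (\<omega> k)) / real n + m = 1 / real n * (\<Sum>k<n. f (\<omega> k))"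
      unfolding eventually_sequentially
      by (intro exI[of _ 1]) (auto simp: g_def sum_subtractf field_simps)
    ultimately have "(\<lambda>n. 1 / real n * (\<Sum>k<n. f (\<omega> k))) \<longlonglongrightarrow> 0 + m"
      by (rule Lim_transform_eventually)
    then show ?case by (simp add: m_def)
  qed
qed

end

section \<open>A bounded cost function\<close>

text \<open>For \<open>D\<close> beyond the linear range, \<open>1 - g\<close> decays like \<open>D\<close> to the power \<open>- \<gamma>\<close> with \<open>a\<close> to the power
  \<open>- \<gamma>\<close> equal to \<open>2 / \<delta>\<close>: contracting \<open>D\<close> by \<open>a\<close> with probability only \<open>\<delta>\<close> then still lowers the mean cost,
  even if the cost jumps to its maximum \<open>1\<close> otherwise.\<close>

lemma ex_cost_function:
  fixes \<sigma> \<delta> a R :: real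
  assumes \<sigma>: "\<sigma> > 0" and \<delta>: "0 < \<delta>" "\<delta> \<le> 1" and a: "0 < a" "a < 1" and R: "1 / \<sigma> \<le> R"
  obtains g :: "real \<Rightarrow> real" and \<epsilon> where
    "0 < \<epsilon>" "\<epsilon> < 1" "mono g" "g \<in> borel_measurable borel"
    "\<And>D. 0 \<le> D \<Longrightarrow> 0 \<le> g D" "\<And>D. g D \<le> 1" "\<And>D. g D \<le> \<sigma> * D"
    "\<And>D. min (\<sigma> * D) (1 / 2) \<le> g D" "\<And>D. R \<le> D \<Longrightarrow> g D = 1"
    "\<And>D. D \<le> R \<Longrightarrow> g D \<noteq> \<sigma> * D \<Longrightarrow> 1 - \<delta> * (1 - g (a * D)) \<le> (1 - \<epsilon>) * g D"
proof -
  define \<gamma> where "\<gamma> = ln (2 / \<delta>) / ln (1 / a)"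
  \<comment> \<open>Where \<open>g D\<close> has left the line \<open>\<sigma> * D\<close>, one has
    \<open>D > 1 / (2 * \<sigma>)\<close>, so \<open>a * D\<close> is still at least
    \<open>d\<close>. The floor \<open>d\<close> in \<open>\<theta>\<close> is therefore inactive in
    the final estimate and only keeps \<open>\<theta>\<close> bounded.\<close>
  define d where "d = a / (2 * \<sigma>)"
  \<comment> \<open>Chosen so that \<open>\<epsilon> * \<theta> D\<close> never exceeds 1/2, which
    keeps \<open>g\<close> above \<open>min (\<sigma> * D) (1 / 2)\<close>.\<close>
  define \<epsilon> where "\<epsilon> = (d / R) powr \<gamma> / 2"
  \<comment> \<open>Normalised to vanish at \<open>R\<close>, where the cost is to reach its maximum
    1.\<close>
  define \<theta> where "\<theta> D = (max D d / R) powr (- \<gamma>) - 1" for D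
  define g where "g D = min 1 (min (\<sigma> * D) (1 - \<epsilon> * \<theta> D))" for D
  have R0: "R > 0" using R \<sigma> by (meson divide_pos_pos less_le_trans zero_less_one)
  have sR: "1 \<le> \<sigma> * R" using R \<sigma> by (simp add: field_simps)
  have d0: "d > 0" using a \<sigma> by (simp add: d_def)
  have dR: "d \<le> R" 
  proof -
    have "d \<le> 1 / \<sigma>" using a \<sigma> by (simp add: d_def field_simps)
    then show ?thesis using R by simp
  qed
  have \<gamma>: "\<gamma> > 0" unfolding \<gamma>_def using \<delta> a by (intro divide_pos_pos ln_gt_zero) (auto simp: field_simps)
  have a_pow: "a powr (- \<gamma>) = 2 / \<delta>"
  proof -
    have "ln a < 0" using a by simp
    then have "- \<gamma> * ln a = ln (2 / \<delta>)" using a by (simp add: \<gamma>_def ln_div)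
    then show ?thesis using a \<delta> by (simp add: powr_def)
  qed
  have \<epsilon>: "0 < \<epsilon>" "\<epsilon> < 1"
  proof -
    show "0 < \<epsilon>" using d0 R0 by (simp add: \<epsilon>_def)
    have "(d / R) powr \<gamma> \<le> 1 powr \<gamma>" using d0 R0 dR \<gamma> by (intro powr_mono2) auto
    then show "\<epsilon> < 1" by (simp add: \<epsilon>_def)
  qed
  have \<theta>_anti: "\<theta> y \<le> \<theta> x" if "x \<le> y" for x y
    unfolding \<theta>_def using that d0 R0 \<gamma> by (intro diff_right_mono powr_mono2') (auto intro!: divide_right_mono)
  have \<theta>_R: "\<theta> R = 0" using dR R0 by (simp add: \<theta>_def max_absorb1)
  have \<theta>_le: "\<epsilon> * \<theta> D \<le> 1 / 2" for D
  proof -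
    have "\<theta> D \<le> (d / R) powr (- \<gamma>)"
    proof -
      have "(max D d / R) powr (- \<gamma>) \<le> (d / R) powr (- \<gamma>)"
        using d0 R0 \<gamma> by (intro powr_mono2') (auto intro!: divide_right_mono)
      then show ?thesis by (simp add: \<theta>_def)
    qed
    then have "\<epsilon> * \<theta> D \<le> \<epsilon> * (d / R) powr (- \<gamma>)" using \<epsilon> by (intro mult_left_mono) auto
    also have "\<dots> = 1 / 2" using d0 R0 by (simp add: \<epsilon>_def powr_minus field_simps)
    finally show ?thesis .
  qed
  show ?thesis
  proof (rule that[of \<epsilon> g])
    show "0 < \<epsilon>" "\<epsilon> < 1" by (rule \<epsilon>)+
    show "mono g"
    proof (rule monoI)
      fix x y :: real assume "x \<le> y"
      then have "\<sigma> * x \<le> \<sigma> * y" "\<epsilon> * \<theta> y \<le> \<epsilon> * \<theta> x"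
        using \<sigma> \<epsilon> \<theta>_anti by (auto intro!: mult_left_mono)
      then show "g x \<le> g y" unfolding g_def by linarith
    qed
    show "g \<in> borel_measurable borel" unfolding g_def \<theta>_def by measurable
    show "0 \<le> g D" if "0 \<le> D" for D
    proof -
      have "0 \<le> \<sigma> * D" using that \<sigma> by simp
      then show ?thesis using \<theta>_le[of D] unfolding g_def by linarith
    qed
    show "g D \<le> 1" "g D \<le> \<sigma> * D" for D unfolding g_def by linarith+
    show "min (\<sigma> * D) (1 / 2) \<le> g D" for D using \<theta>_le[of D] unfolding g_def by linarith
    show "g D = 1" if "R \<le> D" for D
    proof -
      have "\<sigma> * R \<le> \<sigma> * D" using that \<sigma> by simp
      moreover have "\<epsilon> * \<theta> D \<le> \<epsilon> * 0" using \<theta>_anti[OF that] \<theta>_R \<epsilon> by (intro mult_left_mono) auto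
      ultimately show ?thesis using sR unfolding g_def by linarith
    qed
    fix D assume D: "D \<le> R" and ne: "g D \<noteq> \<sigma> * D"
    have "0 \<le> \<epsilon> * \<theta> D" using \<theta>_anti[OF D] \<theta>_R \<epsilon> by simp
    then have gD: "g D = 1 - \<epsilon> * \<theta> D" and "1 - \<epsilon> * \<theta> D < \<sigma> * D" using ne unfolding g_def by linarith+
    then have "1 / 2 < \<sigma> * D" using \<theta>_le[of D] by linarith
    then have D2: "1 / (2 * \<sigma>) < D" using \<sigma> by (simp add: field_simps)
    have aD: "d \<le> a * D"
    proof -
      have "a * (1 / (2 * \<sigma>)) \<le> a * D" using D2 a by (intro mult_left_mono) auto
      then show ?thesis by (simp add: d_def)
    qed
    have D0: "0 < D" using D2 \<sigma> by (meson divide_pos_pos less_trans mult_pos_pos zero_less_numeral zero_less_one)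
    have "a * D \<le> D" using a D0 by simp
    then have dD: "d \<le> D" using aD by linarith
    define u where "u = (D / R) powr (- \<gamma>)"
    have u1: "1 \<le> u"
    proof -
      have "1 powr (- \<gamma>) \<le> u" unfolding u_def using D0 D R0 \<gamma> by (intro powr_mono2') auto
      then show ?thesis by simp
    qed
    have th1: "\<theta> D = u - 1" using dD by (simp add: \<theta>_def u_def max_absorb1)
    have th2: "\<theta> (a * D) = 2 / \<delta> * u - 1"
    proof -
      have "(a * D / R) powr (- \<gamma>) = a powr (- \<gamma>) * (D / R) powr (- \<gamma>)"
        using a D0 R0 by (subst powr_mult[symmetric]) auto
      then show ?thesis using aD by (simp add: \<theta>_def u_def max_absorb1 a_pow)
    qed
    have "g (a * D) \<le> 1 - \<epsilon> * \<theta> (a * D)" unfolding g_def by linarith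
    \<comment> \<open>Here \<open>g D = 1 - \<epsilon> * (u - 1)\<close>. The gain is at least
      \<open>\<epsilon> * (2 * u - \<delta>)\<close>, hence at least \<open>\<epsilon> * u\<close>
      because \<open>\<delta> \<le> 1 \<le> u\<close>; so the left side of the goal is at most
      \<open>g D - \<epsilon>\<close>, and \<open>g D \<le> 1\<close> does the rest.\<close>
    then have "\<delta> * (\<epsilon> * \<theta> (a * D)) \<le> \<delta> * (1 - g (a * D))" using \<delta> by (intro mult_left_mono) auto
    moreover have "\<delta> * (\<epsilon> * \<theta> (a * D)) = \<epsilon> * (2 * u - \<delta>)" unfolding th2 using \<delta> by (simp add: field_simps)
    moreover have "\<epsilon> * u \<le> \<epsilon> * (2 * u - \<delta>)" using \<epsilon> u1 \<delta> by (intro mult_left_mono) auto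
    moreover have "\<epsilon> * g D \<le> \<epsilon> * 1" using gD \<open>0 \<le> \<epsilon> * \<theta> D\<close> \<epsilon> by (intro mult_left_mono) auto
    ultimately show "1 - \<delta> * (1 - g (a * D)) \<le> (1 - \<epsilon>) * g D"
      unfolding gD th1 by (simp add: algebra_simps)
  qed
qed

section \<open>Integrals against the exponential and the uniform law\<close>

lemma measurable_count_space_subset:
  "f \<in> M \<rightarrow>\<^sub>M count_space UNIV \<Longrightarrow> (\<And>x. x \<in> space M \<Longrightarrow> f x \<in> A) \<Longrightarrow> f \<in> M \<rightarrow>\<^sub>M count_space A"
  by (auto simp: measurable_def)

text \<open>Multiplying the exponential density of rate \<open>lam\<close> by
  \<open>exp (\<alpha> * t)\<close> gives, up to a constant, the density of rate
  \<open>lam - \<alpha>\<close>; \<open>max 0 t\<close> agrees with \<open>t\<close> on the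
  support.\<close>

lemma nn_integral_exponential_exp:
  fixes \<alpha> lam :: real
  assumes "lam > 0" "\<alpha> < lam"
  shows "(\<integral>\<^sup>+t. ennreal (exp (\<alpha> * max 0 t)) \<partial>density lborel (exponential_density lam)) = ennreal (lam / (lam - \<alpha>))"
proof -
  have "(\<integral>\<^sup>+t. ennreal (exp (\<alpha> * max 0 t)) \<partial>density lborel (exponential_density lam))
      = (\<integral>\<^sup>+t. ennreal (exponential_density lam t) * ennreal (exp (\<alpha> * max 0 t)) \<partial>lborel)"
    by (subst nn_integral_density) auto
  also have "\<dots> = (\<integral>\<^sup>+t. ennreal (lam / (lam - \<alpha>)) * ennreal (exponential_density (lam - \<alpha>) t) \<partial>lborel)"
  proof (rule nn_integral_cong)
    fix t
    show "ennreal (exponential_density lam t) * ennreal (exp (\<alpha> * max 0 t))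
        = ennreal (lam / (lam - \<alpha>)) * ennreal (exponential_density (lam - \<alpha>) t)"
      using assms by (auto simp: exponential_density_def ennreal_mult[symmetric] max_def exp_add[symmetric] field_simps)
  qed
  also have "\<dots> = ennreal (lam / (lam - \<alpha>)) * (\<integral>\<^sup>+t. ennreal (exponential_density (lam - \<alpha>) t) \<partial>lborel)"
    by (rule nn_integral_cmult) simp
  also have "(\<integral>\<^sup>+t. ennreal (exponential_density (lam - \<alpha>) t) \<partial>lborel) = 1"
    using prob_space.emeasure_space_1[OF prob_space_exponential_density[of "lam - \<alpha>"]] assms
    by (simp add: emeasure_density)
  finally show ?thesis by simp
qed

lemma nn_integral_uniform_le:
  assumes "0 \<le> k" "k \<le> 1"
  shows "(\<integral>\<^sup>+u. (if u \<le> k then c else 0) \<partial>uniform_measure lborel {0..1::real}) = ennreal k * c"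
proof -
  have "(\<integral>\<^sup>+u. (if u \<le> k then c else 0) \<partial>uniform_measure lborel {0..1::real})
      = (\<integral>\<^sup>+u. c * indicator {..k} u \<partial>uniform_measure lborel {0..1::real})"
    by (intro nn_integral_cong) (auto split: split_indicator)
  also have "\<dots> = c * emeasure (uniform_measure lborel {0..1::real}) {..k}"
    by (rule nn_integral_cmult_indicator) simp
  also have "{0..1} \<inter> {..k} = {0..k}" using assms by auto
  then have "emeasure (uniform_measure lborel {0..1::real}) {..k} = ennreal k"
    using assms by (subst emeasure_uniform_measure) (auto simp: divide_ennreal_def)
  finally show ?thesis by (simp add: mult.commute)
qed

text \<open>With one uniform level for both states, the decisions differ exactly when it falls
  between the two thresholds.\<close>

lemma nn_integral_uniform_neq:
  assumes "0 \<le> k" "k \<le> 1" "0 \<le> l" "l \<le> 1"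
  shows "(\<integral>\<^sup>+u. (if (u \<le> k) \<noteq> (u \<le> l) then 1 else 0) \<partial>uniform_measure lborel {0..1::real}) = ennreal \<bar>k - l\<bar>"
proof -
  have "(\<integral>\<^sup>+u. (if (u \<le> k) \<noteq> (u \<le> l) then 1 else 0) \<partial>uniform_measure lborel {0..1::real})
      = (\<integral>\<^sup>+u. indicator {min k l<..max k l} u \<partial>uniform_measure lborel {0..1::real})"
    by (intro nn_integral_cong) (auto split: split_indicator)
  also have "\<dots> = emeasure (uniform_measure lborel {0..1::real}) {min k l<..max k l}" by simp
  also have "{0..1} \<inter> {min k l<..max k l} = {min k l<..max k l}" using assms by auto
  then have "emeasure (uniform_measure lborel {0..1::real}) {min k l<..max k l} = ennreal \<bar>k - l\<bar>"
    using assms by (subst emeasure_uniform_measure) (auto simp: divide_ennreal_def max_def min_def)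
  finally show ?thesis .
qed

section \<open>The jump process as a random map\<close>

lemma emeasure_eq_nn_integral_if:
  assumes "Measurable.pred M P"
  shows "emeasure M {x\<in>space M. P x} = (\<integral>\<^sup>+x. (if P x then 1 else 0) \<partial>M)"
proof -
  have "(\<integral>\<^sup>+x. (if P x then 1 else 0) \<partial>M) = (\<integral>\<^sup>+x. indicator {x\<in>space M. P x} x \<partial>M)"
    by (intro nn_integral_cong) (auto split: split_indicator)
  also have "\<dots> = emeasure M {x\<in>space M. P x}" using assms by (intro nn_integral_indicator) simp
  finally show ?thesis ..
qed

locale jump_process =
  fixes N K :: nat and lam :: real
    and \<Phi> :: "nat \<Rightarrow> real \<Rightarrow> 'y::polish_space \<Rightarrow> 'y"
    and q :: "nat \<Rightarrow> 'y \<Rightarrow> 'y"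
    and pb :: "nat \<Rightarrow> 'y \<Rightarrow> real"
    and p :: "nat \<Rightarrow> nat \<Rightarrow> 'y \<Rightarrow> real"
    and Lp Lpb :: real
  assumes N: "N \<ge> 1" and K: "K \<ge> 1" and lam: "lam > 0"
    and semidynamical: "\<And>i. i \<in> {1..N} \<Longrightarrow> semidynamical_system (\<Phi> i)"
    and continuous_q: "\<And>s. s \<in> {1..K} \<Longrightarrow> continuous_on UNIV (q s)"
    and prob_vector: "probability_vector K pb"
    and prob_matrix: "probability_matrix N p"
    and Lp: "Lp > 0" and Lpb: "Lpb > 0"
    and lipschitz_p: "\<And>x y i. i \<in> {1..N} \<Longrightarrow> (\<Sum>j\<in>{1..N}. \<bar>p i j x - p i j y\<bar>) \<le> Lp * dist x y"
    and lipschitz_pb: "\<And>x y. (\<Sum>s\<in>{1..K}. \<bar>pb s x - pb s y\<bar>) \<le> Lpb * dist x y"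
begin

text \<open>The flow is only controlled for nonnegative times; freezing it at negative ones makes it
  jointly continuous on the whole line and does not change it under the exponential law.\<close>

definition Phi :: "nat \<Rightarrow> real \<Rightarrow> 'y \<Rightarrow> 'y" where "Phi j t x = \<Phi> j (max 0 t) x"

definition JS :: "(nat \<times> nat) set" where "JS = {1..N} \<times> {1..K}"

text \<open>The acceptance probability of the pair \<open>js\<close> at waiting time
  \<open>t\<close>: the old index selects the row of the probability matrix, and the proposed flow
  index becomes the new index in \<open>pos\<close>.\<close>

definition wt :: "'y \<times> nat \<Rightarrow> nat \<times> nat \<Rightarrow> real \<Rightarrow> real" where
  "wt z js t = p (snd z) (fst js) (fst z) * pb (snd js) (Phi (fst js) t (fst z))"

definition pos :: "'y \<times> nat \<Rightarrow> nat \<times> nat \<Rightarrow> real \<Rightarrow> 'y \<times> nat" where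
  "pos z js t = (q (snd js) (Phi (fst js) t (fst z)), fst js)"

definition Ex :: "real measure" where "Ex = density lborel (exponential_density lam)"

definition Unif :: "real measure" where "Unif = uniform_measure lborel {0..1}"

text \<open>Pairs of indices are proposed uniformly, the waiting time already has its true law, and
  the last coordinate is the level that \<open>acc\<close> compares with the weight.\<close>

definition Q :: "((nat \<times> nat) \<times> real \<times> real) measure" where
  "Q = uniform_count_measure JS \<Otimes>\<^sub>M (Ex \<Otimes>\<^sub>M Unif)"

definition T :: "'y \<times> nat \<Rightarrow> (nat \<times> nat) \<times> real \<times> real \<Rightarrow> 'y \<times> nat" where
  "T z w = pos z (fst w) (fst (snd w))"

definition acc :: "'y \<times> nat \<Rightarrow> (nat \<times> nat) \<times> real \<times> real \<Rightarrow> bool" where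
  "acc z w \<longleftrightarrow> snd (snd w) \<le> wt z (fst w) (fst (snd w))"

lemma finite_JS [simp]: "finite JS" and JS_nonempty: "JS \<noteq> {}" and card_JS: "card JS = N * K"
  using N K by (auto simp: JS_def)

lemma JS_D: "js \<in> JS \<Longrightarrow> fst js \<in> {1..N}" "js \<in> JS \<Longrightarrow> snd js \<in> {1..K}"
  by (auto simp: JS_def)

lemma p_bounds: "i \<in> {1..N} \<Longrightarrow> j \<in> {1..N} \<Longrightarrow> 0 \<le> p i j x" "i \<in> {1..N} \<Longrightarrow> j \<in> {1..N} \<Longrightarrow> p i j x \<le> 1"
  "i \<in> {1..N} \<Longrightarrow> (\<Sum>j\<in>{1..N}. p i j x) = 1"
  using prob_matrix unfolding probability_matrix_def by auto

lemma pb_bounds: "s \<in> {1..K} \<Longrightarrow> 0 \<le> pb s x" "s \<in> {1..K} \<Longrightarrow> pb s x \<le> 1"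
  "(\<Sum>s\<in>{1..K}. pb s x) = 1"
  using prob_vector unfolding probability_vector_def by auto

sublocale Ex: prob_space Ex
  unfolding Ex_def by (rule prob_space_exponential_density[OF lam])

sublocale Unif: prob_space Unif
  unfolding Unif_def by (rule prob_space_uniform_measure) auto

lemma sets_Ex [measurable_cong, simp]: "sets Ex = sets borel" by (simp add: Ex_def)
lemma sets_Unif [measurable_cong, simp]: "sets Unif = sets borel" by (simp add: Unif_def)
lemma space_Ex [simp]: "space Ex = UNIV" by (simp add: Ex_def)
lemma space_Unif [simp]: "space Unif = UNIV" by (simp add: Unif_def)

lemma prob_space_Q: "prob_space Q"
proof -
  interpret A: prob_space "uniform_count_measure JS"
    by (rule prob_space_uniform_count_measure) (simp_all add: JS_nonempty)
  interpret B: pair_prob_space Ex Unif ..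
  interpret C: pair_prob_space "uniform_count_measure JS" "Ex \<Otimes>\<^sub>M Unif" ..
  show ?thesis unfolding Q_def by (rule C.P.prob_space_axioms)
qed

lemma continuous_Phi: "j \<in> {1..N} \<Longrightarrow> continuous_on UNIV (\<lambda>p. Phi j (fst p) (snd p))"
  unfolding Phi_def
  by (rule continuous_on_compose2[of "{0..} \<times> UNIV" "\<lambda>(t, x). \<Phi> j t x" UNIV "\<lambda>p. (max 0 (fst p), snd p)", simplified])
    (use semidynamical[of j] in \<open>auto simp: semidynamical_system_def intro!: continuous_intros\<close>)

lemma measurable_Phi:
  assumes "j \<in> {1..N}" "f \<in> borel_measurable M" "g \<in> borel_measurable M"
  shows "(\<lambda>x. Phi j (f x) (g x)) \<in> borel_measurable M"
  using measurable_compose[OF borel_measurable_Pair[OF assms(2,3)] borel_measurable_continuous_onI[OF continuous_Phi[OF assms(1)]]]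
  by simp

lemma measurable_q: "s \<in> {1..K} \<Longrightarrow> q s \<in> borel_measurable borel"
  by (intro borel_measurable_continuous_onI continuous_q)

text \<open>Measurability of the probabilities comes out of the Lipschitz condition, which makes
  each entry continuous.\<close>

lemma measurable_p:
  assumes "i \<in> {1..N}" "j \<in> {1..N}" shows "p i j \<in> borel_measurable borel"
proof -
  have "Lp-lipschitz_on UNIV (p i j)"
  proof (rule lipschitz_onI)
    fix x y
    have "\<bar>p i j x - p i j y\<bar> \<le> (\<Sum>j\<in>{1..N}. \<bar>p i j x - p i j y\<bar>)"
      using assms(2) by (intro member_le_sum) auto
    then show "dist (p i j x) (p i j y) \<le> Lp * dist x y"
      using lipschitz_p[OF assms(1), of x y] by (simp add: dist_real_def)
  qed (use Lp in simp)
  then show ?thesis by (intro borel_measurable_continuous_onI lipschitz_on_continuous_on)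
qed

lemma measurable_pb:
  assumes "s \<in> {1..K}" shows "pb s \<in> borel_measurable borel"
proof -
  have "Lpb-lipschitz_on UNIV (pb s)"
  proof (rule lipschitz_onI)
    fix x y
    have "\<bar>pb s x - pb s y\<bar> \<le> (\<Sum>s\<in>{1..K}. \<bar>pb s x - pb s y\<bar>)"
      using assms by (intro member_le_sum) auto
    then show "dist (pb s x) (pb s y) \<le> Lpb * dist x y"
      using lipschitz_pb[of x y] by (simp add: dist_real_def)
  qed (use Lpb in simp)
  then show ?thesis by (intro borel_measurable_continuous_onI lipschitz_on_continuous_on)
qed

lemma measurable_snd_state_count: "snd \<in> state_space N \<rightarrow>\<^sub>M count_space {1..N}"
  by (rule measurable_count_space_subset[OF measurable_snd_state]) simp

lemma measurable_wt:
  assumes f: "f \<in> M \<rightarrow>\<^sub>M state_space N" and g: "g \<in> borel_measurable M" and js: "js \<in> JS"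
  shows "(\<lambda>x. wt (f x) js (g x)) \<in> borel_measurable M"
  unfolding wt_def
proof (rule borel_measurable_times)
  note ff = measurable_fst_state'[OF f]
  show "(\<lambda>x. p (snd (f x)) (fst js) (fst (f x))) \<in> borel_measurable M"
  proof (rule measurable_compose_countable'[where f="\<lambda>i x. p i (fst js) (fst (f x))" and I="{1..N}"])
    show "(\<lambda>x. snd (f x)) \<in> M \<rightarrow>\<^sub>M count_space {1..N}"
      by (rule measurable_compose[OF f measurable_snd_state_count])
  qed (use JS_D[OF js] in \<open>auto intro!: measurable_compose[OF ff measurable_p] countable_finite\<close>)
  show "(\<lambda>x. pb (snd js) (Phi (fst js) (g x) (fst (f x)))) \<in> borel_measurable M"
    using JS_D[OF js] by (intro measurable_compose[OF _ measurable_pb] measurable_Phi g ff)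
qed

lemma measurable_pos:
  assumes f: "f \<in> M \<rightarrow>\<^sub>M state_space N" and g: "g \<in> borel_measurable M" and js: "js \<in> JS"
  shows "(\<lambda>x. pos (f x) js (g x)) \<in> M \<rightarrow>\<^sub>M state_space N"
  unfolding pos_def
proof (rule measurable_Pair_state)
  show "(\<lambda>x. q (snd js) (Phi (fst js) (g x) (fst (f x)))) \<in> borel_measurable M"
    using JS_D[OF js] by (intro measurable_compose[OF _ measurable_q] measurable_Phi g measurable_fst_state'[OF f])
qed (use JS_D[OF js] in auto)

lemma measurable_Q_parts:
  "(\<lambda>w. fst w) \<in> Q \<rightarrow>\<^sub>M count_space JS" "(\<lambda>w. fst (snd w)) \<in> borel_measurable Q" "(\<lambda>w. snd (snd w)) \<in> borel_measurable Q"
proof -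
  have "fst \<in> Q \<rightarrow>\<^sub>M uniform_count_measure JS" unfolding Q_def by (rule measurable_fst)
  also have "Q \<rightarrow>\<^sub>M uniform_count_measure JS = Q \<rightarrow>\<^sub>M count_space JS"
    by (rule measurable_cong_sets) (simp_all add: sets_uniform_count_measure)
  finally show "(\<lambda>w. fst w) \<in> Q \<rightarrow>\<^sub>M count_space JS" by simp
  show "(\<lambda>w. fst (snd w)) \<in> borel_measurable Q" "(\<lambda>w. snd (snd w)) \<in> borel_measurable Q"
    unfolding Q_def by measurable
qed

lemma wt_bounds: "z \<in> state_set N \<Longrightarrow> js \<in> JS \<Longrightarrow> 0 \<le> wt z js t" "z \<in> state_set N \<Longrightarrow> js \<in> JS \<Longrightarrow> wt z js t \<le> 1"
  unfolding wt_def using JS_D[of js] p_bounds(1,2)[of "snd z" "fst js"] pb_bounds(1,2)[of "snd js"]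
  by (auto intro!: mult_nonneg_nonneg mult_le_one)

lemma sum_JS: "(\<Sum>js\<in>JS. h (fst js) (snd js)) = (\<Sum>j\<in>{1..N}. \<Sum>s\<in>{1..K}. h j s)"
  unfolding JS_def by (simp add: sum.cartesian_product case_prod_beta)

text \<open>Summing over the jump indices at the end of each flow gives 1, and what remains is a row
  of the matrix. That this holds at every waiting time makes the acceptance rate independent of the
  state, as the sampler demands.\<close>

lemma sum_wt: "z \<in> state_set N \<Longrightarrow> (\<Sum>js\<in>JS. wt z js t) = 1"
  unfolding wt_def sum_JS[of "\<lambda>j s. p (snd z) j (fst z) * pb s (Phi j t (fst z))"]
  unfolding sum_distrib_left[symmetric] pb_bounds(3) mult_1_right by (intro p_bounds(3)) simp

lemma nn_integral_Q:
  assumes G: "G \<in> borel_measurable Q"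
  shows "(\<integral>\<^sup>+w. G w \<partial>Q) = ennreal (1 / real (N * K)) * (\<integral>\<^sup>+t. (\<Sum>js\<in>JS. \<integral>\<^sup>+u. G (js, t, u) \<partial>Unif) \<partial>Ex)"
proof -
  interpret A: prob_space "uniform_count_measure JS"
    by (rule prob_space_uniform_count_measure) (simp_all add: JS_nonempty)
  interpret B: pair_prob_space Ex Unif ..
  have Gj: "(\<lambda>v. G (js, v)) \<in> borel_measurable (Ex \<Otimes>\<^sub>M Unif)" if "js \<in> JS" for js
    using measurable_compose_Pair1[OF _ G[unfolded Q_def], of js] that by (simp add: space_uniform_count_measure)
  have Gj2: "(\<lambda>t. \<integral>\<^sup>+u. G (js, t, u) \<partial>Unif) \<in> borel_measurable Ex" if "js \<in> JS" for js
    using Unif.borel_measurable_nn_integral_fst[OF Gj[OF that]] .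
  have "(\<integral>\<^sup>+w. G w \<partial>Q) = (\<integral>\<^sup>+js. \<integral>\<^sup>+v. G (js, v) \<partial>(Ex \<Otimes>\<^sub>M Unif) \<partial>uniform_count_measure JS)"
    unfolding Q_def by (rule B.nn_integral_fst[symmetric, OF G[unfolded Q_def]])
  also have "\<dots> = (\<Sum>js\<in>JS. ennreal (1 / real (N * K)) * (\<integral>\<^sup>+v. G (js, v) \<partial>(Ex \<Otimes>\<^sub>M Unif)))"
    unfolding uniform_count_measure_def by (subst nn_integral_point_measure_finite) (auto simp: card_JS)
  also have "\<dots> = (\<Sum>js\<in>JS. ennreal (1 / real (N * K)) * (\<integral>\<^sup>+t. \<integral>\<^sup>+u. G (js, t, u) \<partial>Unif \<partial>Ex))"
    by (intro sum.cong refl) (simp add: Unif.nn_integral_fst[OF Gj])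
  also have "\<dots> = ennreal (1 / real (N * K)) * (\<integral>\<^sup>+t. (\<Sum>js\<in>JS. \<integral>\<^sup>+u. G (js, t, u) \<partial>Unif) \<partial>Ex)"
    by (subst nn_integral_sum[OF Gj2]) (simp_all add: sum_distrib_left)
  finally show ?thesis .
qed

lemma measurable_T: "(\<lambda>(z, w). T z w) \<in> state_space N \<Otimes>\<^sub>M Q \<rightarrow>\<^sub>M state_space N"
  unfolding T_def case_prod_beta
  by (rule measurable_compose_countable'[where f="\<lambda>js x. pos (fst x) js (fst (snd (snd x)))" and I=JS])
    (auto intro!: measurable_pos measurable_fst measurable_compose[OF measurable_snd measurable_Q_parts(1)]
       measurable_compose[OF measurable_snd measurable_Q_parts(2)] countable_finite)

lemma pred_acc: "Measurable.pred (state_space N \<Otimes>\<^sub>M Q) (\<lambda>(z, w). acc z w)"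
proof -
  have "(\<lambda>x. wt (fst x) (fst (snd x)) (fst (snd (snd x)))) \<in> borel_measurable (state_space N \<Otimes>\<^sub>M Q)"
    by (rule measurable_compose_countable'[where f="\<lambda>js x. wt (fst x) js (fst (snd (snd x)))" and I=JS])
      (auto intro!: measurable_wt measurable_fst measurable_compose[OF measurable_snd measurable_Q_parts(1)]
         measurable_compose[OF measurable_snd measurable_Q_parts(2)] countable_finite)
  moreover have "(\<lambda>x. snd (snd (snd x))) \<in> borel_measurable (state_space N \<Otimes>\<^sub>M Q)"
    by (rule measurable_compose[OF measurable_snd measurable_Q_parts(3)])
  ultimately have "Measurable.pred (state_space N \<Otimes>\<^sub>M Q) (\<lambda>x. snd (snd (snd x)) \<le> wt (fst x) (fst (snd x)) (fst (snd (snd x))))"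
    by measurable
  then show ?thesis unfolding acc_def case_prod_beta .
qed

lemma measurable_accQ: "z \<in> state_set N \<Longrightarrow> Measurable.pred Q (acc z)"
  using measurable_compose[OF measurable_Pair1' pred_acc, of z] by simp

lemma measurable_TQ: "z \<in> state_set N \<Longrightarrow> T z \<in> Q \<rightarrow>\<^sub>M state_space N"
  using measurable_compose[OF measurable_Pair1' measurable_T, of z] by simp

lemma integral_u_le:
  assumes "z \<in> state_set N" "js \<in> JS"
  shows "(\<integral>\<^sup>+u. (if u \<le> wt z js t then c else 0) \<partial>Unif) = ennreal (wt z js t) * c"
  unfolding Unif_def by (intro nn_integral_uniform_le wt_bounds assms)

lemma emeasure_acc:
  assumes z: "z \<in> state_set N"
  shows "emeasure Q {w\<in>space Q. acc z w} = ennreal (1 / real (N * K))"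
proof -
  note [measurable] = measurable_accQ[OF z]
  have "emeasure Q {w\<in>space Q. acc z w} = (\<integral>\<^sup>+w. (if acc z w then 1 else 0) \<partial>Q)"
    by (rule emeasure_eq_nn_integral_if) measurable
  also have "\<dots> = ennreal (1 / real (N * K)) * (\<integral>\<^sup>+t. (\<Sum>js\<in>JS. \<integral>\<^sup>+u. (if acc z (js, t, u) then 1 else 0) \<partial>Unif) \<partial>Ex)"
    by (rule nn_integral_Q) measurable
  also have "(\<lambda>t. \<Sum>js\<in>JS. \<integral>\<^sup>+u. (if acc z (js, t, u) then 1 else 0) \<partial>Unif) = (\<lambda>t. ennreal (\<Sum>js\<in>JS. wt z js t))"
    by (intro ext) (simp add: acc_def integral_u_le[OF z] sum_ennreal[symmetric] wt_bounds[OF z] del: sum_ennreal)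
  finally show ?thesis by (simp add: sum_wt[OF z] Ex.emeasure_space_1[simplified])
qed

sublocale RS: rejection_sampler Q "state_space N" T acc "1 / real (N * K)"
proof (rule rejection_sampler.intro[OF prob_space_Q], rule rejection_sampler_axioms.intro)
  show "0 < 1 / real (N * K)" using N K by simp
qed (use measurable_T pred_acc emeasure_acc in auto)

abbreviation smp :: "'y \<times> nat \<Rightarrow> ((nat \<times> nat) \<times> real \<times> real) stream \<Rightarrow> 'y \<times> nat" where
  "smp \<equiv> RS.sample"

lemma ennreal_cancel_NK: "ennreal (1 / real (N * K)) * x = ennreal (1 / real (N * K)) * y \<longleftrightarrow> x = y"
  "ennreal (1 / real (N * K)) * x \<le> ennreal (1 / real (N * K)) * y \<longleftrightarrow> x \<le> y"
proof -
  have *: "ennreal (1 / real (N * K)) \<noteq> 0" "ennreal (1 / real (N * K)) < top" using N K by auto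
  then show "ennreal (1 / real (N * K)) * x = ennreal (1 / real (N * K)) * y \<longleftrightarrow> x = y"
    by (subst ennreal_mult_cancel_left) auto
  show "ennreal (1 / real (N * K)) * x \<le> ennreal (1 / real (N * K)) * y \<longleftrightarrow> x \<le> y"
    using * by (subst ennreal_mult_le_mult_iff) auto
qed

section \<open>Law of the sampler at one state and at a pair of states\<close>

lemma measurable_smp1: "z \<in> state_set N \<Longrightarrow> smp z \<in> stream_space Q \<rightarrow>\<^sub>M state_space N"
  using measurable_compose[OF measurable_Pair1' RS.measurable_sample, of z] by simp

text \<open>The uniform proposal rate and the overall acceptance rate are both
  \<open>1 / (N * K)\<close> and cancel, leaving the transition law of the chain.\<close>

lemma nn_integral_smp:
  assumes z: "z \<in> state_set N" and h[measurable]: "h \<in> borel_measurable (state_space N)"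
  shows "(\<integral>\<^sup>+\<omega>. h (smp z \<omega>) \<partial>stream_space Q)
    = (\<integral>\<^sup>+t. (\<Sum>js\<in>JS. ennreal (wt z js t) * h (pos z js t)) \<partial>Ex)"
proof -
  note [measurable] = measurable_accQ[OF z] measurable_TQ[OF z]
  have "ennreal (1 / real (N * K)) * (\<integral>\<^sup>+\<omega>. h (smp z \<omega>) \<partial>stream_space Q)
      = (\<integral>\<^sup>+w. (if acc z w then h (T z w) else 0) \<partial>Q)"
    using z by (intro RS.nn_integral_sample) auto
  also have "\<dots> = ennreal (1 / real (N * K)) * (\<integral>\<^sup>+t. (\<Sum>js\<in>JS. \<integral>\<^sup>+u. (if acc z (js, t, u) then h (T z (js, t, u)) else 0) \<partial>Unif) \<partial>Ex)"
    by (rule nn_integral_Q) measurable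
  also have "(\<lambda>t. \<Sum>js\<in>JS. \<integral>\<^sup>+u. (if acc z (js, t, u) then h (T z (js, t, u)) else 0) \<partial>Unif)
      = (\<lambda>t. \<Sum>js\<in>JS. ennreal (wt z js t) * h (pos z js t))"
    unfolding acc_def T_def fst_conv snd_conv by (intro ext sum.cong refl integral_u_le[OF z])
  finally show ?thesis unfolding ennreal_cancel_NK .
qed

text \<open>The mean of \<open>c\<close> over the overlap of the two weight systems, that is, over
  proposals accepted by both states. Like \<open>gap\<close>, which is twice a total variation
  distance, it is written without the factor \<open>1 / (N * K)\<close>.\<close>

definition common :: "('y \<times> nat \<Rightarrow> 'y \<times> nat \<Rightarrow> ennreal) \<Rightarrow> 'y \<times> nat \<Rightarrow> 'y \<times> nat \<Rightarrow> ennreal" where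
  "common c z w = (\<integral>\<^sup>+t. (\<Sum>js\<in>JS. ennreal (min (wt z js t) (wt w js t)) * c (pos z js t) (pos w js t)) \<partial>Ex)"

definition gap :: "'y \<times> nat \<Rightarrow> 'y \<times> nat \<Rightarrow> ennreal" where
  "gap z w = (\<integral>\<^sup>+t. (\<Sum>js\<in>JS. ennreal \<bar>wt z js t - wt w js t\<bar>) \<partial>Ex)"

lemma nn_integral_both:
  assumes z: "z \<in> state_set N" and w: "w \<in> state_set N"
    and c: "(\<lambda>(z, w). c z w) \<in> borel_measurable (state_space N \<Otimes>\<^sub>M state_space N)"
  shows "(\<integral>\<^sup>+v. (if acc z v \<and> acc w v then c (T z v) (T w v) else 0) \<partial>Q)
    = ennreal (1 / real (N * K)) * common c z w"
proof -
  note [measurable] = measurable_accQ[OF z] measurable_accQ[OF w]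
  have [measurable]: "(\<lambda>v. c (T z v) (T w v)) \<in> borel_measurable Q"
    using measurable_compose[OF measurable_Pair[OF measurable_TQ[OF z] measurable_TQ[OF w]] c] by simp
  have "(\<integral>\<^sup>+v. (if acc z v \<and> acc w v then c (T z v) (T w v) else 0) \<partial>Q)
     = ennreal (1 / real (N * K)) * (\<integral>\<^sup>+t. (\<Sum>js\<in>JS. \<integral>\<^sup>+u. (if acc z (js, t, u) \<and> acc w (js, t, u) then c (T z (js, t, u)) (T w (js, t, u)) else 0) \<partial>Unif) \<partial>Ex)"
    by (rule nn_integral_Q) measurable
  also have "(\<lambda>t. \<Sum>js\<in>JS. \<integral>\<^sup>+u. (if acc z (js, t, u) \<and> acc w (js, t, u) then c (T z (js, t, u)) (T w (js, t, u)) else 0) \<partial>Unif)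
     = (\<lambda>t. \<Sum>js\<in>JS. ennreal (min (wt z js t) (wt w js t)) * c (pos z js t) (pos w js t))"
  proof (intro ext sum.cong refl)
    fix t js assume js: "js \<in> JS"
    have "(\<integral>\<^sup>+u. (if acc z (js, t, u) \<and> acc w (js, t, u) then c (T z (js, t, u)) (T w (js, t, u)) else 0) \<partial>Unif)
      = (\<integral>\<^sup>+u. (if u \<le> min (wt z js t) (wt w js t) then c (pos z js t) (pos w js t) else 0) \<partial>Unif)"
      by (intro nn_integral_cong) (simp add: acc_def T_def)
    also have "\<dots> = ennreal (min (wt z js t) (wt w js t)) * c (pos z js t) (pos w js t)"
      unfolding Unif_def using wt_bounds[OF z js, of t] wt_bounds[OF w js, of t] by (intro nn_integral_uniform_le) auto
    finally show "(\<integral>\<^sup>+u. (if acc z (js, t, u) \<and> acc w (js, t, u) then c (T z (js, t, u)) (T w (js, t, u)) else 0) \<partial>Unif)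
      = ennreal (min (wt z js t) (wt w js t)) * c (pos z js t) (pos w js t)" .
  qed
  finally show ?thesis unfolding common_def .
qed

lemma emeasure_xor:
  assumes z: "z \<in> state_set N" and w: "w \<in> state_set N"
  shows "emeasure Q {v\<in>space Q. acc z v \<noteq> acc w v} = ennreal (1 / real (N * K)) * gap z w"
proof -
  note [measurable] = measurable_accQ[OF z] measurable_accQ[OF w]
  have "emeasure Q {v\<in>space Q. acc z v \<noteq> acc w v} = (\<integral>\<^sup>+v. (if acc z v \<noteq> acc w v then 1 else 0) \<partial>Q)"
    by (rule emeasure_eq_nn_integral_if) measurable
  also have "\<dots> = ennreal (1 / real (N * K)) * (\<integral>\<^sup>+t. (\<Sum>js\<in>JS. \<integral>\<^sup>+u. (if acc z (js, t, u) \<noteq> acc w (js, t, u) then 1 else 0) \<partial>Unif) \<partial>Ex)"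
    by (rule nn_integral_Q) measurable
  also have "(\<lambda>t. \<Sum>js\<in>JS. \<integral>\<^sup>+u. (if acc z (js, t, u) \<noteq> acc w (js, t, u) then 1 else 0) \<partial>Unif)
      = (\<lambda>t. \<Sum>js\<in>JS. ennreal \<bar>wt z js t - wt w js t\<bar>)"
    unfolding Unif_def acc_def snd_conv fst_conv
    by (intro ext sum.cong refl nn_integral_uniform_neq wt_bounds z w)
  finally show ?thesis unfolding gap_def .
qed

lemma smp_pair:
  assumes z: "z \<in> state_set N" and w: "w \<in> state_set N"
    and c: "(\<lambda>(z, w). c z w) \<in> borel_measurable (state_space N \<Otimes>\<^sub>M state_space N)" and c1: "\<And>z w. c z w \<le> 1"
  shows "(\<integral>\<^sup>+\<omega>. c (smp z \<omega>) (smp w \<omega>) \<partial>stream_space Q) * emeasure Q {v\<in>space Q. acc z v \<or> acc w v}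
    \<le> ennreal (1 / real (N * K)) * (common c z w + gap z w)"
proof -
  have c1': "(case v of (z, w) \<Rightarrow> c z w) \<le> 1" for v by (simp add: case_prod_beta c1)
  have "z \<in> space (state_space N)" "w \<in> space (state_space N)" using z w by simp_all
  from RS.nn_integral_sample_pair[OF this c c1'] show ?thesis
    unfolding prod.case nn_integral_both[OF z w c] emeasure_xor[OF z w] distrib_left .
qed

text \<open>The normalising probability is at least that of acceptance by \<open>z\<close> alone.
  The bound is meant for close states with equal indices, where \<open>gap\<close> is small.\<close>

lemma smp_pair_le:
  assumes z: "z \<in> state_set N" and w: "w \<in> state_set N"
    and c: "(\<lambda>(z, w). c z w) \<in> borel_measurable (state_space N \<Otimes>\<^sub>M state_space N)" and c1: "\<And>z w. c z w \<le> 1"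
  shows "(\<integral>\<^sup>+\<omega>. c (smp z \<omega>) (smp w \<omega>) \<partial>stream_space Q) \<le> common c z w + gap z w" (is "?I \<le> _")
proof -
  note [measurable] = measurable_accQ[OF z] measurable_accQ[OF w]
  have "ennreal (1 / real (N * K)) * ?I \<le> ?I * emeasure Q {v\<in>space Q. acc z v \<or> acc w v}"
    unfolding emeasure_acc[OF z, symmetric] by (subst mult.commute, intro mult_left_mono emeasure_mono) auto
  also have "\<dots> \<le> ennreal (1 / real (N * K)) * (common c z w + gap z w)"
    by (rule smp_pair[OF z w c c1])
  finally show ?thesis unfolding ennreal_cancel_NK .
qed

lemma measurable_common:
  assumes z: "z \<in> state_set N" and w: "w \<in> state_set N"
    and c: "(\<lambda>(z, w). c z w) \<in> borel_measurable (state_space N \<Otimes>\<^sub>M state_space N)"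
  shows "(\<lambda>t. \<Sum>js\<in>JS. ennreal (min (wt z js t) (wt w js t)) * c (pos z js t) (pos w js t)) \<in> borel_measurable Ex"
proof (rule borel_measurable_sum)
  fix js assume js: "js \<in> JS"
  have wt: "(\<lambda>t. wt v js t) \<in> borel_measurable Ex" and pos: "(\<lambda>t. pos v js t) \<in> Ex \<rightarrow>\<^sub>M state_space N"
    if "v \<in> state_set N" for v
    using that js by (auto intro!: measurable_wt measurable_pos measurable_const measurable_ident_sets)
  have "(\<lambda>t. c (pos z js t) (pos w js t)) \<in> borel_measurable Ex"
    using measurable_compose[OF measurable_Pair[OF pos[OF z] pos[OF w]] c] by simp
  with wt[OF z] wt[OF w]
  show "(\<lambda>t. ennreal (min (wt z js t) (wt w js t)) * c (pos z js t) (pos w js t)) \<in> borel_measurable Ex"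
    by measurable
qed

text \<open>The complementary bound, for states whose weights may differ widely. It counts the gain
  \<open>1 - c\<close> on the overlap: the rescaled probability \<open>O'\<close> that at least one
  state accepts lies between 1 and 2, so a gain \<open>l\<close> lowers the mean cost by at least
  \<open>l / 2\<close>.\<close>

lemma smp_pair_overlap:
  assumes z: "z \<in> state_set N" and w: "w \<in> state_set N"
    and c: "(\<lambda>(z, w). c z w) \<in> borel_measurable (state_space N \<Otimes>\<^sub>M state_space N)"
    and c01: "\<And>z w. z \<in> state_set N \<Longrightarrow> w \<in> state_set N \<Longrightarrow> 0 \<le> c z w" "\<And>z w. c z w \<le> 1"
    and l: "ennreal l \<le> common (\<lambda>z w. ennreal (1 - c z w)) z w" and l0: "0 \<le> l"
  shows "(\<integral>\<^sup>+\<omega>. ennreal (c (smp z \<omega>) (smp w \<omega>)) \<partial>stream_space Q) \<le> ennreal (1 - l / 2)" (is "?I \<le> _")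
proof -
  note [measurable] = measurable_accQ[OF z] measurable_accQ[OF w]
  let ?\<theta> = "ennreal (1 / real (N * K))"
  have ce: "(\<lambda>(z, w). ennreal (c z w)) \<in> borel_measurable (state_space N \<Otimes>\<^sub>M state_space N)"
    "(\<lambda>(z, w). ennreal (1 - c z w)) \<in> borel_measurable (state_space N \<Otimes>\<^sub>M state_space N)"
    "(\<lambda>(z, w). 1::ennreal) \<in> borel_measurable ((state_space N :: ('y \<times> nat) measure) \<Otimes>\<^sub>M (state_space N :: ('y \<times> nat) measure))"
    using c unfolding case_prod_beta' by measurable
  have posin: "pos v js t \<in> state_set N" if "js \<in> JS" for v js t using JS_D[OF that] by (simp add: pos_def)
  have c_sum: "common (\<lambda>z w. ennreal (c z w)) z w + common (\<lambda>z w. ennreal (1 - c z w)) z w = common (\<lambda>_ _. 1) z w"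
    unfolding common_def
    by (subst nn_integral_add[symmetric, OF measurable_common[OF z w ce(1)] measurable_common[OF z w ce(2)]])
      (auto intro!: nn_integral_cong sum.cong simp: sum.distrib[symmetric] distrib_left[symmetric] ennreal_plus[symmetric] c01 posin
        simp del: ennreal_plus mem_state_set)
  define O' where "O' = common (\<lambda>_ _. 1) z w + gap z w"
  have or_eq: "emeasure Q {v\<in>space Q. acc z v \<or> acc w v} = ?\<theta> * O'"
  proof -
    have "emeasure Q {v\<in>space Q. acc z v \<or> acc w v}
        = emeasure Q ({v\<in>space Q. acc z v \<and> acc w v} \<union> {v\<in>space Q. acc z v \<noteq> acc w v})"
      by (intro arg_cong[where f="emeasure Q"]) auto
    also have "\<dots> = emeasure Q {v\<in>space Q. acc z v \<and> acc w v} + emeasure Q {v\<in>space Q. acc z v \<noteq> acc w v}"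
      by (subst plus_emeasure) auto
    also have "emeasure Q {v\<in>space Q. acc z v \<and> acc w v} = (\<integral>\<^sup>+v. (if acc z v \<and> acc w v then 1 else 0) \<partial>Q)"
      by (rule emeasure_eq_nn_integral_if) measurable
    also have "\<dots> = ?\<theta> * common (\<lambda>_ _. 1) z w"
      by (rule nn_integral_both[OF z w ce(3)])
    finally show ?thesis unfolding O'_def emeasure_xor[OF z w] distrib_left .
  qed
  have O_ge: "1 \<le> O'"
  proof -
    have "?\<theta> \<le> emeasure Q {v\<in>space Q. acc z v \<or> acc w v}"
      unfolding emeasure_acc[OF z, symmetric] by (intro emeasure_mono) auto
    then have "?\<theta> * 1 \<le> ?\<theta> * O'" unfolding or_eq by simp
    then show ?thesis unfolding ennreal_cancel_NK .
  qed
  have O_le: "O' \<le> 2"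
  proof -
    have "?\<theta> * O' \<le> emeasure Q {v\<in>space Q. acc z v} + emeasure Q {v\<in>space Q. acc w v}"
      unfolding or_eq[symmetric]
      by (rule order_trans[OF emeasure_mono emeasure_subadditive]) auto
    also have "\<dots> = ?\<theta> * 2" unfolding emeasure_acc[OF z] emeasure_acc[OF w] by (simp add: mult_2_right)
    finally show ?thesis unfolding ennreal_cancel_NK .
  qed
  have "?\<theta> * (?I * O') \<le> ?\<theta> * (common (\<lambda>z w. ennreal (c z w)) z w + gap z w)"
    using smp_pair[OF z w ce(1)] c01(2) by (simp add: or_eq mult_ac)
  then have "?I * O' \<le> common (\<lambda>z w. ennreal (c z w)) z w + gap z w" unfolding ennreal_cancel_NK .
  then have "?I * O' + ennreal l \<le> common (\<lambda>z w. ennreal (c z w)) z w + gap z w + common (\<lambda>z w. ennreal (1 - c z w)) z w"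
    by (intro add_mono l)
  also have "\<dots> = O'" unfolding O'_def c_sum[symmetric] by (simp add: add_ac)
  finally have main: "?I * O' + ennreal l \<le> O'" .
  obtain o' where o': "O' = ennreal o'" "1 \<le> o'" "o' \<le> 2"
  proof -
    have "O' < top" by (rule le_less_trans[OF O_le]) simp
    then obtain x where x: "O' = ennreal x" "0 \<le> x" by (cases O') auto
    have "1 \<le> x" using O_ge x by (simp add: ennreal_1[symmetric] del: ennreal_1)
    moreover have "x \<le> 2" using O_le x by (simp add: ennreal_numeral[symmetric] del: ennreal_numeral)
    ultimately show ?thesis using that x by blast
  qed
  have "?I \<le> 1"
  proof -
    interpret prob_space "stream_space Q" by (rule RS.prob_space_stream_space)
    have "?I \<le> (\<integral>\<^sup>+\<omega>. 1 \<partial>stream_space Q)" using c01(2) by (intro nn_integral_mono) simp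
    then show ?thesis by (simp add: emeasure_space_1)
  qed
  then obtain i where i: "?I = ennreal i" "0 \<le> i" "i \<le> 1"
    by (cases ?I) (auto simp: top_unique)
  have "i * o' + l \<le> o'"
    using main i o' l0 by (simp add: ennreal_mult[symmetric] ennreal_plus[symmetric] del: ennreal_plus)
  then have "l \<le> (1 - i) * o'" by (simp add: algebra_simps)
  also have "\<dots> \<le> (1 - i) * 2" using i o' by (intro mult_left_mono) auto
  finally show ?thesis unfolding i(1) by (intro ennreal_leI) simp
qed

end

section \<open>Drift and overlap\<close>

locale contractive_jump_process = jump_process N K lam \<Phi> q pb p Lp Lpb
  for N K lam and \<Phi> :: "nat \<Rightarrow> real \<Rightarrow> 'y::polish_space \<Rightarrow> 'y" and q pb p Lp Lpb +
  fixes xs :: 'y and L \<alpha> Lq p0 q0 :: real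
  assumes moment: "\<And>j s. j \<in> {1..N} \<Longrightarrow> s \<in> {1..K} \<Longrightarrow>
      (\<integral>\<^sup>+ t\<in>{0..}. ennreal (exp (- (lam * t)) * dist (q s (\<Phi> j t xs)) (q s xs)) \<partial>lborel) < \<infinity>"
    and L: "L \<ge> 1" and Lq: "Lq > 0"
    and flow_contraction: "\<And>x y i t. i \<in> {1..N} \<Longrightarrow> t \<ge> 0 \<Longrightarrow>
      (\<Sum>j\<in>{1..N}. p i j y * dist (\<Phi> j t x) (\<Phi> j t y)) \<le> L * exp (\<alpha> * t) * dist x y"
    and jump_contraction: "\<And>x y. (\<Sum>s\<in>{1..K}. pb s x * dist (q s x) (q s y)) \<le> Lq * dist x y"
    and p0: "p0 > 0" and q0: "q0 > 0"
    and flow_overlap: "\<And>i1 i2 x y t. i1 \<in> {1..N} \<Longrightarrow> i2 \<in> {1..N} \<Longrightarrow> t \<ge> 0 \<Longrightarrow>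
      (\<Sum>j\<in>{j \<in> {1..N}. dist (\<Phi> j t x) (\<Phi> j t y) \<le> L * exp (\<alpha> * t) * dist x y}.
         p i1 j x * p i2 j y) > p0"
    and jump_overlap: "\<And>x y.
      (\<Sum>s\<in>{s \<in> {1..K}. dist (q s x) (q s y) \<le> Lq * dist x y}. pb s x * pb s y) > q0"
    and rate: "L * Lq + \<alpha> / lam < 1"
begin

definition ex :: "real \<Rightarrow> real" where "ex t = exp (\<alpha> * max 0 t)"

definition h :: "real \<Rightarrow> real" where "h t = L * Lq * ex t"

text \<open>The mean of \<open>h\<close> under the exponential waiting time, hence the mean
  contraction factor of one step.\<close>

definition a :: real where "a = L * Lq * (lam / (lam - \<alpha>))"

text \<open>As \<open>L * Lq\<close> is positive, the rate condition forces
  \<open>\<alpha> < lam\<close>, so that the mean of \<open>h\<close> is finite; multiplied by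
  \<open>lam\<close> it says \<open>a < 1\<close>.\<close>

lemma alpha_less: "\<alpha> < lam" and a_bounds: "0 < a" "a < 1" and LLq: "0 < L * Lq"
proof -
  show LLq: "0 < L * Lq" using L Lq by simp
  then have "\<alpha> / lam < 1" using rate by linarith
  then show "\<alpha> < lam" using lam by simp
  then show "0 < a" using LLq lam by (simp add: a_def)
  have "L * Lq * lam + \<alpha> < lam" using rate lam by (simp add: field_simps)
  then show "a < 1" using \<open>\<alpha> < lam\<close> by (simp add: a_def field_simps)
qed

lemma ex_pos: "0 < ex t" by (simp add: ex_def)

lemma h_pos: "0 < h t" using LLq ex_pos by (simp add: h_def)

lemma measurable_ex [measurable]: "ex \<in> borel_measurable borel" unfolding ex_def by measurable

lemma nn_integral_ex: "(\<integral>\<^sup>+t. ennreal (c * ex t) \<partial>Ex) = ennreal (c * (lam / (lam - \<alpha>)))" if "0 \<le> c"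
proof -
  have "(\<integral>\<^sup>+t. ennreal (c * ex t) \<partial>Ex) = (\<integral>\<^sup>+t. ennreal c * ennreal (ex t) \<partial>Ex)"
    using that ex_pos by (intro nn_integral_cong) (simp add: ennreal_mult less_imp_le)
  also have "\<dots> = ennreal c * (\<integral>\<^sup>+t. ennreal (ex t) \<partial>Ex)" by (rule nn_integral_cmult) measurable
  also have "(\<integral>\<^sup>+t. ennreal (ex t) \<partial>Ex) = ennreal (lam / (lam - \<alpha>))"
    unfolding ex_def Ex_def by (rule nn_integral_exponential_exp[OF lam alpha_less])
  finally show ?thesis using that lam alpha_less by (simp add: ennreal_mult[symmetric])
qed

lemma nn_integral_h: "(\<integral>\<^sup>+t. ennreal (c * h t) \<partial>Ex) = ennreal (c * a)" if "0 \<le> c"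
  using nn_integral_ex[OF mult_nonneg_nonneg[OF that less_imp_le[OF LLq]]] by (simp add: h_def a_def mult_ac)

lemma measurable_h [measurable]: "h \<in> borel_measurable borel" unfolding h_def by measurable

text \<open>The flow condition carries the weights of the second point, the jump condition those of
  the first; symmetry of the distance makes them match.\<close>

lemma flow_contraction':
  "i \<in> {1..N} \<Longrightarrow> (\<Sum>j\<in>{1..N}. p i j x * dist (Phi j t x) (Phi j t y)) \<le> L * ex t * dist x y"
  using flow_contraction[of i "max 0 t" x y] unfolding Phi_def ex_def by (simp add: dist_commute)

text \<open>Both averaged bounds use the weights of \<open>z\<close> alone, so they compose: the
  jump bound inside, the flow bound outside. The index of \<open>w\<close> is free, and
  \<open>w\<close> may later be a reference state.\<close>

lemma sum_wt_dist_le: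
  assumes z: "z \<in> state_set N"
  shows "(\<Sum>js\<in>JS. wt z js t * dist (fst (pos z js t)) (fst (pos w js t))) \<le> h t * dist (fst z) (fst w)"
proof -
  let ?x = "fst z" and ?y = "fst w"
  have "(\<Sum>js\<in>JS. wt z js t * dist (fst (pos z js t)) (fst (pos w js t)))
      = (\<Sum>j\<in>{1..N}. \<Sum>s\<in>{1..K}. p (snd z) j ?x * (pb s (Phi j t ?x) * dist (q s (Phi j t ?x)) (q s (Phi j t ?y))))"
    unfolding sum_JS[symmetric, of "\<lambda>j s. p (snd z) j ?x * (pb s (Phi j t ?x) * dist (q s (Phi j t ?x)) (q s (Phi j t ?y)))"]
    by (simp add: wt_def pos_def mult_ac)
  also have "\<dots> \<le> (\<Sum>j\<in>{1..N}. p (snd z) j ?x * (Lq * dist (Phi j t ?x) (Phi j t ?y)))"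
    unfolding sum_distrib_left[symmetric]
    using z by (intro sum_mono mult_left_mono jump_contraction p_bounds(1)) (simp_all only: mem_state_set)
  also have "\<dots> = Lq * (\<Sum>j\<in>{1..N}. p (snd z) j ?x * dist (Phi j t ?x) (Phi j t ?y))"
    by (simp add: sum_distrib_left mult_ac)
  also have "\<dots> \<le> Lq * (L * ex t * dist ?x ?y)"
    using z Lq by (intro mult_left_mono flow_contraction') (simp_all only: mem_state_set)
  finally show ?thesis by (simp add: h_def mult_ac)
qed

text \<open>The difference of products is split so that one factor of each term is a probability.
  Equal indices are essential: rows of the matrix for different indices need not be close.\<close>

lemma sum_gap_le:
  assumes z: "z \<in> state_set N" and zw: "snd z = snd w"
  shows "(\<Sum>js\<in>JS. \<bar>wt z js t - wt w js t\<bar>) \<le> (Lp + Lpb * L * ex t) * dist (fst z) (fst w)"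
proof -
  let ?x = "fst z" and ?y = "fst w" and ?i = "snd z"
  have i: "?i \<in> {1..N}" using z by (simp only: mem_state_set)
  have "(\<Sum>js\<in>JS. \<bar>wt z js t - wt w js t\<bar>)
      = (\<Sum>j\<in>{1..N}. \<Sum>s\<in>{1..K}. \<bar>p ?i j ?x * pb s (Phi j t ?x) - p ?i j ?y * pb s (Phi j t ?y)\<bar>)"
    unfolding sum_JS[symmetric, of "\<lambda>j s. \<bar>p ?i j ?x * pb s (Phi j t ?x) - p ?i j ?y * pb s (Phi j t ?y)\<bar>"]
    by (simp add: wt_def zw)
  also have "\<dots> \<le> (\<Sum>j\<in>{1..N}. \<Sum>s\<in>{1..K}. p ?i j ?x * \<bar>pb s (Phi j t ?x) - pb s (Phi j t ?y)\<bar>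
      + \<bar>p ?i j ?x - p ?i j ?y\<bar> * pb s (Phi j t ?y))"
  proof (intro sum_mono)
    fix j s assume j: "j \<in> {1..N}" and s: "s \<in> {1..K}"
    have "p ?i j ?x * pb s (Phi j t ?x) - p ?i j ?y * pb s (Phi j t ?y)
      = p ?i j ?x * (pb s (Phi j t ?x) - pb s (Phi j t ?y)) + (p ?i j ?x - p ?i j ?y) * pb s (Phi j t ?y)"
      by (simp add: algebra_simps)
    also have "\<bar>\<dots>\<bar> \<le> \<bar>p ?i j ?x * (pb s (Phi j t ?x) - pb s (Phi j t ?y))\<bar> + \<bar>(p ?i j ?x - p ?i j ?y) * pb s (Phi j t ?y)\<bar>"
      by (rule abs_triangle_ineq)
    finally show "\<bar>p ?i j ?x * pb s (Phi j t ?x) - p ?i j ?y * pb s (Phi j t ?y)\<bar>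
      \<le> p ?i j ?x * \<bar>pb s (Phi j t ?x) - pb s (Phi j t ?y)\<bar> + \<bar>p ?i j ?x - p ?i j ?y\<bar> * pb s (Phi j t ?y)"
      using p_bounds(1)[OF i j] pb_bounds(1)[OF s] by (simp add: abs_mult)
  qed
  also have "\<dots> = (\<Sum>j\<in>{1..N}. p ?i j ?x * (\<Sum>s\<in>{1..K}. \<bar>pb s (Phi j t ?x) - pb s (Phi j t ?y)\<bar>))
      + (\<Sum>j\<in>{1..N}. \<bar>p ?i j ?x - p ?i j ?y\<bar>)"
    unfolding sum.distrib sum_distrib_left[symmetric] pb_bounds(3) by simp
  also have "\<dots> \<le> (\<Sum>j\<in>{1..N}. p ?i j ?x * (Lpb * dist (Phi j t ?x) (Phi j t ?y))) + Lp * dist ?x ?y"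
    by (intro add_mono sum_mono mult_left_mono lipschitz_pb lipschitz_p p_bounds(1) i)
  also have "(\<Sum>j\<in>{1..N}. p ?i j ?x * (Lpb * dist (Phi j t ?x) (Phi j t ?y)))
      = Lpb * (\<Sum>j\<in>{1..N}. p ?i j ?x * dist (Phi j t ?x) (Phi j t ?y))"
    by (simp add: sum_distrib_left mult_ac)
  also have "\<dots> \<le> Lpb * (L * ex t * dist ?x ?y)"
    using Lpb by (intro mult_left_mono flow_contraction' i) simp
  finally show ?thesis by (simp add: algebra_simps)
qed

text \<open>Pairs whose flow and jump both contract have product weight above
  \<open>p0 * q0\<close>, for any two current indices, and on them the new distance is at most
  \<open>h t\<close> times the old. A product of two numbers in the unit interval lies below their
  minimum, which leads from product weights to the overlap of the sampler.\<close>

lemma sum_overlap_ge: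
  assumes z: "z \<in> state_set N" and w: "w \<in> state_set N"
    and g: "mono g" "\<And>D. g D \<le> 1"
  shows "p0 * q0 * (1 - g (h t * dist (fst z) (fst w)))
    \<le> (\<Sum>js\<in>JS. min (wt z js t) (wt w js t) * (1 - g (dist (fst (pos z js t)) (fst (pos w js t)))))"
proof -
  let ?x = "fst z" and ?y = "fst w" and ?i = "snd z" and ?k = "snd w"
  let ?D = "dist ?x ?y"
  let ?G = "1 - g (h t * ?D)"
  have i: "?i \<in> {1..N}" "?k \<in> {1..N}" using z w by (simp_all only: mem_state_set)
  have G0: "0 \<le> ?G" using g(2) by simp
  define I where "I = {j\<in>{1..N}. dist (Phi j t ?x) (Phi j t ?y) \<le> L * ex t * ?D}"
  define J where "J j = {s\<in>{1..K}. dist (q s (Phi j t ?x)) (q s (Phi j t ?y)) \<le> Lq * dist (Phi j t ?x) (Phi j t ?y)}" for j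
  have pI: "p0 < (\<Sum>j\<in>I. p ?i j ?x * p ?k j ?y)"
    using flow_overlap[OF i, of "max 0 t" ?x ?y] unfolding I_def Phi_def ex_def by simp
  have "p0 * q0 * ?G \<le> (\<Sum>j\<in>I. p ?i j ?x * p ?k j ?y) * (q0 * ?G)"
    using pI q0 G0 by (subst mult.assoc, intro mult_right_mono) auto
  also have "\<dots> = (\<Sum>j\<in>I. p ?i j ?x * p ?k j ?y * (q0 * ?G))" by (rule sum_distrib_right)
  also have "\<dots> \<le> (\<Sum>j\<in>I. p ?i j ?x * p ?k j ?y * (\<Sum>s\<in>J j. pb s (Phi j t ?x) * pb s (Phi j t ?y) * ?G))"
  proof (intro sum_mono mult_left_mono)
    fix j assume "j \<in> I"
    then have j: "j \<in> {1..N}" by (simp only: I_def mem_Collect_eq)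
    show "0 \<le> p ?i j ?x * p ?k j ?y" by (intro mult_nonneg_nonneg p_bounds(1) i j)
    show "q0 * ?G \<le> (\<Sum>s\<in>J j. pb s (Phi j t ?x) * pb s (Phi j t ?y) * ?G)"
      unfolding sum_distrib_right[symmetric] J_def
      using jump_overlap[of "Phi j t ?x" "Phi j t ?y"] G0 by (intro mult_right_mono) auto
  qed
  also have "\<dots> \<le> (\<Sum>j\<in>I. \<Sum>s\<in>J j. p ?i j ?x * p ?k j ?y * (pb s (Phi j t ?x) * pb s (Phi j t ?y)
      * (1 - g (dist (q s (Phi j t ?x)) (q s (Phi j t ?y))))))"
    unfolding sum_distrib_left
  proof (intro sum_mono mult_left_mono)
    fix j s assume jI: "j \<in> I" and sJ: "s \<in> J j"
    have j: "j \<in> {1..N}" using jI by (simp only: I_def mem_Collect_eq)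
    have s: "s \<in> {1..K}" using sJ by (simp only: J_def mem_Collect_eq)
    show "0 \<le> p ?i j ?x * p ?k j ?y" by (intro mult_nonneg_nonneg p_bounds(1) i j)
    show "0 \<le> pb s (Phi j t ?x) * pb s (Phi j t ?y)" by (intro mult_nonneg_nonneg pb_bounds(1) s)
    have "dist (q s (Phi j t ?x)) (q s (Phi j t ?y)) \<le> Lq * (L * ex t * ?D)"
    proof -
      have "dist (q s (Phi j t ?x)) (q s (Phi j t ?y)) \<le> Lq * dist (Phi j t ?x) (Phi j t ?y)"
        using sJ by (simp only: J_def mem_Collect_eq)
      also have "\<dots> \<le> Lq * (L * ex t * ?D)"
        using jI Lq by (intro mult_left_mono) (simp_all only: I_def mem_Collect_eq less_imp_le)
      finally show ?thesis .
    qed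
    then have "dist (q s (Phi j t ?x)) (q s (Phi j t ?y)) \<le> h t * ?D" by (simp add: h_def mult_ac)
    then show "?G \<le> 1 - g (dist (q s (Phi j t ?x)) (q s (Phi j t ?y)))" using monoD[OF g(1)] by simp
  qed
  \<comment> \<open>The index sets may be enlarged because \<open>g \<le> 1\<close> keeps every
    summand nonnegative.\<close>
  also have "\<dots> \<le> (\<Sum>j\<in>{1..N}. \<Sum>s\<in>{1..K}. p ?i j ?x * p ?k j ?y * (pb s (Phi j t ?x) * pb s (Phi j t ?y)
      * (1 - g (dist (q s (Phi j t ?x)) (q s (Phi j t ?y))))))"
  proof (rule order_trans[OF sum_mono[of I, OF sum_mono2] sum_mono2])
    show "0 \<le> p ?i j ?x * p ?k j ?y * (pb s (Phi j t ?x) * pb s (Phi j t ?y) * (1 - g (dist (q s (Phi j t ?x)) (q s (Phi j t ?y)))))"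
      if "j \<in> I" "s \<in> {1..K} - J j" for j s
      using that g(2) p_bounds(1)[OF i(1), of j] p_bounds(1)[OF i(2), of j] pb_bounds(1)[of s]
      by (intro mult_nonneg_nonneg) (auto simp: I_def)
    show "0 \<le> (\<Sum>s\<in>{1..K}. p ?i j ?x * p ?k j ?y * (pb s (Phi j t ?x) * pb s (Phi j t ?y) * (1 - g (dist (q s (Phi j t ?x)) (q s (Phi j t ?y))))))"
      if "j \<in> {1..N} - I" for j
      using that g(2) p_bounds(1)[OF i(1), of j] p_bounds(1)[OF i(2), of j] pb_bounds(1)
      by (intro sum_nonneg mult_nonneg_nonneg) auto
  qed (auto simp: I_def J_def)
  also have "\<dots> = (\<Sum>js\<in>JS. wt z js t * wt w js t * (1 - g (dist (fst (pos z js t)) (fst (pos w js t)))))"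
    unfolding sum_JS[symmetric, of "\<lambda>j s. p ?i j ?x * p ?k j ?y * (pb s (Phi j t ?x) * pb s (Phi j t ?y)
      * (1 - g (dist (q s (Phi j t ?x)) (q s (Phi j t ?y)))))"]
    by (simp add: wt_def pos_def mult_ac)
  also have "\<dots> \<le> (\<Sum>js\<in>JS. min (wt z js t) (wt w js t) * (1 - g (dist (fst (pos z js t)) (fst (pos w js t)))))"
  proof (intro sum_mono mult_right_mono)
    fix js assume js: "js \<in> JS"
    note b = wt_bounds[OF z js, of t] wt_bounds[OF w js, of t]
    show "wt z js t * wt w js t \<le> min (wt z js t) (wt w js t)"
      using mult_left_mono[OF b(4) b(1)] mult_right_mono[OF b(2) b(3)] by simp
  qed (use g(2) in simp)
  finally show ?thesis .
qed

text \<open>A bound for the one-step displacement of \<open>xs\<close> along every pair of indices,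
  split at \<open>q s xs\<close> as in the moment condition. A plain sum replaces the weighted mean,
  since weights are at most 1.\<close>

definition b0 :: "real \<Rightarrow> real" where
  "b0 t = (\<Sum>js\<in>JS. dist (q (snd js) (Phi (fst js) t xs)) (q (snd js) xs) + dist (q (snd js) xs) xs)"

definition b :: real where "b = enn2real (\<integral>\<^sup>+t. ennreal (b0 t) \<partial>Ex)"

lemma b0_nonneg: "0 \<le> b0 t" by (simp add: b0_def sum_nonneg)

lemma measurable_dist_q: "js \<in> JS \<Longrightarrow> (\<lambda>t. dist (q (snd js) (Phi (fst js) t xs)) y) \<in> borel_measurable borel"
  using JS_D[of js] by (intro borel_measurable_dist measurable_compose[OF _ measurable_q] measurable_Phi) auto

lemma measurable_b0 [measurable]: "b0 \<in> borel_measurable borel"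
  unfolding b0_def using measurable_dist_q by (intro borel_measurable_sum borel_measurable_add) auto

text \<open>The moment condition makes the integral finite, so \<open>enn2real\<close> in
  \<open>b\<close> loses nothing.\<close>

lemma nn_integral_b0: "(\<integral>\<^sup>+t. ennreal (b0 t) \<partial>Ex) = ennreal b"
proof -
  have "(\<integral>\<^sup>+t. ennreal (b0 t) \<partial>Ex)
      = (\<integral>\<^sup>+t. (\<Sum>js\<in>JS. ennreal (dist (q (snd js) (Phi (fst js) t xs)) (q (snd js) xs)) + ennreal (dist (q (snd js) xs) xs)) \<partial>Ex)"
    unfolding b0_def by (intro nn_integral_cong) (simp add: sum_ennreal[symmetric] del: sum_ennreal)
  also have "\<dots> = (\<Sum>js\<in>JS. (\<integral>\<^sup>+t. ennreal (dist (q (snd js) (Phi (fst js) t xs)) (q (snd js) xs)) \<partial>Ex) + ennreal (dist (q (snd js) xs) xs))"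
    using measurable_dist_q Ex.emeasure_space_1
    by (subst nn_integral_sum) (auto intro!: sum.cong simp: nn_integral_add)
  also have "\<dots> < \<infinity>"
    unfolding infinity_ennreal_def
  proof (subst ennreal_sum_less_top[OF finite_JS], intro ballI)
    fix js assume js: "js \<in> JS"
    let ?d = "\<lambda>t. dist (q (snd js) (\<Phi> (fst js) t xs)) (q (snd js) xs)"
    have "(\<integral>\<^sup>+t. ennreal (dist (q (snd js) (Phi (fst js) t xs)) (q (snd js) xs)) \<partial>Ex)
       = (\<integral>\<^sup>+t. ennreal (exponential_density lam t) * ennreal (dist (q (snd js) (Phi (fst js) t xs)) (q (snd js) xs)) \<partial>lborel)"
      unfolding Ex_def using measurable_dist_q[OF js] by (subst nn_integral_density) auto
    also have "\<dots> = (\<integral>\<^sup>+t. ennreal lam * (ennreal (exp (- (lam * t)) * dist (q (snd js) (Phi (fst js) t xs)) (q (snd js) xs)) * indicator {0..} t) \<partial>lborel)"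
      using lam by (intro nn_integral_cong) (auto simp: exponential_density_def ennreal_mult[symmetric] mult_ac split: split_indicator)
    also have "\<dots> = ennreal lam * (\<integral>\<^sup>+t. ennreal (exp (- (lam * t)) * dist (q (snd js) (Phi (fst js) t xs)) (q (snd js) xs)) * indicator {0..} t \<partial>lborel)"
      using measurable_dist_q[OF js] by (intro nn_integral_cmult) auto
    also have "(\<integral>\<^sup>+t. ennreal (exp (- (lam * t)) * dist (q (snd js) (Phi (fst js) t xs)) (q (snd js) xs)) * indicator {0..} t \<partial>lborel)
        = (\<integral>\<^sup>+t\<in>{0..}. ennreal (exp (- (lam * t)) * ?d t) \<partial>lborel)"
      by (intro nn_integral_cong) (auto simp: Phi_def max_def split: split_indicator)
    also have "ennreal lam * \<dots> < top"
      using moment[OF JS_D[OF js]] by (intro ennreal_mult_less_top[THEN iffD2]) auto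
    finally show "(\<integral>\<^sup>+t. ennreal (dist (q (snd js) (Phi (fst js) t xs)) (q (snd js) xs)) \<partial>Ex) + ennreal (dist (q (snd js) xs) xs) < top"
      by simp
  qed
  finally show ?thesis unfolding b_def by (simp add: less_top)
qed

lemma b_nonneg: "0 \<le> b" by (simp add: b_def)

text \<open>The image of \<open>z\<close> is compared with the image of \<open>xs\<close> under the
  same proposal, and the latter with \<open>xs\<close>.\<close>

lemma sum_drift_le:
  assumes z: "z \<in> state_set N"
  shows "(\<Sum>js\<in>JS. wt z js t * dist (fst (pos z js t)) xs) \<le> h t * dist (fst z) xs + b0 t"
proof -
  have "(\<Sum>js\<in>JS. wt z js t * dist (fst (pos z js t)) xs)
      \<le> (\<Sum>js\<in>JS. wt z js t * dist (fst (pos z js t)) (fst (pos (xs, 1) js t))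
          + (dist (q (snd js) (Phi (fst js) t xs)) (q (snd js) xs) + dist (q (snd js) xs) xs))"
  proof (rule sum_mono)
    fix js assume js: "js \<in> JS"
    note w = wt_bounds[OF z js, of t]
    have "dist (fst (pos z js t)) xs \<le> dist (fst (pos z js t)) (fst (pos (xs, 1) js t)) + dist (fst (pos (xs, 1) js t)) xs"
      by (rule dist_triangle)
    also have "dist (fst (pos (xs, 1) js t)) xs \<le> dist (q (snd js) (Phi (fst js) t xs)) (q (snd js) xs) + dist (q (snd js) xs) xs"
      unfolding pos_def fst_conv by (rule dist_triangle)
    finally have "wt z js t * dist (fst (pos z js t)) xs
      \<le> wt z js t * (dist (fst (pos z js t)) (fst (pos (xs, 1) js t))
        + (dist (q (snd js) (Phi (fst js) t xs)) (q (snd js) xs) + dist (q (snd js) xs) xs))"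
      using w by (intro mult_left_mono) auto
    also have "\<dots> \<le> wt z js t * dist (fst (pos z js t)) (fst (pos (xs, 1) js t))
        + 1 * (dist (q (snd js) (Phi (fst js) t xs)) (q (snd js) xs) + dist (q (snd js) xs) xs)"
      unfolding distrib_left[of "wt z js t"] using w by (intro add_left_mono mult_right_mono[of _ 1] order_refl) (auto simp: distrib_left[symmetric] mult_left_le_one_le)
    finally show "wt z js t * dist (fst (pos z js t)) xs \<le> wt z js t * dist (fst (pos z js t)) (fst (pos (xs, 1) js t))
          + (dist (q (snd js) (Phi (fst js) t xs)) (q (snd js) xs) + dist (q (snd js) xs) xs)" by simp
  qed
  also have "\<dots> \<le> h t * dist (fst z) xs + b0 t"
    using sum_wt_dist_le[OF z, of t "(xs, 1)"] unfolding sum.distrib b0_def by simp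
  finally show ?thesis .
qed

lemma smp_drift:
  assumes z: "z \<in> state_set N"
  shows "(\<integral>\<^sup>+\<omega>. ennreal (dist (fst (smp z \<omega>)) xs) \<partial>stream_space Q) \<le> ennreal (a * dist (fst z) xs + b)"
proof -
  have "(\<integral>\<^sup>+\<omega>. ennreal (dist (fst (smp z \<omega>)) xs) \<partial>stream_space Q)
      = (\<integral>\<^sup>+t. (\<Sum>js\<in>JS. ennreal (wt z js t) * ennreal (dist (fst (pos z js t)) xs)) \<partial>Ex)"
    by (rule nn_integral_smp[OF z]) measurable
  also have "\<dots> = (\<integral>\<^sup>+t. ennreal (\<Sum>js\<in>JS. wt z js t * dist (fst (pos z js t)) xs) \<partial>Ex)"
    using wt_bounds[OF z]
    by (intro nn_integral_cong) (simp add: sum_ennreal[symmetric] ennreal_mult[symmetric] del: sum_ennreal)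
  also have "\<dots> \<le> (\<integral>\<^sup>+t. ennreal (dist (fst z) xs * h t) + ennreal (b0 t) \<partial>Ex)"
    using sum_drift_le[OF z] h_pos b0_nonneg
    by (intro nn_integral_mono) (simp add: ennreal_plus[symmetric] ennreal_leI mult.commute less_imp_le del: ennreal_plus)
  also have "\<dots> = ennreal (dist (fst z) xs * a) + ennreal b"
    by (subst nn_integral_add) (auto simp: nn_integral_h nn_integral_b0)
  finally show ?thesis using a_bounds b_nonneg by (simp add: ennreal_plus[symmetric] mult.commute del: ennreal_plus)
qed

end

section \<open>Contraction in mean\<close>

lemma ennreal_power2_le_imp_le:
  assumes "X ^ 2 \<le> ennreal (y ^ 2)" "0 \<le> y"
  shows "X \<le> ennreal y"
proof (cases X)
  case (real x)
  then have "x ^ 2 \<le> y ^ 2" using assms by (simp add: ennreal_power)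
  then have "x \<le> y" using assms(2) by (rule power2_le_imp_le)
  then show ?thesis using real by (simp add: ennreal_leI)
next
  case top
  then show ?thesis using assms by (simp add: power2_eq_square ennreal_top_mult top_unique)
qed

context contractive_jump_process
begin

definition c0 :: "(real \<Rightarrow> real) \<Rightarrow> 'y \<times> nat \<Rightarrow> 'y \<times> nat \<Rightarrow> real" where
  "c0 g z w = (if snd z = snd w then g (dist (fst z) (fst w)) else 1)"

lemma measurable_c0:
  assumes [measurable]: "g \<in> borel_measurable borel"
  shows "(\<lambda>(z, w). c0 g z w) \<in> borel_measurable (state_space N \<Otimes>\<^sub>M (state_space N :: ('y \<times> nat) measure))"
proof -
  let ?S = "state_space N :: ('y \<times> nat) measure"
  have m: "(\<lambda>p. fst (fst p)) \<in> borel_measurable (?S \<Otimes>\<^sub>M ?S)" "(\<lambda>p. fst (snd p)) \<in> borel_measurable (?S \<Otimes>\<^sub>M ?S)"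
    "(\<lambda>p. snd (fst p)) \<in> ?S \<Otimes>\<^sub>M ?S \<rightarrow>\<^sub>M count_space UNIV" "(\<lambda>p. snd (snd p)) \<in> ?S \<Otimes>\<^sub>M ?S \<rightarrow>\<^sub>M count_space UNIV"
    by (rule measurable_fst_state' measurable_snd_state' measurable_fst measurable_snd)+
  have "(\<lambda>p. g (dist (fst (fst p)) (fst (snd p)))) \<in> borel_measurable (?S \<Otimes>\<^sub>M ?S)"
    by (rule measurable_compose[OF borel_measurable_dist[OF m(1,2)]]) fact
  moreover have "Measurable.pred (?S \<Otimes>\<^sub>M ?S) (\<lambda>p. snd (fst p) = snd (snd p))"
    by (rule measurable_compose_countable[where f="\<lambda>i p. i = snd (snd p)", OF _ m(3)]) (use m(4) in measurable)
  ultimately show ?thesis unfolding c0_def case_prod_beta by measurable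
qed

text \<open>On common proposals the new indices agree, so the cost is at most
  \<open>\<sigma>\<close> times a distance whose mean contracts by \<open>a\<close>; on the others
  it is at most 1, and their mass is of the order of the distance.\<close>

lemma nn_integral_c0_near:
  assumes z: "z \<in> state_set N" and w: "w \<in> state_set N" and zw: "snd z = snd w"
    and g: "g \<in> borel_measurable borel" "\<And>D. g D \<le> 1" "\<And>D. g D \<le> \<sigma> * D" and \<sigma>: "0 < \<sigma>"
  shows "(\<integral>\<^sup>+\<omega>. ennreal (c0 g (smp z \<omega>) (smp w \<omega>)) \<partial>stream_space Q)
    \<le> ennreal ((\<sigma> * a + (Lp + Lpb * L * (lam / (lam - \<alpha>)))) * dist (fst z) (fst w))"
proof -
  let ?D = "dist (fst z) (fst w)"
  have mc: "(\<lambda>(z, w). ennreal (c0 g z w)) \<in> borel_measurable (state_space N \<Otimes>\<^sub>M state_space N)"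
    using measurable_c0[OF g(1)] unfolding case_prod_beta' by measurable
  have "(\<integral>\<^sup>+\<omega>. ennreal (c0 g (smp z \<omega>) (smp w \<omega>)) \<partial>stream_space Q)
      \<le> common (\<lambda>z w. ennreal (c0 g z w)) z w + gap z w"
    by (rule smp_pair_le[OF z w mc]) (use g(2) in \<open>auto simp: c0_def\<close>)
  also have "common (\<lambda>z w. ennreal (c0 g z w)) z w \<le> (\<integral>\<^sup>+t. ennreal (\<sigma> * ?D * h t) \<partial>Ex)"
    unfolding common_def
  proof (rule nn_integral_mono)
    fix t
    have "(\<Sum>js\<in>JS. ennreal (min (wt z js t) (wt w js t)) * ennreal (c0 g (pos z js t) (pos w js t)))
        \<le> (\<Sum>js\<in>JS. ennreal (wt z js t * (\<sigma> * dist (fst (pos z js t)) (fst (pos w js t)))))"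
    proof (rule sum_mono)
      fix js assume js: "js \<in> JS"
      have "c0 g (pos z js t) (pos w js t) \<le> \<sigma> * dist (fst (pos z js t)) (fst (pos w js t))"
        using g(3) by (simp add: c0_def pos_def)
      then show "ennreal (min (wt z js t) (wt w js t)) * ennreal (c0 g (pos z js t) (pos w js t))
          \<le> ennreal (wt z js t * (\<sigma> * dist (fst (pos z js t)) (fst (pos w js t))))"
        using wt_bounds[OF z js, of t] \<sigma> by (subst ennreal_mult) (auto intro!: mult_mono ennreal_leI)
    qed
    also have "\<dots> = ennreal (\<Sum>js\<in>JS. wt z js t * (\<sigma> * dist (fst (pos z js t)) (fst (pos w js t))))"
      using wt_bounds[OF z] \<sigma> by (intro sum_ennreal) auto
    also have "(\<Sum>js\<in>JS. wt z js t * (\<sigma> * dist (fst (pos z js t)) (fst (pos w js t))))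
        = \<sigma> * (\<Sum>js\<in>JS. wt z js t * dist (fst (pos z js t)) (fst (pos w js t)))"
      by (simp add: sum_distrib_left mult_ac)
    also have "ennreal \<dots> \<le> ennreal (\<sigma> * (h t * ?D))"
      using sum_wt_dist_le[OF z, of t w] \<sigma> by (intro ennreal_leI mult_left_mono) auto
    finally show "(\<Sum>js\<in>JS. ennreal (min (wt z js t) (wt w js t)) * ennreal (c0 g (pos z js t) (pos w js t)))
        \<le> ennreal (\<sigma> * ?D * h t)" by (simp add: mult_ac)
  qed
  also have "\<dots> = ennreal (\<sigma> * ?D * a)" using \<sigma> by (intro nn_integral_h) simp
  also have "gap z w \<le> (\<integral>\<^sup>+t. ennreal (Lp * ?D) + ennreal (Lpb * L * ?D * ex t) \<partial>Ex)"
    unfolding gap_def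
  proof (rule nn_integral_mono)
    fix t
    have "(\<Sum>js\<in>JS. ennreal \<bar>wt z js t - wt w js t\<bar>) = ennreal (\<Sum>js\<in>JS. \<bar>wt z js t - wt w js t\<bar>)"
      by (rule sum_ennreal) simp
    also have "\<dots> \<le> ennreal ((Lp + Lpb * L * ex t) * ?D)" by (intro ennreal_leI sum_gap_le z zw)
    also have "\<dots> = ennreal (Lp * ?D) + ennreal (Lpb * L * ?D * ex t)"
      using Lp Lpb L ex_pos[of t] by (subst ennreal_plus[symmetric]) (auto simp: algebra_simps)
    finally show "(\<Sum>js\<in>JS. ennreal \<bar>wt z js t - wt w js t\<bar>) \<le> ennreal (Lp * ?D) + ennreal (Lpb * L * ?D * ex t)" .
  qed
  also have "\<dots> = ennreal (Lp * ?D) + ennreal (Lpb * L * ?D * (lam / (lam - \<alpha>)))"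
    using Lpb L Ex.emeasure_space_1 by (subst nn_integral_add) (auto simp: nn_integral_ex)
  also have "ennreal (\<sigma> * ?D * a) + (ennreal (Lp * ?D) + ennreal (Lpb * L * ?D * (lam / (lam - \<alpha>))))
      = ennreal ((\<sigma> * a + (Lp + Lpb * L * (lam / (lam - \<alpha>)))) * ?D)"
    using \<sigma> a_bounds Lp Lpb L lam alpha_less
    by (subst ennreal_plus[symmetric], simp, simp, subst ennreal_plus[symmetric]) (auto simp: algebra_simps)
  finally show ?thesis by (simp add: add_mono)
qed

text \<open>\<open>h t\<close> may exceed 1 for some waiting times although its mean is
  \<open>a < 1\<close>. Only times with \<open>h t \<le> a1\<close> are exploited, which have
  probability at least \<open>1 - a / a1\<close>; the 2 in the condition on \<open>\<delta>\<close>
  pays for the loss in \<open>smp_pair_overlap\<close>.\<close>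

lemma nn_integral_c0_overlap:
  assumes z: "z \<in> state_set N" and w: "w \<in> state_set N"
    and g: "g \<in> borel_measurable borel" "mono g" "\<And>D. g D \<le> 1" "\<And>D. 0 \<le> D \<Longrightarrow> 0 \<le> g D"
    and a1: "a < a1" and \<delta>: "0 \<le> \<delta>" "2 * \<delta> \<le> p0 * q0 * (1 - a / a1)"
  shows "(\<integral>\<^sup>+\<omega>. ennreal (c0 g (smp z \<omega>) (smp w \<omega>)) \<partial>stream_space Q)
    \<le> ennreal (1 - \<delta> * (1 - g (a1 * dist (fst z) (fst w))))"
proof -
  let ?D = "dist (fst z) (fst w)"
  let ?G = "1 - g (a1 * ?D)"
  define c where "c = p0 * q0 * ?G"
  have G0: "0 \<le> ?G" using g(3) by simp
  have c: "0 \<le> c" using p0 q0 G0 by (simp add: c_def)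
  have a1_pos: "0 < a1" using a1 a_bounds by simp
  have m: "(\<lambda>(z, w). c0 g z w) \<in> borel_measurable (state_space N \<Otimes>\<^sub>M state_space N)"
    by (rule measurable_c0[OF g(1)])
  let ?F = "\<lambda>t. \<Sum>js\<in>JS. ennreal (min (wt z js t) (wt w js t)) * ennreal (1 - c0 g (pos z js t) (pos w js t))"
  have mF: "?F \<in> borel_measurable Ex"
    by (rule measurable_common[OF z w]) (use m in \<open>unfold case_prod_beta', measurable\<close>)
  \<comment> \<open>Markov's inequality for \<open>h\<close>, in the pointwise form \<open>1 - h t / a1 \<le> indicator {t. h t \<le> a1} t\<close>.\<close>
  have "ennreal c = (\<integral>\<^sup>+t. ennreal c \<partial>Ex)" using Ex.emeasure_space_1 by simp
  also have "\<dots> \<le> (\<integral>\<^sup>+t. ?F t + ennreal (c / a1 * h t) \<partial>Ex)"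
  proof (rule nn_integral_mono)
    fix t
    have F: "?F t = ennreal (\<Sum>js\<in>JS. min (wt z js t) (wt w js t) * (1 - g (dist (fst (pos z js t)) (fst (pos w js t)))))"
    proof -
      have "?F t = (\<Sum>js\<in>JS. ennreal (min (wt z js t) (wt w js t) * (1 - g (dist (fst (pos z js t)) (fst (pos w js t))))))"
        using wt_bounds(1)[OF z] wt_bounds(1)[OF w] g(3)
        by (intro sum.cong refl, subst ennreal_mult) (auto simp: c0_def pos_def)
      also have "\<dots> = ennreal (\<Sum>js\<in>JS. min (wt z js t) (wt w js t) * (1 - g (dist (fst (pos z js t)) (fst (pos w js t)))))"
        using wt_bounds(1)[OF z] wt_bounds(1)[OF w] g(3) by (intro sum_ennreal) (auto intro!: mult_nonneg_nonneg)
      finally show ?thesis .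
    qed
    show "ennreal c \<le> ?F t + ennreal (c / a1 * h t)"
    proof (cases "h t \<le> a1")
      case True
      have "h t * ?D \<le> a1 * ?D" using True by (intro mult_right_mono) auto
      then have "?G \<le> 1 - g (h t * ?D)" using monoD[OF g(2)] by simp
      then have "c \<le> p0 * q0 * (1 - g (h t * ?D))" unfolding c_def using p0 q0 by (intro mult_left_mono) auto
      also note sum_overlap_ge[OF z w g(2,3), of t]
      finally have "ennreal c \<le> ?F t" unfolding F by (rule ennreal_leI)
      then show ?thesis by (rule order_trans) simp
    next
      case False
      then have "1 \<le> h t / a1" using a1_pos by simp
      then have "c * 1 \<le> c * (h t / a1)" using c by (rule mult_left_mono)
      then have "ennreal c \<le> ennreal (c / a1 * h t)" by (intro ennreal_leI) simp
      then show ?thesis by (rule order_trans) simp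
    qed
  qed
  also have "\<dots> = (\<integral>\<^sup>+t. ?F t \<partial>Ex) + (\<integral>\<^sup>+t. ennreal (c / a1 * h t) \<partial>Ex)"
    by (rule nn_integral_add[OF mF]) measurable
  also have "(\<integral>\<^sup>+t. ennreal (c / a1 * h t) \<partial>Ex) = ennreal (c / a1 * a)"
    using c a1_pos by (intro nn_integral_h) simp
  also have "(\<integral>\<^sup>+t. ?F t \<partial>Ex) = common (\<lambda>z w. ennreal (1 - c0 g z w)) z w"
    unfolding common_def ..
  finally have main: "ennreal c \<le> common (\<lambda>z w. ennreal (1 - c0 g z w)) z w + ennreal (c / a1 * a)" .
  have "2 * (\<delta> * ?G) \<le> p0 * q0 * (1 - a / a1) * ?G"
    using mult_right_mono[OF \<delta>(2) G0] by (simp add: mult_ac)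
  also have "\<dots> = c - c / a1 * a" by (simp add: c_def algebra_simps)
  finally have le: "2 * (\<delta> * ?G) \<le> c - c / a1 * a" .
  have "ennreal (2 * (\<delta> * ?G)) \<le> common (\<lambda>z w. ennreal (1 - c0 g z w)) z w"
  proof (cases "common (\<lambda>z w. ennreal (1 - c0 g z w)) z w")
    case (real x)
    have "c \<le> x + c / a1 * a"
      using main real c a1_pos a_bounds by (simp add: ennreal_plus[symmetric] del: ennreal_plus)
    then show ?thesis using le real by (simp add: ennreal_leI)
  qed simp
  then have "(\<integral>\<^sup>+\<omega>. ennreal (c0 g (smp z \<omega>) (smp w \<omega>)) \<partial>stream_space Q) \<le> ennreal (1 - 2 * (\<delta> * ?G) / 2)"
    by (rule smp_pair_overlap[OF z w m, rotated 2]) (use g(3,4) \<delta>(1) G0 in \<open>auto simp: c0_def\<close>)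
  then show ?thesis by simp
qed

theorem ex_contractive_maps:
  "\<exists>ct r \<eta>. contractive_maps (stream_space Q) N smp xs ct r a b \<eta>"
proof -
  interpret Om: prob_space "stream_space Q" by (rule RS.prob_space_stream_space)
  define l where "l = Lp + Lpb * L * (lam / (lam - \<alpha>))"
  \<comment> \<open>Halfway between \<open>a\<close> and 1: the margin above \<open>a\<close>
    absorbs the gap and feeds Markov's inequality, the margin below 1 is the contraction left
    over.\<close>
  define a1 where "a1 = (1 + a) / 2"
  \<comment> \<open>The slope solving \<open>\<sigma> * a + l = a1 * \<sigma>\<close>.\<close>
  define \<sigma> where "\<sigma> = 2 * l / (1 - a)"
  define \<delta> where "\<delta> = min 1 (p0 * q0 * (1 - a / a1) / 2)"
  \<comment> \<open>The added 1 makes \<open>R\<close> strictly larger than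
    \<open>1 / \<sigma>\<close>, so that \<open>g R\<close> differs from
    \<open>\<sigma> * R\<close>; the other entry makes the drift dominate its constant beyond
    \<open>R\<close>.\<close>
  define R where "R = max (1 / \<sigma>) (4 * b / (1 - a)) + 1"
  have l: "l > 0" unfolding l_def using Lp Lpb L lam alpha_less by (intro add_pos_nonneg) auto
  have a1: "0 < a1" "a1 < 1" "a < a1" using a_bounds by (auto simp: a1_def)
  have \<sigma>: "\<sigma> > 0" using l a_bounds by (simp add: \<sigma>_def)
  have near_rate: "\<sigma> * a + l = a1 * \<sigma>" using a_bounds by (simp add: \<sigma>_def a1_def field_simps)
  have pq: "0 < p0 * q0 * (1 - a / a1)" using p0 q0 a1 a_bounds by simp
  have \<delta>: "0 < \<delta>" "\<delta> \<le> 1" "2 * \<delta> \<le> p0 * q0 * (1 - a / a1)"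
    using pq by (auto simp: \<delta>_def min_def)
  have R: "1 / \<sigma> \<le> R" "1 / \<sigma> < R" "4 * b / (1 - a) \<le> R" unfolding R_def by linarith+
  have R_pos: "0 < R" using R(2) \<sigma> by (meson divide_pos_pos less_trans zero_less_one)
  obtain g \<epsilon> where \<epsilon>: "0 < \<epsilon>" "\<epsilon> < 1" and g: "mono g" "g \<in> borel_measurable borel"
    "\<And>D. 0 \<le> D \<Longrightarrow> 0 \<le> g D" "\<And>D. g D \<le> 1" "\<And>D. g D \<le> \<sigma> * D"
    "\<And>D. min (\<sigma> * D) (1 / 2) \<le> g D" "\<And>D. R \<le> D \<Longrightarrow> g D = 1"
    "\<And>D. D \<le> R \<Longrightarrow> g D \<noteq> \<sigma> * D \<Longrightarrow> 1 - \<delta> * (1 - g (a1 * D)) \<le> (1 - \<epsilon>) * g D"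
    by (rule ex_cost_function[OF \<sigma> \<delta>(1,2) a1(1,2) R(1)], rule that; assumption)
  define \<kappa> where "\<kappa> = max a1 (1 - \<epsilon>)"
  have \<kappa>: "0 < \<kappa>" "\<kappa> < 1" "a1 \<le> \<kappa>" "1 - \<epsilon> \<le> \<kappa>" using a1 \<epsilon> by (auto simp: \<kappa>_def)
  \<comment> \<open>So small that the growth of \<open>W\<close>, at most by
    \<open>1 + 2 * \<beta> * b\<close>, uses up only part of the margin \<open>1 - \<kappa>\<close>;
    \<open>b + 1\<close> guards against \<open>b = 0\<close>.\<close>
  define \<beta> where "\<beta> = (1 - \<kappa>) / (4 * (b + 1))"
  have \<beta>: "0 < \<beta>" "\<beta> \<le> 1" "2 * \<beta> * b \<le> (1 - \<kappa>) / 2"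
    using \<kappa> b_nonneg by (auto simp: \<beta>_def field_simps)
  let ?V = "\<lambda>z :: 'y \<times> nat. dist (fst z) xs"
  define W where "W z w = 1 + \<beta> * (?V z + ?V w)" for z w :: "'y \<times> nat"
  have W1: "1 \<le> W z w" for z w using \<beta> by (simp add: W_def)
  define ct where "ct z w = sqrt (c0 g z w * W z w)" for z w
  have c01: "0 \<le> c0 g z w" "c0 g z w \<le> 1" for z w using g(3,4) by (auto simp: c0_def)
  define r1 where "r1 = (1 + \<kappa>) / 2"
  \<comment> \<open>The ratio of the contracted to the old weight when \<open>?V z + ?V w\<close>
    equals \<open>R\<close>. It decreases in that sum and so bounds the ratio for all larger
    sums.\<close>
  define r2 where "r2 = (1 + a1 * \<beta> * R) / (1 + \<beta> * R)"
  \<comment> \<open>Cauchy-Schwarz controls the square of the mean of \<open>ct\<close>, hence the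
    root.\<close>
  define r where "r = sqrt (max r1 r2)"
  have r1: "0 < r1" "r1 < 1" using \<kappa> by (auto simp: r1_def)
  have "\<beta> * R > 0" using \<beta> R_pos by simp
  then have "0 < a1 * (\<beta> * R)" "a1 * (\<beta> * R) < 1 * (\<beta> * R)"
    using mult_pos_pos[OF a1(1)] mult_strict_right_mono[OF a1(2)] by blast+
  then have r2: "0 < r2" "r2 < 1" by (auto simp: r2_def mult.assoc)
  have r: "0 < r" "r < 1" and r_sq: "r ^ 2 = max r1 r2" using r1 r2 by (auto simp: r_def)
  have meas_W: "(\<lambda>(z, w). W z w) \<in> borel_measurable (state_space N \<Otimes>\<^sub>M (state_space N :: ('y \<times> nat) measure))"
    unfolding W_def case_prod_beta
    by (intro borel_measurable_add borel_measurable_times borel_measurable_const borel_measurable_dist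
      measurable_fst_state'[OF measurable_fst] measurable_fst_state'[OF measurable_snd])
  have step_c0: "(\<integral>\<^sup>+\<omega>. ennreal (c0 g (smp z \<omega>) (smp w \<omega>)) \<partial>stream_space Q) \<le> ennreal (\<kappa> * c0 g z w)"
    if z: "z \<in> state_set N" and w: "w \<in> state_set N" and D: "dist (fst z) (fst w) \<le> R" for z w
  proof -
    let ?D = "dist (fst z) (fst w)"
    note over = nn_integral_c0_overlap[OF z w g(2,1,4,3) a1(3) less_imp_le[OF \<delta>(1)] \<delta>(3)]
    show ?thesis
    proof (cases "snd z = snd w")
      case True
      then have c: "c0 g z w = g ?D" by (simp add: c0_def)
      show ?thesis
      proof (cases "g ?D = \<sigma> * ?D")
        case eq: True
        note nn_integral_c0_near[OF z w True g(2,4,5) \<sigma>]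
        also have "(\<sigma> * a + (Lp + Lpb * L * (lam / (lam - \<alpha>)))) * ?D = a1 * (\<sigma> * ?D)"
          using near_rate by (simp add: l_def mult.assoc[symmetric])
        also have "\<dots> \<le> \<kappa> * (\<sigma> * ?D)" using \<kappa> \<sigma> by (intro mult_right_mono) auto
        finally show ?thesis unfolding c eq by (simp add: ennreal_leI)
      next
        case False
        note over
        also have "1 - \<delta> * (1 - g (a1 * ?D)) \<le> (1 - \<epsilon>) * g ?D" by (rule g(8)[OF D False])
        also have "\<dots> \<le> \<kappa> * g ?D" using \<kappa> g(3) by (intro mult_right_mono) auto
        finally show ?thesis unfolding c by (simp add: ennreal_leI)
      qed
    next
      case False
      then have c: "c0 g z w = 1" by (simp add: c0_def)
      \<comment> \<open>For different indices the current cost is 1, which is also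
        \<open>g R\<close>. As \<open>\<sigma> * R > 1\<close>, the estimate for \<open>g\<close>
        applies at \<open>R\<close> and passes by monotonicity to all distances up to
        \<open>R\<close>.\<close>
      have "g R = 1" by (rule g(7)) simp
      moreover have "1 < \<sigma> * R" using R(2) \<sigma> by (simp add: field_simps)
      ultimately have "1 - \<delta> * (1 - g (a1 * R)) \<le> 1 - \<epsilon>" using g(8)[of R] by simp
      moreover have "g (a1 * ?D) \<le> g (a1 * R)" using D a1 by (intro monoD[OF g(1)] mult_left_mono) auto
      then have "\<delta> * (1 - g (a1 * R)) \<le> \<delta> * (1 - g (a1 * ?D))" using \<delta> by (intro mult_left_mono) auto
      ultimately have "1 - \<delta> * (1 - g (a1 * ?D)) \<le> \<kappa> * 1" using \<kappa> by linarith
      then show ?thesis unfolding c using over by (meson ennreal_leI order_trans)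
    qed
  qed
  have step_1: "(\<integral>\<^sup>+\<omega>. ennreal (c0 g (smp z \<omega>) (smp w \<omega>)) \<partial>stream_space Q) \<le> 1" for z w
  proof -
    have "(\<integral>\<^sup>+\<omega>. ennreal (c0 g (smp z \<omega>) (smp w \<omega>)) \<partial>stream_space Q) \<le> (\<integral>\<^sup>+\<omega>. 1 \<partial>stream_space Q)"
      using c01 by (intro nn_integral_mono) simp
    then show ?thesis using Om.emeasure_space_1 by simp
  qed
  have step_W: "(\<integral>\<^sup>+\<omega>. ennreal (W (smp z \<omega>) (smp w \<omega>)) \<partial>stream_space Q)
      \<le> ennreal (1 + 2 * \<beta> * b + a * \<beta> * (?V z + ?V w))"
    if z: "z \<in> state_set N" and w: "w \<in> state_set N" for z w
  proof -
    have mV: "(\<lambda>\<omega>. ?V (smp v \<omega>)) \<in> borel_measurable (stream_space Q)" if "v \<in> state_set N" for v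
      by (intro borel_measurable_dist borel_measurable_const measurable_fst_state'[OF measurable_smp1[OF that]])
    have "(\<integral>\<^sup>+\<omega>. ennreal (W (smp z \<omega>) (smp w \<omega>)) \<partial>stream_space Q)
        = (\<integral>\<^sup>+\<omega>. 1 + ennreal \<beta> * (ennreal (?V (smp z \<omega>)) + ennreal (?V (smp w \<omega>))) \<partial>stream_space Q)"
      using \<beta> by (intro nn_integral_cong) (simp add: W_def ennreal_mult ennreal_plus)
    also have "\<dots> = 1 + ennreal \<beta> * ((\<integral>\<^sup>+\<omega>. ennreal (?V (smp z \<omega>)) \<partial>stream_space Q) + (\<integral>\<^sup>+\<omega>. ennreal (?V (smp w \<omega>)) \<partial>stream_space Q))"
      using mV[OF z] mV[OF w] Om.emeasure_space_1 by (simp add: nn_integral_add nn_integral_cmult)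
    also have "\<dots> \<le> 1 + ennreal \<beta> * (ennreal (a * ?V z + b) + ennreal (a * ?V w + b))"
      by (intro add_left_mono mult_left_mono add_mono smp_drift z w) simp
    also have "\<dots> = ennreal (1 + \<beta> * ((a * ?V z + b) + (a * ?V w + b)))"
    proof -
      have "1 + ennreal \<beta> * (ennreal u + ennreal v) = ennreal (1 + \<beta> * (u + v))" if "0 \<le> u" "0 \<le> v" for u v
        using \<beta> that by (simp add: ennreal_mult)
      from this[of "a * ?V z + b" "a * ?V w + b"] show ?thesis
        using a_bounds b_nonneg by (simp only: add_nonneg_nonneg mult_nonneg_nonneg zero_le_dist less_imp_le)
    qed
    also have "1 + \<beta> * ((a * ?V z + b) + (a * ?V w + b)) = 1 + 2 * \<beta> * b + a * \<beta> * (?V z + ?V w)"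
      by (simp add: algebra_simps)
    finally show ?thesis .
  qed
  \<comment> \<open>Up to distance \<open>R\<close> the factor \<open>c0\<close> contracts and
    \<open>W\<close> grows only slightly. Beyond, \<open>c0\<close> already has its maximum, while
    the triangle inequality makes \<open>?V z + ?V w\<close> at least \<open>R\<close> and the drift
    shrinks \<open>W\<close>.\<close>
  have step_prod: "(\<integral>\<^sup>+\<omega>. ennreal (c0 g (smp z \<omega>) (smp w \<omega>)) \<partial>stream_space Q)
      * (\<integral>\<^sup>+\<omega>. ennreal (W (smp z \<omega>) (smp w \<omega>)) \<partial>stream_space Q) \<le> ennreal (r ^ 2 * (c0 g z w * W z w))"
    (is "?I * ?J \<le> _") if z: "z \<in> state_set N" and w: "w \<in> state_set N" for z w
  proof -
    let ?D = "dist (fst z) (fst w)" and ?s = "?V z + ?V w"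
    have s0: "0 \<le> ?s" by simp
    show ?thesis
    proof (cases "?D \<le> R")
      case True
      have "1 + 2 * \<beta> * b + a * \<beta> * ?s \<le> (1 + 2 * \<beta> * b) * W z w"
      proof -
        have "a * (\<beta> * ?s) \<le> 1 * (\<beta> * ?s)" using a_bounds \<beta> s0 by (intro mult_right_mono) auto
        moreover have "0 \<le> 2 * \<beta> * b * (\<beta> * ?s)" using \<beta> b_nonneg s0 by (intro mult_nonneg_nonneg) auto
        ultimately show ?thesis unfolding W_def by (simp add: algebra_simps)
      qed
      then have J: "?J \<le> ennreal ((1 + 2 * \<beta> * b) * W z w)"
        using step_W[OF z w] by (meson ennreal_leI order_trans)
      have "?I * ?J \<le> ennreal (\<kappa> * c0 g z w) * ennreal ((1 + 2 * \<beta> * b) * W z w)"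
        by (intro mult_mono step_c0[OF z w True] J) auto
      also have "\<dots> = ennreal (\<kappa> * (1 + 2 * \<beta> * b) * (c0 g z w * W z w))"
        using \<kappa> \<beta> b_nonneg c01[of z w] W1[of z w] by (subst ennreal_mult[symmetric]) (auto simp: mult_ac)
      also have "\<dots> \<le> ennreal (r ^ 2 * (c0 g z w * W z w))"
      proof (intro ennreal_leI mult_right_mono)
        have "\<kappa> * (2 * \<beta> * b) \<le> 1 * (2 * \<beta> * b)" using \<kappa> \<beta> b_nonneg by (intro mult_right_mono) auto
        then have "\<kappa> * (1 + 2 * \<beta> * b) \<le> r1" using \<beta>(3) unfolding r1_def by (simp add: algebra_simps)
        then show "\<kappa> * (1 + 2 * \<beta> * b) \<le> r ^ 2" unfolding r_sq by simp
        show "0 \<le> c0 g z w * W z w" using c01[of z w] W1[of z w] by (intro mult_nonneg_nonneg) auto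
      qed
      finally show ?thesis .
    next
      case False
      then have c: "c0 g z w = 1" using g(7)[of ?D] by (simp add: c0_def)
      have "?D \<le> ?s" using dist_triangle2[of "fst z" "fst w" xs] .
      then have sR: "R \<le> ?s" using False by linarith
      have "2 * b \<le> (1 - a) / 2 * R" using R(3) a_bounds by (simp add: field_simps)
      also have "\<dots> \<le> (1 - a) / 2 * ?s" using sR a_bounds by (intro mult_left_mono) auto
      finally have "\<beta> * (2 * b) \<le> \<beta> * ((1 - a) / 2 * ?s)" using \<beta> by (intro mult_left_mono) auto
      then have "1 + 2 * \<beta> * b + a * \<beta> * ?s \<le> 1 + a1 * (\<beta> * ?s)" by (simp add: a1_def algebra_simps add_divide_distrib diff_divide_distrib)
      also have "\<dots> \<le> r2 * W z w"
      proof -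
        have "(1 - a1) * (\<beta> * R) \<le> (1 - a1) * (\<beta> * ?s)" using a1 \<beta> sR by (intro mult_left_mono) auto
        then have "(1 + a1 * (\<beta> * ?s)) * (1 + \<beta> * R) \<le> (1 + a1 * \<beta> * R) * (1 + \<beta> * ?s)" by (simp add: algebra_simps)
        then show ?thesis using \<open>\<beta> * R > 0\<close> unfolding r2_def W_def by (simp add: pos_le_divide_eq)
      qed
      also have "\<dots> \<le> r ^ 2 * W z w" unfolding r_sq using W1[of z w] by (intro mult_right_mono) auto
      finally have "?J \<le> ennreal (r ^ 2 * W z w)" using step_W[OF z w] by (meson ennreal_leI order_trans)
      then have "?I * ?J \<le> 1 * ennreal (r ^ 2 * W z w)" by (intro mult_mono step_1) auto
      then show ?thesis unfolding c by simp
    qed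
  qed
  have meas_ct: "(\<lambda>(z, w). ct z w) \<in> borel_measurable (state_space N \<Otimes>\<^sub>M state_space N)"
  proof -
    have "(\<lambda>p. sqrt (c0 g (fst p) (snd p) * W (fst p) (snd p))) \<in> borel_measurable (state_space N \<Otimes>\<^sub>M state_space N)"
      using measurable_c0[OF g(2)] meas_W unfolding case_prod_beta'
      by (intro measurable_compose[OF _ borel_measurable_sqrt] borel_measurable_times)
    then show ?thesis unfolding ct_def case_prod_beta' .
  qed
  have contraction: "(\<integral>\<^sup>+\<omega>. ennreal (ct (smp z \<omega>) (smp w \<omega>)) \<partial>stream_space Q) \<le> ennreal (r * ct z w)"
    if z: "z \<in> state_set N" and w: "w \<in> state_set N" for z w
  proof (rule ennreal_power2_le_imp_le)
    note mp = measurable_Pair[OF measurable_smp1[OF z] measurable_smp1[OF w]]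
    have m1: "(\<lambda>\<omega>. c0 g (smp z \<omega>) (smp w \<omega>)) \<in> borel_measurable (stream_space Q)"
      using measurable_compose[OF mp measurable_c0[OF g(2)]] by simp
    have m2: "(\<lambda>\<omega>. W (smp z \<omega>) (smp w \<omega>)) \<in> borel_measurable (stream_space Q)"
      using measurable_compose[OF mp meas_W] by simp
    note [measurable] = m1 m2
    have sq: "ennreal (sqrt x) ^ 2 = ennreal x" if "0 \<le> x" for x using that by (simp add: ennreal_power)
    have W0: "0 \<le> W u v" for u v using W1[of u v] by simp
    have "(\<integral>\<^sup>+\<omega>. ennreal (ct (smp z \<omega>) (smp w \<omega>)) \<partial>stream_space Q) ^ 2
        = (\<integral>\<^sup>+\<omega>. ennreal (sqrt (c0 g (smp z \<omega>) (smp w \<omega>))) * ennreal (sqrt (W (smp z \<omega>) (smp w \<omega>))) \<partial>stream_space Q) ^ 2"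
      using c01 W0 by (simp add: ct_def real_sqrt_mult ennreal_mult)
    also have "\<dots> \<le> (\<integral>\<^sup>+\<omega>. ennreal (sqrt (c0 g (smp z \<omega>) (smp w \<omega>))) ^ 2 \<partial>stream_space Q)
        * (\<integral>\<^sup>+\<omega>. ennreal (sqrt (W (smp z \<omega>) (smp w \<omega>))) ^ 2 \<partial>stream_space Q)"
      by (rule Cauchy_Schwarz_nn_integral) measurable
    also have "\<dots> \<le> ennreal (r ^ 2 * (c0 g z w * W z w))"
      using step_prod[OF z w] by (simp only: sq[OF c01(1)] sq[OF W0])
    also have "r ^ 2 * (c0 g z w * W z w) = (r * ct z w) ^ 2"
      using c01[of z w] W0[of z w] by (simp add: ct_def power_mult_distrib)
    finally show "(\<integral>\<^sup>+\<omega>. ennreal (ct (smp z \<omega>) (smp w \<omega>)) \<partial>stream_space Q) ^ 2 \<le> ennreal ((r * ct z w) ^ 2)" .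
    show "0 \<le> r * ct z w" using r c01[of z w] W0[of z w] by (simp add: ct_def)
  qed
  \<comment> \<open>\<open>\<sigma>\<close> serves the linear range of \<open>g\<close>, where the
    cost may be as small as \<open>\<sigma>\<close> times the distance; 1/2 serves the rest.\<close>
  define \<eta> where "\<eta> = min \<sigma> (1 / 2)"
  have \<eta>: "0 < \<eta>" "\<eta> \<le> \<sigma>" "\<eta> \<le> 1 / 2" using \<sigma> by (auto simp: \<eta>_def)
  have lower: "\<eta> * min 1 (state_dist z w) \<le> ct z w" for z w
  proof -
    have "\<eta> * min 1 (state_dist z w) \<le> c0 g z w"
    proof (cases "snd z = snd w")
      case True
      let ?D = "dist (fst z) (fst w)"
      have "\<eta> * min 1 ?D \<le> \<sigma> * ?D" using \<eta> \<sigma> by (intro mult_mono) auto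
      moreover have "\<eta> * min 1 ?D \<le> 1 / 2 * 1" using \<eta> by (intro mult_mono) auto
      ultimately show ?thesis using g(6)[of ?D] True by (simp add: c0_def state_dist_def)
    next
      case False
      have "\<eta> * min 1 (state_dist z w) \<le> 1 * 1"
        using \<eta> state_dist_nonneg[of z w] by (intro mult_mono) auto
      then show ?thesis using False by (simp add: c0_def)
    qed
    \<comment> \<open>\<open>c0\<close> is at most 1 and \<open>W\<close> at least 1, so replacing
      one factor \<open>c0\<close> by \<open>W\<close> only increases the root.\<close>
    also have "c0 g z w = sqrt (c0 g z w * c0 g z w)" using c01 by simp
    also have "\<dots> \<le> ct z w"
      unfolding ct_def using c01[of z w] W1[of z w] by (intro real_sqrt_le_mono mult_left_mono) auto
    finally show ?thesis .
  qed
  have upper: "ct z w \<le> 1 + ?V z + ?V w" for z w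
  proof -
    have "ct z w \<le> sqrt (W z w * W z w)"
      unfolding ct_def using c01[of z w] W1[of z w] by (intro real_sqrt_le_mono mult_right_mono) auto
    also have "\<dots> = W z w" using W1[of z w] by simp
    also have "\<dots> \<le> 1 + 1 * (?V z + ?V w)" unfolding W_def using \<beta> by (intro add_left_mono mult_right_mono) auto
    finally show ?thesis by simp
  qed
  have tends: "(ct z \<longlongrightarrow> 0) (at z within state_set N)" for z
  proof -
    have "((\<lambda>w. sqrt (\<sigma> * dist (fst z) (fst w) * W z w)) \<longlongrightarrow> sqrt (\<sigma> * dist (fst z) (fst z) * W z z)) (at z within state_set N)"
      unfolding W_def by (intro tendsto_intros)
    then have lim: "((\<lambda>w. sqrt (\<sigma> * dist (fst z) (fst w) * W z w)) \<longlongrightarrow> 0) (at z within state_set N)" by simp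
    have "\<forall>\<^sub>F w in at z within state_set N. snd w = snd z"
      unfolding tendsto_discrete[symmetric] by (intro tendsto_intros)
    then have "\<forall>\<^sub>F w in at z within state_set N. norm (ct z w) \<le> sqrt (\<sigma> * dist (fst z) (fst w) * W z w)"
    proof eventually_elim
      case (elim w)
      then have "c0 g z w \<le> \<sigma> * dist (fst z) (fst w)" using g(5) by (simp add: c0_def)
      moreover have "0 \<le> ct z w" using c01[of z w] W1[of z w] by (simp add: ct_def)
      ultimately show ?case
        unfolding ct_def using W1[of z w] by (simp add: mult_right_mono)
    qed
    from Lim_null_comparison[OF this lim] show ?thesis .
  qed
  have "contractive_maps (stream_space Q) N smp xs ct r a b \<eta>"
    by (rule contractive_maps.intro[OF Om.prob_space_axioms], rule contractive_maps_axioms.intro)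
      (use N RS.measurable_sample meas_ct lower upper tends \<eta>(1) r a_bounds b_nonneg contraction smp_drift in \<open>auto simp del: mem_state_set\<close>)
  then show ?thesis by blast
qed

end

section \<open>The operators of the jump process\<close>

context contractive_maps
begin

lemma emeasure_Pmap:
  assumes \<mu>: "\<mu> \<in> prob_measures N" and A[measurable]: "A \<in> sets (state_space N)"
  shows "emeasure (Pmap \<mu>) A = (\<integral>\<^sup>+z. \<integral>\<^sup>+\<omega>. indicator A (F z \<omega>) \<partial>Om \<partial>\<mu>)"
proof -
  have [measurable_cong]: "sets \<mu> = sets (state_space N)" using \<mu> by (rule prob_measuresD)
  have m: "(\<lambda>(z, \<omega>). F z \<omega>) \<in> \<mu> \<Otimes>\<^sub>M Om \<rightarrow>\<^sub>M state_space N" by measurable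
  have "emeasure (Pmap \<mu>) A = (\<integral>\<^sup>+z. indicator A z \<partial>Pmap \<mu>)" by (simp add: Pmap_def)
  also have "\<dots> = (\<integral>\<^sup>+p. indicator A (case p of (z, \<omega>) \<Rightarrow> F z \<omega>) \<partial>(\<mu> \<Otimes>\<^sub>M Om))"
    unfolding Pmap_def by (rule nn_integral_distr[OF m]) simp
  also have "\<dots> = (\<integral>\<^sup>+z. \<integral>\<^sup>+\<omega>. indicator A (F z \<omega>) \<partial>Om \<partial>\<mu>)"
    by (subst nn_integral_fst[symmetric]) (auto intro!: measurable_compose[OF m])
  finally show ?thesis .
qed

lemma Pmap_return:
  assumes z: "z \<in> state_set N"
  shows "Pmap (return (state_space N) z) = distr Om (state_space N) (F z)"
proof (rule measure_eqI)
  fix A assume "A \<in> sets (Pmap (return (state_space N) z))"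
  then have A[measurable]: "A \<in> sets (state_space N)" by (simp add: Pmap_def)
  have "return (state_space N) z \<in> prob_measures N"
    using z by (auto simp: prob_measures_def intro!: prob_space_return simp del: mem_state_set)
  then have "emeasure (Pmap (return (state_space N) z)) A
      = (\<integral>\<^sup>+v. \<integral>\<^sup>+\<omega>. indicator A (F v \<omega>) \<partial>Om \<partial>return (state_space N) z)"
    by (rule emeasure_Pmap) fact
  also have "\<dots> = (\<integral>\<^sup>+\<omega>. indicator A (F z \<omega>) \<partial>Om)"
    using z by (intro nn_integral_return) auto
  also have "\<dots> = (\<integral>\<^sup>+v. indicator A v \<partial>distr Om (state_space N) (F z))"
    using z by (intro nn_integral_distr[symmetric]) auto
  finally show "emeasure (Pmap (return (state_space N) z)) A = emeasure (distr Om (state_space N) (F z)) A"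
    by simp
qed (simp add: Pmap_def)

end

context jump_process
begin

lemma pos_in [simp]: "js \<in> JS \<Longrightarrow> pos z js t \<in> state_set N"
  using JS_D[of js] by (simp add: pos_def)

lemma measurable_wt_Ex: "z \<in> state_set N \<Longrightarrow> js \<in> JS \<Longrightarrow> (\<lambda>t. wt z js t) \<in> borel_measurable Ex"
  by (rule measurable_wt) (auto intro!: measurable_const measurable_ident_sets)

lemma measurable_pos_Ex: "z \<in> state_set N \<Longrightarrow> js \<in> JS \<Longrightarrow> (\<lambda>t. pos z js t) \<in> Ex \<rightarrow>\<^sub>M state_space N"
  by (rule measurable_pos) (auto intro!: measurable_const measurable_ident_sets)

lemma integrable_wt:
  assumes z: "z \<in> state_set N" and js: "js \<in> JS"
    and f: "f \<in> borel_measurable (state_space N)" "\<And>z. z \<in> state_set N \<Longrightarrow> \<bar>f z\<bar> \<le> B"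
  shows "integrable Ex (\<lambda>t. wt z js t * f (pos z js t))"
proof (rule Ex.abs_integral_le(1)[of _ "1 * B"])
  show "(\<lambda>t. wt z js t * f (pos z js t)) \<in> borel_measurable Ex"
    by (intro borel_measurable_times measurable_wt_Ex measurable_compose[OF measurable_pos_Ex f(1)] z js)
  show "\<bar>wt z js t * f (pos z js t)\<bar> \<le> 1 * B" for t
    unfolding abs_mult using wt_bounds[OF z js, of t] f(2)[OF pos_in[OF js]] by (intro mult_mono) auto
qed

lemma U_op_eq_sum:
  assumes z: "z \<in> state_set N" and f: "f \<in> borel_measurable (state_space N)"
  shows "U_op N K lam \<Phi> q pb p f z = (\<Sum>js\<in>JS. \<integral>t. wt z js t * f (pos z js t) \<partial>Ex)"
proof -
  have eq: "(LINT t:{0..}|lborel. lam * exp (- (lam * t)) * f (q s (\<Phi> j t (fst z)), j) * p (snd z) j (fst z) * pb s (\<Phi> j t (fst z)))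
     = (\<integral>t. wt z (j, s) t * f (pos z (j, s) t) \<partial>Ex)" if js: "(j, s) \<in> JS" for j s
  proof -
    have m: "(\<lambda>t. wt z (j, s) t * f (pos z (j, s) t)) \<in> borel_measurable lborel"
      using borel_measurable_times[OF measurable_wt_Ex[OF z js] measurable_compose[OF measurable_pos_Ex[OF z js] f]] by simp
    have "(\<integral>t. wt z (j, s) t * f (pos z (j, s) t) \<partial>Ex)
        = (\<integral>t. exponential_density lam t *\<^sub>R (wt z (j, s) t * f (pos z (j, s) t)) \<partial>lborel)"
      unfolding Ex_def using lam by (intro integral_density m) (auto simp: exponential_density_nonneg)
    also have "\<dots> = (LINT t:{0..}|lborel. lam * exp (- (lam * t)) * f (q s (\<Phi> j t (fst z)), j) * p (snd z) j (fst z) * pb s (\<Phi> j t (fst z)))"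
      unfolding set_lebesgue_integral_def
      by (intro Bochner_Integration.integral_cong refl)
        (auto simp: exponential_density_def wt_def pos_def Phi_def max_def mult_ac split: split_indicator)
    finally show ?thesis ..
  qed
  have "U_op N K lam \<Phi> q pb p f z = (\<Sum>j\<in>{1..N}. \<Sum>s\<in>{1..K}. \<integral>t. wt z (j, s) t * f (pos z (j, s) t) \<partial>Ex)"
    unfolding U_op_def case_prod_beta by (intro sum.cong refl eq) (simp add: JS_def)
  also have "\<dots> = (\<Sum>js\<in>JS. \<integral>t. wt z js t * f (pos z js t) \<partial>Ex)"
    unfolding sum_JS[symmetric, of "\<lambda>j s. \<integral>t. wt z (j, s) t * f (pos z (j, s) t) \<partial>Ex"] by simp
  finally show ?thesis .
qed

text \<open>Powers of \<open>U_op\<close> are identified only on the state set; this lets the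
  induction over powers replace the inner function there.\<close>

lemma U_op_cong:
  assumes "\<And>z. z \<in> state_set N \<Longrightarrow> f z = g z"
  shows "U_op N K lam \<Phi> q pb p f z = U_op N K lam \<Phi> q pb p g z"
  unfolding U_op_def case_prod_beta by (intro sum.cong refl) (simp add: assms)

text \<open>The law of the sampler is available for nonnegative integrals. Boundedness extends it to
  signed functions: \<open>f + B\<close> and the constant \<open>B\<close> are nonnegative, and
  subtracting their identities gives the one for \<open>f\<close>.\<close>

lemma U_op_eq:
  assumes z: "z \<in> state_set N"
    and f: "f \<in> borel_measurable (state_space N)" "\<And>z. z \<in> state_set N \<Longrightarrow> \<bar>f z\<bar> \<le> B"
  shows "U_op N K lam \<Phi> q pb p f z = (\<integral>\<omega>. f (smp z \<omega>) \<partial>stream_space Q)"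
proof -
  interpret Om: prob_space "stream_space Q" by (rule RS.prob_space_stream_space)
  have smp_in: "smp z \<omega> \<in> state_set N" if "\<omega> \<in> space (stream_space Q)" for \<omega>
    using measurable_space[OF measurable_smp1[OF z] that] by simp
  have nonneg: "(\<Sum>js\<in>JS. \<integral>t. wt z js t * h (pos z js t) \<partial>Ex) = (\<integral>\<omega>. h (smp z \<omega>) \<partial>stream_space Q)"
    if h: "h \<in> borel_measurable (state_space N)" "\<And>z. z \<in> state_set N \<Longrightarrow> \<bar>h z\<bar> \<le> C" "\<And>z. z \<in> state_set N \<Longrightarrow> 0 \<le> h z"
    for h C
  proof -
    note iw = integrable_wt[OF z _ h(1,2)]
    have nn: "0 \<le> wt z js t * h (pos z js t)" if "js \<in> JS" for js t
      using wt_bounds(1)[OF z that] h(3)[OF pos_in[OF that]] by (rule mult_nonneg_nonneg)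
    have i: "integrable (stream_space Q) (\<lambda>\<omega>. h (smp z \<omega>))"
      using smp_in h(2) by (intro Om.abs_integral_le(1)[of _ C] measurable_compose[OF measurable_smp1[OF z] h(1)]) auto
    have "ennreal (\<integral>\<omega>. h (smp z \<omega>) \<partial>stream_space Q) = (\<integral>\<^sup>+\<omega>. ennreal (h (smp z \<omega>)) \<partial>stream_space Q)"
      using smp_in h(3) by (intro nn_integral_eq_integral[symmetric] i AE_I2) auto
    also have "\<dots> = (\<integral>\<^sup>+t. (\<Sum>js\<in>JS. ennreal (wt z js t) * ennreal (h (pos z js t))) \<partial>Ex)"
      using h(1) by (intro nn_integral_smp[OF z]) measurable
    also have "\<dots> = (\<integral>\<^sup>+t. ennreal (\<Sum>js\<in>JS. wt z js t * h (pos z js t)) \<partial>Ex)"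
      using nn wt_bounds[OF z] h(3)[OF pos_in]
      by (intro nn_integral_cong) (simp add: sum_ennreal[symmetric] ennreal_mult del: sum_ennreal)
    also have "\<dots> = ennreal (\<integral>t. (\<Sum>js\<in>JS. wt z js t * h (pos z js t)) \<partial>Ex)"
      using iw nn by (intro nn_integral_eq_integral AE_I2 Bochner_Integration.integrable_sum sum_nonneg) auto
    also have "(\<integral>t. (\<Sum>js\<in>JS. wt z js t * h (pos z js t)) \<partial>Ex) = (\<Sum>js\<in>JS. \<integral>t. wt z js t * h (pos z js t) \<partial>Ex)"
      using iw by (intro Bochner_Integration.integral_sum) auto
    finally show ?thesis
      using nn smp_in h(3)
      by (subst (asm) ennreal_inj) (auto intro!: sum_nonneg Bochner_Integration.integral_nonneg integral_nonneg_AE)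
  qed
  have iw: "integrable Ex (\<lambda>t. wt z js t * f (pos z js t))" "integrable Ex (\<lambda>t. wt z js t * B)" if "js \<in> JS" for js
    using integrable_wt[OF z that f] integrable_wt[OF z that, of "\<lambda>_. B" "\<bar>B\<bar>"] by auto
  have B0: "0 \<le> B" using f(2)[OF z] by linarith
  have i: "integrable (stream_space Q) (\<lambda>\<omega>. f (smp z \<omega>))"
    using smp_in f(2) by (intro Om.abs_integral_le(1)[of _ B] measurable_compose[OF measurable_smp1[OF z] f(1)]) auto
  have fB: "\<bar>f v + B\<bar> \<le> 2 * B" "0 \<le> f v + B" if "v \<in> state_set N" for v using f(2)[OF that] by linarith+
  have "(\<Sum>js\<in>JS. \<integral>t. wt z js t * (f (pos z js t) + B) \<partial>Ex)
      = (\<Sum>js\<in>JS. \<integral>t. wt z js t * f (pos z js t) \<partial>Ex) + (\<Sum>js\<in>JS. \<integral>t. wt z js t * B \<partial>Ex)"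
    unfolding distrib_left using iw by (subst sum.distrib[symmetric]) (auto intro!: sum.cong)
  moreover have "(\<Sum>js\<in>JS. \<integral>t. wt z js t * (f (pos z js t) + B) \<partial>Ex) = (\<integral>\<omega>. f (smp z \<omega>) + B \<partial>stream_space Q)"
    using nonneg[of "\<lambda>v. f v + B" "2 * B"] fB f(1) by simp
  moreover have "(\<Sum>js\<in>JS. \<integral>t. wt z js t * B \<partial>Ex) = (\<integral>\<omega>. B \<partial>stream_space Q)"
    using nonneg[of "\<lambda>_. B" B] B0 by simp
  ultimately have "(\<Sum>js\<in>JS. \<integral>t. wt z js t * f (pos z js t) \<partial>Ex) = (\<integral>\<omega>. f (smp z \<omega>) \<partial>stream_space Q)"
    using i by simp
  then show ?thesis unfolding U_op_eq_sum[OF z f(1)] .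
qed

lemma emeasure_smp_eq:
  assumes z: "z \<in> state_set N" and A: "A \<in> sets (state_space N)"
  shows "(\<integral>\<^sup>+\<omega>. indicator A (smp z \<omega>) \<partial>stream_space Q)
    = (\<Sum>js\<in>JS. \<integral>\<^sup>+t. ennreal (wt z js t) * indicator A (pos z js t) \<partial>Ex)"
proof -
  have m: "(\<lambda>t. ennreal (wt z js t) * indicator A (pos z js t)) \<in> borel_measurable Ex" if "js \<in> JS" for js
    using that by (intro borel_measurable_times_ennreal measurable_compose[OF measurable_wt_Ex[OF z] measurable_ennreal]
      measurable_compose[OF measurable_pos_Ex[OF z]] borel_measurable_indicator A)
  show ?thesis
    using nn_integral_smp[OF z borel_measurable_indicator[OF A]] nn_integral_sum[of JS, OF m] by simp
qed

text \<open>\<open>measure_of\<close> sees the set function only on the generated sigma-algebra,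
  where it agrees with that of an actual measure \<open>P\<close>; countable additivity is inherited
  from there.\<close>

lemma P_op_eq:
  assumes \<mu>: "\<mu> \<in> prob_measures N"
    and P: "sets P = sets (state_space N)"
      "\<And>A. A \<in> sets (state_space N) \<Longrightarrow> emeasure P A = (\<integral>\<^sup>+z. \<integral>\<^sup>+\<omega>. indicator A (smp z \<omega>) \<partial>stream_space Q \<partial>\<mu>)"
  shows "P_op N K lam \<Phi> q pb p \<mu> = P"
proof -
  have sp: "space P = state_set N" using sets_eq_imp_space_eq[OF P(1)] by simp
  have sig: "sigma_sets (state_set N) (sets (state_space N)) = sets (state_space N :: ('y \<times> nat) measure)"
    using sets.sigma_sets_eq[of "state_space N :: ('y \<times> nat) measure"] by simp
  have em: "(\<Sum>j\<in>{1..N}. \<Sum>s\<in>{1..K}. \<integral>\<^sup>+ (x, i). (\<integral>\<^sup>+ t\<in>{0..}.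
        ennreal (lam * exp (- (lam * t)) * indicator A (q s (\<Phi> j t x), j) * p i j x * pb s (\<Phi> j t x)) \<partial>lborel) \<partial>\<mu>)
      = emeasure P A" if A: "A \<in> sets (state_space N)" for A
  proof -
    have one: "(\<integral>\<^sup>+ t\<in>{0..}. ennreal (lam * exp (- (lam * t)) * indicator A (q s (\<Phi> j t (fst z)), j) * p (snd z) j (fst z) * pb s (\<Phi> j t (fst z))) \<partial>lborel)
        = (\<integral>\<^sup>+t. ennreal (wt z (j, s) t) * indicator A (pos z (j, s) t) \<partial>Ex)"
      if z: "z \<in> state_set N" and js: "(j, s) \<in> JS" for z j s
    proof -
      have m: "(\<lambda>t. ennreal (wt z (j, s) t) * indicator A (pos z (j, s) t)) \<in> borel_measurable lborel"
        using borel_measurable_times_ennreal[OF measurable_compose[OF measurable_wt_Ex[OF z js] measurable_ennreal]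
          measurable_compose[OF measurable_pos_Ex[OF z js] borel_measurable_indicator[OF A]]] by simp
      have "(\<integral>\<^sup>+t. ennreal (wt z (j, s) t) * indicator A (pos z (j, s) t) \<partial>Ex)
          = (\<integral>\<^sup>+t. ennreal (exponential_density lam t) * (ennreal (wt z (j, s) t) * indicator A (pos z (j, s) t)) \<partial>lborel)"
        unfolding Ex_def by (rule nn_integral_density[OF _ m]) simp
      also have "\<dots> = (\<integral>\<^sup>+ t\<in>{0..}. ennreal (lam * exp (- (lam * t)) * indicator A (q s (\<Phi> j t (fst z)), j) * p (snd z) j (fst z) * pb s (\<Phi> j t (fst z))) \<partial>lborel)"
      proof (rule nn_integral_cong)
        fix t :: real
        show "ennreal (exponential_density lam t) * (ennreal (wt z (j, s) t) * indicator A (pos z (j, s) t))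
            = ennreal (lam * exp (- (lam * t)) * indicator A (q s (\<Phi> j t (fst z)), j) * p (snd z) j (fst z) * pb s (\<Phi> j t (fst z))) * indicator {0..} t"
        proof (cases "0 \<le> t")
          case True
          then have "pos z (j, s) t = (q s (\<Phi> j t (fst z)), j)" "wt z (j, s) t = p (snd z) j (fst z) * pb s (\<Phi> j t (fst z))"
            by (simp_all add: pos_def wt_def Phi_def)
          then show ?thesis
            using True lam wt_bounds(1)[OF z js, of t]
            by (simp add: exponential_density_def ennreal_mult[symmetric] mult_ac split: split_indicator)
        next
          case False
          then show ?thesis by (simp add: exponential_density_def)
        qed
      qed
      finally show ?thesis ..
    qed
    have m: "(\<lambda>z. \<integral>\<^sup>+t. ennreal (wt z js t) * indicator A (pos z js t) \<partial>Ex) \<in> borel_measurable \<mu>" if js: "js \<in> JS" for js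
    proof (rule Ex.borel_measurable_nn_integral)
      have f: "fst \<in> \<mu> \<Otimes>\<^sub>M Ex \<rightarrow>\<^sub>M state_space N"
        using measurable_fst[of \<mu> Ex] by (simp add: measurable_cong_sets[OF refl prob_measuresD(2)[OF \<mu>]])
      have g: "snd \<in> borel_measurable (\<mu> \<Otimes>\<^sub>M Ex)"
        using measurable_snd[of \<mu> Ex] by (simp add: measurable_cong_sets[OF refl sets_Ex])
      show "(\<lambda>(z, t). ennreal (wt z js t) * indicator A (pos z js t)) \<in> borel_measurable (\<mu> \<Otimes>\<^sub>M Ex)"
        unfolding case_prod_beta
        by (intro borel_measurable_times_ennreal measurable_compose[OF measurable_wt[OF f g js] measurable_ennreal]
          measurable_compose[OF measurable_pos[OF f g js] borel_measurable_indicator[OF A]])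
    qed
    have "(\<Sum>j\<in>{1..N}. \<Sum>s\<in>{1..K}. \<integral>\<^sup>+ (x, i). (\<integral>\<^sup>+ t\<in>{0..}.
        ennreal (lam * exp (- (lam * t)) * indicator A (q s (\<Phi> j t x), j) * p i j x * pb s (\<Phi> j t x)) \<partial>lborel) \<partial>\<mu>)
      = (\<Sum>j\<in>{1..N}. \<Sum>s\<in>{1..K}. \<integral>\<^sup>+z. \<integral>\<^sup>+t. ennreal (wt z (j, s) t) * indicator A (pos z (j, s) t) \<partial>Ex \<partial>\<mu>)"
      unfolding case_prod_beta
      by (intro sum.cong refl nn_integral_cong one) (simp_all add: JS_def prob_measuresD(3)[OF \<mu>])
    also have "\<dots> = (\<Sum>js\<in>JS. \<integral>\<^sup>+z. \<integral>\<^sup>+t. ennreal (wt z js t) * indicator A (pos z js t) \<partial>Ex \<partial>\<mu>)"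
      unfolding sum_JS[symmetric, of "\<lambda>j s. \<integral>\<^sup>+z. \<integral>\<^sup>+t. ennreal (wt z (j, s) t) * indicator A (pos z (j, s) t) \<partial>Ex \<partial>\<mu>"] by simp
    also have "\<dots> = (\<integral>\<^sup>+z. (\<Sum>js\<in>JS. \<integral>\<^sup>+t. ennreal (wt z js t) * indicator A (pos z js t) \<partial>Ex) \<partial>\<mu>)"
      by (rule nn_integral_sum[symmetric, OF m])
    also have "\<dots> = (\<integral>\<^sup>+z. \<integral>\<^sup>+\<omega>. indicator A (smp z \<omega>) \<partial>stream_space Q \<partial>\<mu>)"
      by (intro nn_integral_cong emeasure_smp_eq[symmetric] A) (simp add: prob_measuresD(3)[OF \<mu>])
    finally show ?thesis unfolding P(2)[OF A] .
  qed
  have "P_op N K lam \<Phi> q pb p \<mu> = measure_of (state_set N) (sets (state_space N)) (emeasure P)"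
    unfolding P_op_def
    by (rule measure_of_eq) (use em sig sets.space_closed[of "state_space N :: ('y \<times> nat) measure"] in \<open>auto simp del: mem_state_set\<close>)
  also have "\<dots> = P" using measure_of_of_measure[of P] unfolding sp P(1) .
  finally show ?thesis .
qed

end

theorem theorem4p1:
  fixes N K :: nat and lam :: real
    and \<Phi> :: "nat \<Rightarrow> real \<Rightarrow> 'y::polish_space \<Rightarrow> 'y"
    and q :: "nat \<Rightarrow> 'y \<Rightarrow> 'y"
    and pb :: "nat \<Rightarrow> 'y \<Rightarrow> real"
    and p :: "nat \<Rightarrow> nat \<Rightarrow> 'y \<Rightarrow> real"
    and xs :: 'y
    and Lp Lpb L \<alpha> Lq p0 q0 :: real
  assumes "N \<ge> 1" and "K \<ge> 1" and "lam > 0"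
    and "\<And>i. i \<in> {1..N} \<Longrightarrow> semidynamical_system (\<Phi> i)"
    and "\<And>s. s \<in> {1..K} \<Longrightarrow> continuous_on UNIV (q s)"
    and "probability_vector K pb"
    and "probability_matrix N p"
    and A1: "\<And>j s. j \<in> {1..N} \<Longrightarrow> s \<in> {1..K} \<Longrightarrow>
      (\<integral>\<^sup>+ t\<in>{0..}. ennreal (exp (- (lam * t)) * dist (q s (\<Phi> j t xs)) (q s xs)) \<partial>lborel) < \<infinity>"
    and "Lp > 0" and "Lpb > 0"
    and A2_p: "\<And>x y i. i \<in> {1..N} \<Longrightarrow> (\<Sum>j\<in>{1..N}. \<bar>p i j x - p i j y\<bar>) \<le> Lp * dist x y"
    and A2_pb: "\<And>x y. (\<Sum>s\<in>{1..K}. \<bar>pb s x - pb s y\<bar>) \<le> Lpb * dist x y"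
    and "L \<ge> 1" and "Lq > 0"
    and A3_\<Phi>: "\<And>x y i t. i \<in> {1..N} \<Longrightarrow> t \<ge> 0 \<Longrightarrow>
      (\<Sum>j\<in>{1..N}. p i j y * dist (\<Phi> j t x) (\<Phi> j t y)) \<le> L * exp (\<alpha> * t) * dist x y"
    and A3_q: "\<And>x y. (\<Sum>s\<in>{1..K}. pb s x * dist (q s x) (q s y)) \<le> Lq * dist x y"
    and "p0 > 0" and "q0 > 0"
    and A4_\<Phi>: "\<And>i1 i2 x y t. i1 \<in> {1..N} \<Longrightarrow> i2 \<in> {1..N} \<Longrightarrow> t \<ge> 0 \<Longrightarrow>
      (\<Sum>j\<in>{j \<in> {1..N}. dist (\<Phi> j t x) (\<Phi> j t y) \<le> L * exp (\<alpha> * t) * dist x y}.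
         p i1 j x * p i2 j y) > p0"
    and A4_q: "\<And>x y.
      (\<Sum>s\<in>{s \<in> {1..K}. dist (q s x) (q s y) \<le> Lq * dist x y}. pb s x * pb s y) > q0"
    and A5: "L * Lq + \<alpha> / lam < 1"
  shows "\<exists>\<mu>\<^sub>0.
      \<mu>\<^sub>0 \<in> prob_measures1 N \<and>
      invariant_measure N K lam \<Phi> q pb p \<mu>\<^sub>0 \<and>
      (\<forall>\<nu>\<in>prob_measures1 N. invariant_measure N K lam \<Phi> q pb p \<nu> \<longrightarrow> \<nu> = \<mu>\<^sub>0) \<and>
      attractive_measure N K lam \<Phi> q pb p \<mu>\<^sub>0 \<and>
      (\<exists>r\<in>{0<..<1}. \<exists>C>0. \<forall>\<mu>\<in>prob_measures1 N. \<forall>n.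
         FM_dist N ((P_op N K lam \<Phi> q pb p ^^ n) \<mu>) \<mu>\<^sub>0
           \<le> r ^ n * C * (1 + (\<integral>z. dist (fst z) xs \<partial>\<mu>))) \<and>
      (\<forall>f. bounded (f ` state_set N) \<and>
           (\<exists>c. \<forall>z\<in>state_set N. \<forall>w\<in>state_set N. \<bar>f z - f w\<bar> \<le> c * state_dist z w) \<longrightarrow>
         (\<forall>x0. \<forall>\<xi>0\<in>{1..N}. AE \<omega> in chain_law N K lam \<Phi> q pb p (x0, \<xi>0).
            (\<lambda>n. 1 / real n * (\<Sum>k<n. f (\<omega> k))) \<longlonglongrightarrow> (\<integral>z. f z \<partial>\<mu>\<^sub>0)))"
proof -
  interpret contractive_jump_process N K lam \<Phi> q pb p Lp Lpb xs L \<alpha> Lq p0 q0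
    by (rule contractive_jump_process.intro[OF jump_process.intro contractive_jump_process_axioms.intro]) (fact assms)+
  obtain ct r \<eta> where "contractive_maps (stream_space Q) N smp xs ct r a b \<eta>"
    using ex_contractive_maps by blast
  then interpret CM: contractive_maps "stream_space Q" N smp xs ct r a b \<eta> .
  let ?P = "P_op N K lam \<Phi> q pb p" and ?U = "U_op N K lam \<Phi> q pb p"
  have P_eq: "?P \<mu> = CM.Pmap \<mu>" if "\<mu> \<in> prob_measures N" for \<mu>
    by (rule P_op_eq[OF that _ CM.emeasure_Pmap[OF that]]) (simp_all add: CM.Pmap_def)
  have P_pow_eq: "(?P ^^ n) \<mu> = (CM.Pmap ^^ n) \<mu>" if "\<mu> \<in> prob_measures N" for n \<mu>
    by (induction n) (simp_all add: P_eq[OF CM.Pmap_pow_in[OF that]])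
  have U_eq: "?U f z = CM.Ufun f z" if f: "CM.bdd_meas f" and z: "z \<in> state_set N" for f z
  proof -
    obtain B where "\<And>z. z \<in> state_set N \<Longrightarrow> \<bar>f z\<bar> \<le> B" using f unfolding CM.bdd_meas_def by blast
    then show ?thesis
      unfolding CM.Ufun_def using U_op_eq[OF z CM.bdd_measD[OF f]] by blast
  qed
  have U_pow_eq: "(?U ^^ n) f z = (CM.Ufun ^^ n) f z" if f: "CM.bdd_meas f" and z: "z \<in> state_set N" for n f z
    using z
  proof (induction n arbitrary: z)
    case (Suc n)
    have "?U ((?U ^^ n) f) z = ?U ((CM.Ufun ^^ n) f) z" by (rule U_op_cong) (rule Suc.IH)
    also have "\<dots> = CM.Ufun ((CM.Ufun ^^ n) f) z" by (rule U_eq[OF CM.bdd_meas_Ufun_pow[OF f] Suc.prems])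
    finally show ?case by simp
  qed simp
  show ?thesis
  proof (intro exI[of _ CM.\<mu>0] conjI ballI allI impI)
    show "CM.\<mu>0 \<in> prob_measures1 N" by (rule CM.mu0_in1)
    show "invariant_measure N K lam \<Phi> q pb p CM.\<mu>0"
      unfolding invariant_measure_def using CM.mu0_in P_eq[OF CM.mu0_in] CM.Pmap_mu0 by simp
    show "\<nu> = CM.\<mu>0" if "invariant_measure N K lam \<Phi> q pb p \<nu>" for \<nu>
      using that P_eq[of \<nu>] unfolding invariant_measure_def by (intro CM.Pmap_invariant_unique) auto
    show "attractive_measure N K lam \<Phi> q pb p CM.\<mu>0"
      unfolding attractive_measure_def
    proof (intro allI impI ballI)
      fix f :: "'y \<times> nat \<Rightarrow> real" and \<mu> :: "('y \<times> nat) measure"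
      assume f: "continuous_on (state_set N) f \<and> bounded (f ` state_set N)" and \<mu>: "\<mu> \<in> prob_measures N"
      then have bm: "CM.bdd_meas f" by (intro CM.bdd_meas_continuous) auto
      have "(\<integral>z. (?U ^^ n) f z \<partial>\<mu>) = (\<integral>z. (CM.Ufun ^^ n) f z \<partial>\<mu>)" for n
        by (intro Bochner_Integration.integral_cong refl U_pow_eq[OF bm]) (simp add: prob_measuresD(3)[OF \<mu>])
      then show "(\<lambda>n. \<integral>z. (?U ^^ n) f z \<partial>\<mu>) \<longlonglongrightarrow> (\<integral>z. f z \<partial>CM.\<mu>0)"
        using CM.integral_Ufun_pow_tendsto[OF _ _ \<mu>, of f] f by simp
    qed
    show "\<exists>r\<in>{0<..<1}. \<exists>C>0. \<forall>\<mu>\<in>prob_measures1 N. \<forall>n.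
         FM_dist N ((?P ^^ n) \<mu>) CM.\<mu>0 \<le> r ^ n * C * (1 + (\<integral>z. dist (fst z) xs \<partial>\<mu>))"
    proof (intro bexI[of _ r] exI[of _ "2 / \<eta> * (1 + b / (1 - a))"] conjI ballI allI)
      show "0 < 2 / \<eta> * (1 + b / (1 - a))"
        using CM.\<eta> a_bounds b_nonneg by (intro mult_pos_pos add_pos_nonneg) auto
      show "r \<in> {0<..<1}" using CM.r by simp
      fix \<mu> :: "('y \<times> nat) measure" and n assume \<mu>: "\<mu> \<in> prob_measures1 N"
      then have "\<mu> \<in> prob_measures N" by (simp add: prob_measures1_def)
      from CM.FM_dist_Pmap_pow[OF \<mu>, of n] show "FM_dist N ((?P ^^ n) \<mu>) CM.\<mu>0
          \<le> r ^ n * (2 / \<eta> * (1 + b / (1 - a))) * (1 + (\<integral>z. dist (fst z) xs \<partial>\<mu>))"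
        unfolding P_pow_eq[OF \<open>\<mu> \<in> prob_measures N\<close>] .
    qed
  next
    fix f :: "'y \<times> nat \<Rightarrow> real" and x0 :: 'y and \<xi>0 :: nat
    assume f: "bounded (f ` state_set N) \<and>
        (\<exists>c. \<forall>z\<in>state_set N. \<forall>w\<in>state_set N. \<bar>f z - f w\<bar> \<le> c * state_dist z w)"
      and \<xi>0: "\<xi>0 \<in> {1..N}"
    then obtain c where c: "\<And>z w. z \<in> state_set N \<Longrightarrow> w \<in> state_set N \<Longrightarrow> \<bar>f z - f w\<bar> \<le> c * state_dist z w"
      by blast
    have z0: "(x0, \<xi>0) \<in> state_set N" using \<xi>0 by (simp only: mem_state_set snd_conv)
    \<comment> \<open>The path law is tied to the sampler through its kernels: applied to a point
      mass, \<open>P_op\<close> gives the law of \<open>smp\<close> at that point.\<close>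
    interpret CC: contractive_chain "stream_space Q" N smp xs ct r a b \<eta> "chain_step N K lam \<Phi> q pb p (x0, \<xi>0)" "(x0, \<xi>0)"
    proof (rule contractive_chain.intro[OF CM.contractive_maps_axioms], rule contractive_chain_axioms.intro[OF z0])
      show "chain_step N K lam \<Phi> q pb p (x0, \<xi>0) 0 \<omega> = return (state_space N) (x0, \<xi>0)" for \<omega>
        by (simp add: chain_step_def)
      fix m and \<omega> :: "nat \<Rightarrow> 'y \<times> nat" assume \<omega>: "\<omega> m \<in> state_set N"
      have "return (state_space N) (\<omega> m) \<in> prob_measures N"
        using \<omega> by (auto simp: prob_measures_def intro!: prob_space_return simp del: mem_state_set)
      then show "chain_step N K lam \<Phi> q pb p (x0, \<xi>0) (Suc m) \<omega> = distr (stream_space Q) (state_space N) (smp (\<omega> m))"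
        by (simp add: chain_step_def P_eq CM.Pmap_return[OF \<omega>])
    qed
    show "AE \<omega> in chain_law N K lam \<Phi> q pb p (x0, \<xi>0).
        (\<lambda>n. 1 / real n * (\<Sum>k<n. f (\<omega> k))) \<longlonglongrightarrow> (\<integral>z. f z \<partial>CM.\<mu>0)"
      unfolding chain_law_def by (rule CC.strong_law[OF conjunct1[OF f] c])
  qed
qed

end
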